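(* Let $\alpha>1$ and $\sigma_0>0$, and let $u_0\in G^{\sigma_0,\frac{\alpha}{2}}(\mathbb{R})$ be real-valued. Then the fractional BBM equation $$u_t+D^\alpha u_t+u_x+uu_x=0,\qquad u(0,x)=u_0(x),\qquad x\in\mathbb{R},$$ has a global solution $u\in C([0,\infty);G^{\sigma(t),\frac{\alpha}{2}}(\mathbb{R}))$ for some non-increasing function $\sigma:[0,\infty)\to(0,\infty)$ with $$\sigma(t)\ge c\,t^{-\mu}\qquad\text{as } t\to\infty\text{ (i.e. for all sufficiently large } t),$$ where $c>0$ depends only on $\sigma_0$ and $\|u_0\|_{G^{\sigma_0,\frac{\alpha}{2}}}$ (for the given $\alpha$), and $$\mu=\begin{cases}\dfrac{2}{3(\alpha-1)} & \text{if } 1<\alpha<\frac73,\\[2mm] \dfrac12 & \text{if }\alpha\ge\frac73.\end{cases}$$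
   Context: The Fourier transform is $\widehat f(\xi)=\int_{\mathbb{R}}e^{-ix\xi}f(x)\,dx$. The operator $D^\alpha$ is defined by $D^\alpha u=\mathcal{F}^{-1}(|\xi|^\alpha\widehat u(\xi))$. For $\sigma\ge0$ and $s\in\mathbb{R}$, $G^{\sigma,s}(\mathbb{R})$ is the Banach space with norm $\|u\|_{G^{\sigma,s}}=\|(1+|\xi|)^se^{\sigma|\xi|}\widehat u\|_{L^2(\mathbb{R})}$. The equation is understood in the equivalent integral form $u(t)=e^{-t\varphi(D)}u_0-\frac12\int_0^te^{-(t-\tau)\varphi(D)}\varphi(D)(u^2)(\tau)\,d\tau$, where $\varphi(D)=\partial_x(1+D^\alpha)^{-1}$ is the Fourier multiplier with symbol $i\xi/(1+|\xi|^\alpha)$. The notation $u\in C([0,\infty);G^{\sigma(t),\alpha/2})$ with $\sigma$ non-increasing means: $u(t)\in G^{\sigma(t),\alpha/2}$ for all $t\ge0$, and for every $T>0$ the map $t\mapsto u(t)$ is continuous from $[0,T]$ into $G^{\sigma(T),\alpha/2}$. *)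

theory Defs
  imports "HOL-Analysis.Analysis"
begin

text \<open>Elements of \<open>L\<^sup>2(\<real>)\<close> are represented by Borel measurable functions; all notions below are
  insensitive to changes on null sets.\<close>

definition L2 :: "(real \<Rightarrow> complex) set" where
  "L2 = {f \<in> borel_measurable lborel. integrable lborel (\<lambda>x. (cmod (f x))\<^sup>2)}"

definition L2_norm :: "(real \<Rightarrow> complex) \<Rightarrow> real" where
  "L2_norm f = sqrt (LINT x|lborel. (cmod (f x))\<^sup>2)"

definition fourier_integral :: "(real \<Rightarrow> complex) \<Rightarrow> real \<Rightarrow> complex" where
  "fourier_integral f \<xi> = (LINT x|lborel. exp (- \<i> * of_real (x * \<xi>)) * f x)"

text \<open>The transform on \<open>L\<^sup>2\<close> is the \<open>L\<^sup>2\<close>-limit of the transforms of the truncations, which lie in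
  \<open>L\<^sup>1 \<inter> L\<^sup>2\<close>. As it is determined only up to null sets, it is a relation first, and the
  operators below select representatives.\<close>

definition is_fourier :: "(real \<Rightarrow> complex) \<Rightarrow> (real \<Rightarrow> complex) \<Rightarrow> bool" where
  "is_fourier f g \<longleftrightarrow> f \<in> L2 \<and> g \<in> L2 \<and>
     ((\<lambda>R. \<integral>\<^sup>+ \<xi>. ennreal ((cmod (fourier_integral (\<lambda>x. indicator {-R..R} x * f x) \<xi> - g \<xi>))\<^sup>2) \<partial>lborel)
        \<longlongrightarrow> 0) at_top"

definition fourier :: "(real \<Rightarrow> complex) \<Rightarrow> real \<Rightarrow> complex" where
  "fourier f = (SOME g. is_fourier f g)"

definition inv_fourier :: "(real \<Rightarrow> complex) \<Rightarrow> real \<Rightarrow> complex" where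
  "inv_fourier g = (SOME f. is_fourier f g)"

definition fourier_multiplier :: "(real \<Rightarrow> complex) \<Rightarrow> (real \<Rightarrow> complex) \<Rightarrow> real \<Rightarrow> complex" where
  "fourier_multiplier m f = inv_fourier (\<lambda>\<xi>. m \<xi> * fourier f \<xi>)"

text \<open>Spaces \<open>G\<^bsup>\<sigma>,s\<^esup>\<close>, realised inside \<open>L\<^sup>2\<close>. For \<open>\<sigma> > 0\<close> (and for \<open>\<sigma> = 0\<close>, \<open>s \<ge> 0\<close>) the weight is
  bounded below, so that this loses nothing; the remaining case \<open>\<sigma> = 0\<close>, \<open>s < 0\<close>, where the space
  contains distributions outside \<open>L\<^sup>2\<close>, is not covered.\<close>

definition gevrey_weighted :: "real \<Rightarrow> real \<Rightarrow> (real \<Rightarrow> complex) \<Rightarrow> real \<Rightarrow> complex" where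
  "gevrey_weighted \<sigma> s u \<xi> = of_real ((1 + \<bar>\<xi>\<bar>) powr s * exp (\<sigma> * \<bar>\<xi>\<bar>)) * fourier u \<xi>"

definition gevrey :: "real \<Rightarrow> real \<Rightarrow> (real \<Rightarrow> complex) set" where
  "gevrey \<sigma> s = {u \<in> L2. gevrey_weighted \<sigma> s u \<in> L2}"

definition gevrey_norm :: "real \<Rightarrow> real \<Rightarrow> (real \<Rightarrow> complex) \<Rightarrow> real" where
  "gevrey_norm \<sigma> s u = L2_norm (gevrey_weighted \<sigma> s u)"

text \<open>\<open>u \<in> C([0,\<infinity>); G\<^bsup>\<sigma>(t),s\<^esup>)\<close> for non-increasing \<open>\<sigma>\<close>.\<close>

definition continuous_gevrey :: "(real \<Rightarrow> real) \<Rightarrow> real \<Rightarrow> (real \<Rightarrow> real \<Rightarrow> complex) \<Rightarrow> bool" where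
  "continuous_gevrey \<sigma> s u \<longleftrightarrow>
     (\<forall>t\<ge>0. u t \<in> gevrey (\<sigma> t) s) \<and>
     (\<forall>T>0. \<forall>t\<in>{0..T}. u t \<in> gevrey (\<sigma> T) s \<and>
        ((\<lambda>r. gevrey_norm (\<sigma> T) s (\<lambda>x. u r x - u t x)) \<longlongrightarrow> 0) (at t within {0..T}))"

text \<open>Integral of an \<open>L\<^sup>2\<close>-valued function of time: the library's \<open>has_integral\<close> on a compact
  interval with the \<open>L\<^sup>2\<close> norm in place of the type class norm. For continuous integrands with
  values in \<open>G\<^bsup>\<sigma>,s\<^esup>\<close>, \<open>\<sigma> > 0\<close>, it agrees with the integral in \<open>G\<^bsup>\<sigma>,s\<^esup>\<close>, which embeds continuously.\<close>

definition has_L2_integral ::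
    "(real \<Rightarrow> real \<Rightarrow> complex) \<Rightarrow> (real \<Rightarrow> complex) \<Rightarrow> real \<Rightarrow> real \<Rightarrow> bool" where
  "has_L2_integral f I a b \<longleftrightarrow>
     I \<in> L2 \<and> (\<forall>\<tau>\<in>{a..b}. f \<tau> \<in> L2) \<and>
     (\<forall>e>0. \<exists>\<gamma>. gauge \<gamma> \<and>
        (\<forall>\<D>. \<D> tagged_division_of {a..b} \<and> \<gamma> fine \<D> \<longrightarrow>
           L2_norm (\<lambda>x. (\<Sum>(\<tau>, k)\<in>\<D>. measure lborel k *\<^sub>R f \<tau> x) - I x) < e))"

text \<open>Symbol of \<open>\<phi>(D) = \<partial>\<^sub>x (1 + D\<^sup>\<alpha>)\<^sup>-\<^sup>1\<close>, where \<open>D\<^sup>\<alpha>\<close> has symbol \<open>\<bar>\<xi>\<bar>\<^sup>\<alpha>\<close>.\<close>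

definition bbm_symbol :: "real \<Rightarrow> real \<Rightarrow> complex" where
  "bbm_symbol \<alpha> \<xi> = \<i> * of_real \<xi> / of_real (1 + \<bar>\<xi>\<bar> powr \<alpha>)"

definition bbm_propagator :: "real \<Rightarrow> real \<Rightarrow> (real \<Rightarrow> complex) \<Rightarrow> real \<Rightarrow> complex" where
  "bbm_propagator \<alpha> t = fourier_multiplier (\<lambda>\<xi>. exp (- of_real t * bbm_symbol \<alpha> \<xi>))"

text \<open>Global solutions of \<open>u\<^sub>t + D\<^sup>\<alpha> u\<^sub>t + u\<^sub>x + u u\<^sub>x = 0\<close>, \<open>u(0) = u\<^sub>0\<close>, in the integral (Duhamel) form.\<close>

definition fractional_bbm_solution ::
    "real \<Rightarrow> (real \<Rightarrow> complex) \<Rightarrow> (real \<Rightarrow> real \<Rightarrow> complex) \<Rightarrow> bool" where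
  "fractional_bbm_solution \<alpha> u\<^sub>0 u \<longleftrightarrow>
     (\<forall>t\<ge>0. \<exists>I.
        has_L2_integral
          (\<lambda>\<tau>. bbm_propagator \<alpha> (t - \<tau>) (fourier_multiplier (bbm_symbol \<alpha>) (\<lambda>x. (u \<tau> x)\<^sup>2))) I 0 t \<and>
        (AE x in lborel. u t x = bbm_propagator \<alpha> t u\<^sub>0 x - (1 / 2) * I x))"

definition decay_exponent :: "real \<Rightarrow> real" where
  "decay_exponent \<alpha> = (if \<alpha> < 7 / 3 then 2 / (3 * (\<alpha> - 1)) else 1 / 2)"

end

(* On the Fourier side the equation is an ordinary differential equation with a quadratic, locally
   Lipschitz vector field in the Hilbert space L^2 of V = sqrt(1 + |xi|^alpha) cosh(sigma xi) u^(xi).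
   Because cosh(a + b) = cosh a cosh b (1 + tanh a tanh b), the derivative of |V|^2 splits into the
   Fourier form of the integral of u^2 u_x, which vanishes, and a cubic term with the factor
   tanh(sigma eta) tanh(sigma (xi - eta)).  Using |tanh x| <= |x|^theta with 2 theta = 1/mu, the largest
   theta <= 1 for which the remaining homogeneous kernel is bounded on L^2 (alpha = 7/3 gives theta = 1),
   this term is O(sigma^(1/mu) |V|^3).  Hence |V| stays bounded up to a time T of order sigma^(-1/mu),
   so sigma(T) may be taken of order T^(-mu).  The solutions for different sigma agree by uniqueness,
   and u solves Duhamel's formula by the Plancherel theorem. *)

theory Submission
  imports Defs "HOL-Probability.Probability"
begin

subsection \<open>The Hilbert space of square integrable functions\<close>

text \<open>The exponent comes from scaling. After the bound on tanh the cubic form has the kernel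
  |xi|^p |eta|^q |xi - eta|^q with p = 1 - a/2 and q = theta - a/2, and only a kernel of degree -1/2
  can be bounded by the cube of the L^2 norm. The relation p + 2q = -1/2 gives theta = 3(a - 1)/4.
  For a = alpha > 7/3 this would exceed 1, where |tanh x| <= |x|^theta fails near 0, so only a = 7/3
  of the available powers is spent. The obstacle is that sigma has to decrease in time while each
  energy estimate has a fixed sigma. Therefore u is built once, from sigma = 0, where the cubic
  remainder vanishes and the H^(alpha/2) energy bounds the solution for all times. The solution for
  the weight sigma(T) serves only to show how regular this u is on [0,T]. The transforms in the
  definitions select representatives by choice. The analysis is carried out on classes modulo null
  sets, in the type \<open>ltwo\<close>, and \<open>is_fourier_iff\<close> connects the two
  levels.\<close>

lemma L2_measurable [measurable_dest]: "f \<in> L2 \<Longrightarrow> f \<in> borel_measurable borel"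
  by (auto simp: L2_def)

lemma L2_integrable: "f \<in> L2 \<Longrightarrow> integrable lborel (\<lambda>x. (cmod (f x))\<^sup>2)"
  by (auto simp: L2_def)

lemma L2_iff_nn_integral:
  "f \<in> L2 \<longleftrightarrow> f \<in> borel_measurable borel \<and> (\<integral>\<^sup>+ x. ennreal ((cmod (f x))\<^sup>2) \<partial>lborel) < \<infinity>"
  by (auto simp: L2_def integrable_iff_bounded)

lemma L2_norm_nonneg [simp]: "0 \<le> L2_norm f"
  by (simp add: L2_norm_def)

lemma L2_norm_power2: "(L2_norm f)\<^sup>2 = (LINT x|lborel. (cmod (f x))\<^sup>2)"
  by (simp add: L2_norm_def)

lemma nn_integral_L2_norm:
  "f \<in> L2 \<Longrightarrow> (\<integral>\<^sup>+ x. ennreal ((cmod (f x))\<^sup>2) \<partial>lborel) = ennreal ((L2_norm f)\<^sup>2)"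
  unfolding L2_norm_power2 by (rule nn_integral_eq_integral) (auto simp: L2_integrable)

lemma L2_norm_le:
  assumes "f \<in> borel_measurable borel" "0 \<le> c" "(\<integral>\<^sup>+ x. ennreal ((cmod (f x))\<^sup>2) \<partial>lborel) \<le> ennreal (c\<^sup>2)"
  shows "f \<in> L2" "L2_norm f \<le> c"
proof -
  show f: "f \<in> L2"
    using assms by (auto simp: L2_iff_nn_integral intro: le_less_trans)
  show "L2_norm f \<le> c"
    using assms nn_integral_L2_norm[OF f] by (auto intro: power2_le_imp_le)
qed

lemma L2_bound:
  assumes "f \<in> borel_measurable borel" "g \<in> L2" "AE x in lborel. cmod (f x) \<le> c * cmod (g x)" "0 \<le> c"
  shows "f \<in> L2" "L2_norm f \<le> c * L2_norm g"
proof -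
  note [measurable] = assms(1)
  have "(\<integral>\<^sup>+ x. ennreal ((cmod (f x))\<^sup>2) \<partial>lborel) \<le> (\<integral>\<^sup>+ x. ennreal (c\<^sup>2) * ennreal ((cmod (g x))\<^sup>2) \<partial>lborel)"
    using assms(3)
  proof (intro nn_integral_mono_AE, eventually_elim)
    case (elim x)
    then have "(cmod (f x))\<^sup>2 \<le> (c * cmod (g x))\<^sup>2" by (intro power_mono) auto
    then show ?case by (simp add: power_mult_distrib flip: ennreal_mult)
  qed
  also have "\<dots> = ennreal ((c * L2_norm g)\<^sup>2)"
    using assms(2) by (simp add: nn_integral_cmult nn_integral_L2_norm power_mult_distrib ennreal_mult)
  finally show "f \<in> L2" "L2_norm f \<le> c * L2_norm g"
    using L2_norm_le[OF assms(1), of "c * L2_norm g"] assms(4) by auto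
qed

lemma L2_cong_AE:
  assumes "f \<in> L2" "g \<in> borel_measurable borel" "AE x in lborel. g x = f x"
  shows "g \<in> L2" "L2_norm g = L2_norm f"
proof -
  have "AE x in lborel. cmod (g x) \<le> 1 * cmod (f x)" "AE x in lborel. cmod (f x) \<le> 1 * cmod (g x)"
    using assms(3) by (eventually_elim, simp)+
  note * = this
  show g: "g \<in> L2" using L2_bound(1)[of g f 1] assms * by auto
  show "L2_norm g = L2_norm f"
    using L2_bound(2)[OF assms(2,1) *(1)] L2_bound(2)[OF L2_measurable[OF assms(1)] g *(2)] by simp
qed

lemma borel_measurable_cnj [measurable]: "cnj \<in> borel_measurable borel"
  by (intro borel_measurable_continuous_onI continuous_intros)

lemma L2_0 [simp]: "(\<lambda>x. 0) \<in> L2" by (simp add: L2_def)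

lemma L2_scaleR: "f \<in> L2 \<Longrightarrow> (\<lambda>x. c *\<^sub>R f x) \<in> L2"
  by (rule L2_bound(1)[of _ f "\<bar>c\<bar>"]) auto

lemma L2_cnj: "f \<in> L2 \<Longrightarrow> (\<lambda>x. cnj (f x)) \<in> L2"
  by (rule L2_bound(1)[of _ f 1]) auto

lemma L2_uminus: "f \<in> L2 \<Longrightarrow> (\<lambda>x. - f x) \<in> L2"
  by (rule L2_bound(1)[of _ f 1]) auto

lemma L2_norm_cnj: "L2_norm (\<lambda>x. cnj (f x)) = L2_norm f"
  by (simp add: L2_norm_def)

lemma power2_norm_add_le: "(norm (x + y))\<^sup>2 \<le> 2 * (norm x)\<^sup>2 + 2 * (norm (y :: 'a :: real_normed_vector))\<^sup>2"
proof -
  have "(norm (x + y))\<^sup>2 \<le> (norm x + norm y)\<^sup>2" by (simp add: norm_triangle_ineq power_mono)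
  also have "\<dots> \<le> 2 * (norm x)\<^sup>2 + 2 * (norm y)\<^sup>2"
    using sum_squares_bound[of "norm x" "norm y"] by (simp add: power2_sum)
  finally show ?thesis .
qed

lemma L2_add:
  assumes "f \<in> L2" "g \<in> L2" shows "(\<lambda>x. f x + g x) \<in> L2"
proof -
  note [measurable] = assms[THEN L2_measurable]
  have "integrable lborel (\<lambda>x. (cmod (f x + g x))\<^sup>2)"
  proof (rule Bochner_Integration.integrable_bound)
    show "integrable lborel (\<lambda>x. 2 * (cmod (f x))\<^sup>2 + 2 * (cmod (g x))\<^sup>2)"
      using assms by (simp add: L2_integrable)
    show "AE x in lborel. norm ((cmod (f x + g x))\<^sup>2) \<le> norm (2 * (cmod (f x))\<^sup>2 + 2 * (cmod (g x))\<^sup>2)"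
      by (rule AE_I2) (simp add: power2_norm_add_le)
  qed measurable
  then show ?thesis by (simp add: L2_def)
qed

lemma L2_diff: "f \<in> L2 \<Longrightarrow> g \<in> L2 \<Longrightarrow> (\<lambda>x. f x - g x) \<in> L2"
  using L2_add[of f "\<lambda>x. - g x"] L2_uminus[of g] by simp

lemma L2_sum: "(\<And>i. i \<in> I \<Longrightarrow> f i \<in> L2) \<Longrightarrow> (\<lambda>x. \<Sum>i\<in>I. f i x) \<in> L2"
  by (induction I rule: infinite_finite_induct) (auto intro!: L2_add)

lemma L2_mult_integrable:
  assumes "f \<in> L2" "g \<in> L2" shows "integrable lborel (\<lambda>x. f x * g x)"
proof (rule Bochner_Integration.integrable_bound)
  show "integrable lborel (\<lambda>x. (cmod (f x))\<^sup>2 + (cmod (g x))\<^sup>2)"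
    using assms by (auto simp: L2_integrable)
  have "norm (f x * g x) \<le> norm ((cmod (f x))\<^sup>2 + (cmod (g x))\<^sup>2)" for x
  proof -
    have "0 \<le> cmod (f x) * cmod (g x)" by simp
    then have "cmod (f x) * cmod (g x) \<le> (cmod (f x))\<^sup>2 + (cmod (g x))\<^sup>2"
      using sum_squares_bound[of "cmod (f x)" "cmod (g x)"] by linarith
    then show ?thesis by (simp add: norm_mult)
  qed
  then show "AE x in lborel. norm (f x * g x) \<le> norm ((cmod (f x))\<^sup>2 + (cmod (g x))\<^sup>2)" by simp
qed (use assms in measurable)

section \<open>Square integrable functions modulo null sets, as a complete real inner product
  space\<close>

definition L2_eq :: "(real \<Rightarrow> complex) \<Rightarrow> (real \<Rightarrow> complex) \<Rightarrow> bool" where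
  "L2_eq f g \<longleftrightarrow> f \<in> L2 \<and> g \<in> L2 \<and> (AE x in lborel. f x = g x)"

lemma part_equivp_L2_eq: "part_equivp L2_eq"
proof (rule part_equivpI)
  show "\<exists>f. L2_eq f f"
    by (rule exI[of _ "\<lambda>x. 0"]) (simp add: L2_eq_def)
  show "symp L2_eq"
    by (auto simp: symp_def L2_eq_def eq_commute)
  show "transp L2_eq"
  proof (rule transpI)
    fix f g h :: "real \<Rightarrow> complex"
    assume fg: "L2_eq f g" and gh: "L2_eq g h"
    then have "AE x in lborel. f x = g x" "AE x in lborel. g x = h x"
      by (auto simp: L2_eq_def)
    then have "AE x in lborel. f x = h x" by eventually_elim simp
    then show "L2_eq f h" using fg gh by (simp add: L2_eq_def)
  qed
qed

\<comment> \<open>\<open>L2_eq\<close> relates no function outside \<open>L2\<close> to itself, so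
  the partial quotient consists exactly of the classes of square integrable functions. On other
  functions \<open>lt\<close> has no useful value.\<close>
quotient_type ltwo = "real \<Rightarrow> complex" / partial: L2_eq
  by (rule part_equivp_L2_eq)

text \<open>\<open>fn\<close> picks an arbitrary representative. Identities between representatives
  therefore hold only almost everywhere, and the algebraic laws below are checked on the
  intersection of finitely many sets of full measure.\<close>

abbreviation "lt \<equiv> abs_ltwo"
abbreviation "fn \<equiv> rep_ltwo"

lemma lt_fn [simp]: "lt (fn V) = V"
  by (rule Quotient3_abs_rep[OF Quotient3_ltwo])

lemma fn_L2 [simp]: "fn V \<in> L2"
  using Quotient3_rep_reflp[OF Quotient3_ltwo, of V] by (simp add: L2_eq_def)

lemma fn_measurable [measurable]: "fn V \<in> borel_measurable borel"
  using L2_measurable[OF fn_L2] .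

lemma fn_lt: "f \<in> L2 \<Longrightarrow> AE x in lborel. fn (lt f) x = f x"
  using Quotient3_rep_abs[OF Quotient3_ltwo, of f] by (simp add: L2_eq_def)

lemma lt_eqI: "f \<in> L2 \<Longrightarrow> g \<in> L2 \<Longrightarrow> AE x in lborel. f x = g x \<Longrightarrow> lt f = lt g"
  using Quotient3_rel[OF Quotient3_ltwo, of f g] by (simp add: L2_eq_def)

lemma ltwo_eqI: "AE x in lborel. fn V x = fn W x \<Longrightarrow> V = W"
  using lt_eqI[of "fn V" "fn W"] by simp

instantiation ltwo :: real_vector
begin

definition zero_ltwo where "0 = lt (\<lambda>x. 0)"
definition plus_ltwo where "V + W = lt (\<lambda>x. fn V x + fn W x)"
definition minus_ltwo where "V - W = lt (\<lambda>x. fn V x - fn W x)"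
definition uminus_ltwo where "- V = lt (\<lambda>x. - fn V x)"
definition scaleR_ltwo where "c *\<^sub>R V = lt (\<lambda>x. c *\<^sub>R fn V x)"

lemma fn_zero: "AE x in lborel. fn 0 x = 0"
  unfolding zero_ltwo_def by (rule fn_lt) simp

lemma fn_add: "AE x in lborel. fn (V + W) x = fn V x + fn W x"
  unfolding plus_ltwo_def by (rule fn_lt) (simp add: L2_add)

lemma fn_diff: "AE x in lborel. fn (V - W) x = fn V x - fn W x"
  unfolding minus_ltwo_def by (rule fn_lt) (simp add: L2_diff)

lemma fn_uminus: "AE x in lborel. fn (- V) x = - fn V x"
  unfolding uminus_ltwo_def by (rule fn_lt) (simp add: L2_uminus)

lemma fn_scaleR: "AE x in lborel. fn (c *\<^sub>R V) x = c *\<^sub>R fn V x"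
  unfolding scaleR_ltwo_def by (rule fn_lt) (simp add: L2_scaleR)

instance
proof
  fix U V W :: ltwo and c d :: real
  show "U + V + W = U + (V + W)"
    by (rule ltwo_eqI) (use fn_add[of "U + V" W] fn_add[of U V] fn_add[of U "V + W"] fn_add[of V W] in eventually_elim, simp)
  show "V + W = W + V"
    by (rule ltwo_eqI) (use fn_add[of V W] fn_add[of W V] in eventually_elim, simp)
  show "0 + V = V"
    by (rule ltwo_eqI) (use fn_add[of 0 V] fn_zero in eventually_elim, simp)
  show "- V + V = 0"
    by (rule ltwo_eqI) (use fn_add[of "- V" V] fn_uminus[of V] fn_zero in eventually_elim, simp)
  show "V - W = V + - W"
    by (rule ltwo_eqI) (use fn_add[of V "- W"] fn_uminus[of W] fn_diff[of V W] in eventually_elim, simp)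
  show "c *\<^sub>R (V + W) = c *\<^sub>R V + c *\<^sub>R W"
    by (rule ltwo_eqI) (use fn_add[of V W] fn_add[of "c *\<^sub>R V" "c *\<^sub>R W"] fn_scaleR[of c V] fn_scaleR[of c W]
        fn_scaleR[of c "V + W"] in eventually_elim, simp add: algebra_simps)
  show "(c + d) *\<^sub>R V = c *\<^sub>R V + d *\<^sub>R V"
    by (rule ltwo_eqI) (use fn_add[of "c *\<^sub>R V" "d *\<^sub>R V"] fn_scaleR[of c V] fn_scaleR[of d V]
        fn_scaleR[of "c + d" "V"] in eventually_elim, simp add: algebra_simps)
  show "c *\<^sub>R d *\<^sub>R V = (c * d) *\<^sub>R V"
    by (rule ltwo_eqI) (use fn_scaleR[of c "d *\<^sub>R V"] fn_scaleR[of d V]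
        fn_scaleR[of "c * d" "V"] in eventually_elim, simp)
  show "1 *\<^sub>R V = V"
    by (rule ltwo_eqI) (use fn_scaleR[of 1 V] in eventually_elim, simp)
qed

end

instantiation ltwo :: real_inner
begin

text \<open>The space is treated as a real Hilbert space, so the inner product is the real part of
  the complex one. The norm is the same for both.\<close>

definition inner_ltwo where "inner V W = Re (LINT x|lborel. fn V x * cnj (fn W x))"
definition norm_ltwo where "norm V = sqrt (inner V (V :: ltwo))"
definition sgn_ltwo where "sgn V = inverse (norm V) *\<^sub>R (V :: ltwo)"
definition dist_ltwo where "dist V W = norm (V - W :: ltwo)"
definition uniformity_ltwo where "uniformity = (INF e\<in>{0<..}. principal {(x, y). dist x (y :: ltwo) < e})"
definition open_ltwo where "open S = (\<forall>x\<in>S. \<forall>\<^sub>F (x', y) in uniformity. x' = x \<longrightarrow> (y :: ltwo) \<in> S)"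

lemma fn_integrable: "integrable lborel (\<lambda>x. fn V x * cnj (fn W x))"
  by (intro L2_mult_integrable L2_cnj) auto

instance
proof
  fix U V W :: ltwo and c d :: real
  show "dist V W = norm (V - W)" "sgn V = V /\<^sub>R norm V"
    by (simp_all add: dist_ltwo_def sgn_ltwo_def)
  show "(uniformity :: (ltwo \<times> ltwo) filter) = (INF e\<in>{0<..}. principal {(x, y). dist x y < e})"
    by (rule uniformity_ltwo_def)
  show "open S = (\<forall>x\<in>S. \<forall>\<^sub>F (x', y) in uniformity. x' = x \<longrightarrow> y \<in> S)" for S :: "ltwo set"
    by (rule open_ltwo_def)
  have "inner W V = Re (LINT x|lborel. cnj (fn V x * cnj (fn W x)))"
    by (simp add: inner_ltwo_def mult.commute)
  also have "\<dots> = inner V W"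
    by (simp add: inner_ltwo_def del: complex_cnj_mult)
  finally show "inner V W = inner W V" by simp
  have "(LINT x|lborel. fn (U + V) x * cnj (fn W x)) = (LINT x|lborel. fn U x * cnj (fn W x) + fn V x * cnj (fn W x))"
    by (rule integral_cong_AE) (measurable, use fn_add[of U V] in eventually_elim, simp add: algebra_simps)
  then show "inner (U + V) W = inner U W + inner V W"
    using fn_integrable by (simp add: inner_ltwo_def)
  have "(LINT x|lborel. fn (c *\<^sub>R V) x * cnj (fn W x)) = (LINT x|lborel. c *\<^sub>R (fn V x * cnj (fn W x)))"
    by (rule integral_cong_AE) (measurable, use fn_scaleR[of c V] in eventually_elim, simp add: algebra_simps)
  then show "inner (c *\<^sub>R V) W = c * inner V W"
    using fn_integrable by (simp add: inner_ltwo_def)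
  have *: "inner V V = (LINT x|lborel. (cmod (fn V x))\<^sup>2)"
  proof -
    have "(LINT x|lborel. fn V x * cnj (fn V x)) = (LINT x|lborel. complex_of_real ((cmod (fn V x))\<^sup>2))"
      by (simp only: complex_norm_square)
    then show ?thesis unfolding inner_ltwo_def by (simp del: of_real_power)
  qed
  show "0 \<le> inner V V" unfolding * by simp
  show "inner V V = 0 \<longleftrightarrow> V = 0"
  proof
    assume "inner V V = 0"
    then have "AE x in lborel. (cmod (fn V x))\<^sup>2 = 0"
      unfolding * by (subst (asm) integral_nonneg_eq_0_iff_AE) (auto simp: L2_integrable)
    with fn_zero have "AE x in lborel. fn V x = fn 0 x" by eventually_elim simp
    then show "V = 0" by (rule ltwo_eqI)
  next
    assume "V = 0"
    have "(LINT x|lborel. (cmod (fn 0 x))\<^sup>2) = 0"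
      by (rule integral_eq_zero_AE) (use fn_zero in eventually_elim, simp)
    then show "inner V V = 0" using \<open>V = 0\<close> * by simp
  qed
  show "norm V = sqrt (inner V V)" by (rule norm_ltwo_def)
qed

end

lemma norm_ltwo: "norm V = L2_norm (fn V)"
proof -
  have "(LINT x|lborel. fn V x * cnj (fn V x)) = (LINT x|lborel. complex_of_real ((cmod (fn V x))\<^sup>2))"
    by (simp only: complex_norm_square)
  then show ?thesis unfolding norm_eq_sqrt_inner inner_ltwo_def L2_norm_def by (simp del: of_real_power)
qed

lemma norm_lt: "f \<in> L2 \<Longrightarrow> norm (lt f) = L2_norm f"
  unfolding norm_ltwo by (rule L2_cong_AE) (auto intro: fn_lt)

lemma lt_add:
  assumes "f \<in> L2" "g \<in> L2" shows "lt (\<lambda>x. f x + g x) = lt f + lt g"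
  by (rule ltwo_eqI) (use fn_lt[OF L2_add[OF assms]] fn_lt[OF assms(1)] fn_lt[OF assms(2)] fn_add[of "lt f" "lt g"]
    in eventually_elim, simp)

lemma lt_diff:
  assumes "f \<in> L2" "g \<in> L2" shows "lt (\<lambda>x. f x - g x) = lt f - lt g"
  by (rule ltwo_eqI) (use fn_lt[OF L2_diff[OF assms]] fn_lt[OF assms(1)] fn_lt[OF assms(2)] fn_diff[of "lt f" "lt g"]
    in eventually_elim, simp)

lemma lt_scaleR:
  assumes "f \<in> L2" shows "lt (\<lambda>x. c *\<^sub>R f x) = c *\<^sub>R lt f"
  by (rule ltwo_eqI) (use fn_lt[OF L2_scaleR[OF assms], of c] fn_lt[OF assms] fn_scaleR[of c "lt f"]
    in eventually_elim, simp)

lemma lt_sum: "(\<And>i. i \<in> I \<Longrightarrow> f i \<in> L2) \<Longrightarrow> lt (\<lambda>x. \<Sum>i\<in>I. f i x) = (\<Sum>i\<in>I. lt (f i))"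
proof (induction I rule: infinite_finite_induct)
  case (insert i I)
  then show ?case using lt_add[of "f i" "\<lambda>x. \<Sum>i\<in>I. f i x"] by (simp add: L2_sum)
qed (simp_all add: zero_ltwo_def)

lemma L2_norm_triangle: "f \<in> L2 \<Longrightarrow> g \<in> L2 \<Longrightarrow> L2_norm (\<lambda>x. f x + g x) \<le> L2_norm f + L2_norm g"
  using norm_triangle_ineq[of "lt f" "lt g"] by (simp add: norm_lt L2_add flip: lt_add)

lemma L2_norm_mult_integral_le:
  assumes "f \<in> L2" "g \<in> L2" 
  shows "(LINT x|lborel. cmod (f x) * cmod (g x)) \<le> L2_norm f * L2_norm g"
proof -
  have "(\<integral>\<^sup>+x. ennreal (cmod (f x)) * ennreal (cmod (g x)) \<partial>lborel)\<^sup>2 \<le> ennreal ((L2_norm f)\<^sup>2) * ennreal ((L2_norm g)\<^sup>2)"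
    using Cauchy_Schwarz_nn_integral[of "\<lambda>x. ennreal (cmod (f x))" lborel "\<lambda>x. ennreal (cmod (g x))"] assms
      nn_integral_L2_norm[of f] nn_integral_L2_norm[of g]
    by (simp add: ennreal_power)
  moreover have "(\<integral>\<^sup>+x. ennreal (cmod (f x)) * ennreal (cmod (g x)) \<partial>lborel) = ennreal (LINT x|lborel. cmod (f x) * cmod (g x))"
    using integrable_norm[OF L2_mult_integrable[OF assms]]
    by (simp add: norm_mult nn_integral_eq_integral flip: ennreal_mult)
  ultimately have "(LINT x|lborel. cmod (f x) * cmod (g x))\<^sup>2 \<le> (L2_norm f * L2_norm g)\<^sup>2"
    by (simp add: ennreal_power power_mult_distrib flip: ennreal_mult)
  then show ?thesis by (rule power2_le_imp_le) simp
qed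

text \<open>Riesz-Fischer: a rapidly convergent subsequence converges almost everywhere, and Fatou's
  lemma turns the Cauchy bounds into bounds for the L^2 distance to the pointwise limit.\<close>

instance ltwo :: complete_space
proof
  fix X :: "nat \<Rightarrow> ltwo" assume X: "Cauchy X"
  have "\<exists>r. strict_mono r \<and> (\<forall>n. norm (X (r (Suc n)) - X (r n)) \<le> (1/2)^n)"
  proof -
    have "\<exists>M. \<forall>m\<ge>M. \<forall>n\<ge>M. dist (X m) (X n) < (1/2)^k" for k
      using X by (auto simp: Cauchy_def)
    then obtain M where M: "\<And>k m n. m \<ge> M k \<Longrightarrow> n \<ge> M k \<Longrightarrow> dist (X m) (X n) < (1/2)^k" by metis
    define r where "r = rec_nat (M 0) (\<lambda>n a. max (Suc a) (M (Suc n)))"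
    have "M n \<le> r n" for n by (cases n) (auto simp: r_def)
    moreover have rm: "r n < r (Suc n)" for n by (auto simp: r_def)
    ultimately have "norm (X (r (Suc n)) - X (r n)) \<le> (1/2)^n" for n
    proof -
      have "M n \<le> r (Suc n)" using \<open>\<And>n. M n \<le> r n\<close>[of n] rm[of n] by linarith
      then show ?thesis
        using M[of n "r (Suc n)" "r n"] \<open>\<And>n. M n \<le> r n\<close>[of n] by (simp add: dist_norm)
    qed
    then show ?thesis using rm strict_mono_Suc_iff by blast
  qed
  then obtain r where r: "strict_mono r" "\<And>n. norm (X (r (Suc n)) - X (r n)) \<le> (1/2)^n" by blast
  define f where "f n = fn (X (r n))" for n
  have fL2: "f n \<in> L2" for n by (simp add: f_def)
  note [measurable] = fL2[THEN L2_measurable]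
  have bnd: "(\<integral>\<^sup>+ x. ennreal ((cmod (f m x - f n x))\<^sup>2) \<partial>lborel) = ennreal ((norm (X (r m) - X (r n)))\<^sup>2)" for m n
  proof -
    have "L2_norm (\<lambda>x. f m x - f n x) = norm (X (r m) - X (r n))"
      using norm_lt[OF L2_diff, OF fL2 fL2, of m n] lt_diff[OF fL2 fL2, of m n] by (simp add: f_def)
    then show ?thesis by (subst nn_integral_L2_norm) (auto simp: L2_diff fL2)
  qed
  \<comment> \<open>The squared increments have integral at most 4^(-n) and can afford the weight
    2^n. Finiteness of the weighted sum at x then makes the increments there decay like 2^(-n/2),
    hence summable, and no triangle inequality for infinite sums is involved.\<close>
  have "(\<integral>\<^sup>+ x. (\<Sum>n. ennreal (2^n * (cmod (f (Suc n) x - f n x))\<^sup>2)) \<partial>lborel)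
      = (\<Sum>n. ennreal (2^n) * (\<integral>\<^sup>+ x. ennreal ((cmod (f (Suc n) x - f n x))\<^sup>2) \<partial>lborel))"
    by (subst nn_integral_suminf) (auto simp: ennreal_mult nn_integral_cmult)
  also have "\<dots> \<le> (\<Sum>n. ennreal ((1/2)^n))"
  proof (intro suminf_le allI)
    fix n
    have "2^n * (norm (X (r (Suc n)) - X (r n)))\<^sup>2 \<le> 2^n * ((1/2)^n)\<^sup>2"
      using r(2)[of n] by (intro mult_left_mono power_mono) auto
    also have "\<dots> = (1/2::real)^n"
      by (simp add: power2_eq_square power_one_over)
    finally show "ennreal (2^n) * (\<integral>\<^sup>+ x. ennreal ((cmod (f (Suc n) x - f n x))\<^sup>2) \<partial>lborel) \<le> ennreal ((1/2)^n)"
      unfolding bnd by (simp add: ennreal_leI flip: ennreal_mult)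
  qed auto
  also have "\<dots> < \<infinity>"
    using summable_geometric[of "1/2 :: real"] by (subst suminf_ennreal2) auto
  finally have "AE x in lborel. (\<Sum>n. ennreal (2^n * (cmod (f (Suc n) x - f n x))\<^sup>2)) \<noteq> \<infinity>"
    by (intro nn_integral_PInf_AE) auto
  then have conv: "AE x in lborel. (\<lambda>n. f n x) \<longlonglongrightarrow> lim (\<lambda>n. f n x)"
  proof eventually_elim
    case (elim x)
    define d where "d n = f (Suc n) x - f n x" for n
    have sm: "summable (\<lambda>n. 2^n * (cmod (d n))\<^sup>2)"
      using elim by (intro summable_suminf_not_top) (auto simp: d_def)
    define B where "B = (\<Sum>n. 2^n * (cmod (d n))\<^sup>2)"
    have B: "0 \<le> B" unfolding B_def by (intro suminf_nonneg sm) auto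
    have dB: "2^n * (cmod (d n))\<^sup>2 \<le> B" for n
      unfolding B_def using sum_le_suminf[OF sm, of "{n}"] by simp
    have "(cmod (d n))\<^sup>2 \<le> (sqrt B * (sqrt (1/2))^n)\<^sup>2" for n
    proof -
      have sq: "((sqrt (1/2))^n)\<^sup>2 = (1/2)^n"
        by (metis power_mult mult.commute real_sqrt_pow2 zero_le_divide_1_iff zero_le_numeral)
      have "(cmod (d n))\<^sup>2 = (1/2)^n * (2^n * (cmod (d n))\<^sup>2)"
        by (simp add: power_one_over)
      also have "\<dots> \<le> (1/2)^n * B"
        by (intro mult_left_mono dB) auto
      also have "\<dots> = (sqrt B * (sqrt (1/2))^n)\<^sup>2"
        unfolding power_mult_distrib sq using B by simp
      finally show ?thesis .
    qed
    then have d: "norm (d n) \<le> sqrt B * (sqrt (1/2))^n" for n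
      by (rule power2_le_imp_le) (simp add: B)
    have "sqrt (1/2) < sqrt 1" unfolding real_sqrt_less_iff by simp
    then have "summable (\<lambda>n. sqrt B * (sqrt (1/2))^n)"
      by (intro summable_mult summable_geometric) simp
    then have "summable d"
      by (rule summable_comparison_test'[where N = 0]) (rule d)
    then have "(\<lambda>n. (\<Sum>i<n. d i) + f 0 x) \<longlonglongrightarrow> suminf d + f 0 x"
      by (intro tendsto_add tendsto_const summable_LIMSEQ)
    moreover have "(\<Sum>i<n. d i) = f n x - f 0 x" for n
      unfolding d_def by (rule sum_lessThan_telescope)
    ultimately have "(\<lambda>n. f n x) \<longlonglongrightarrow> suminf d + f 0 x" by simp
    then show ?case by (simp add: limI)
  qed
  define g where "g x = lim (\<lambda>n. f n x)" for x
  have [measurable]: "g \<in> borel_measurable borel"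
    unfolding g_def by measurable
  have fatou: "(\<integral>\<^sup>+ x. ennreal ((cmod (f m x - g x))\<^sup>2) \<partial>lborel) \<le> ennreal (e\<^sup>2)"
    if "\<And>n. n \<ge> N \<Longrightarrow> norm (X (r m) - X (r n)) \<le> e" "0 \<le> e" for m N e
  proof -
    have "(\<integral>\<^sup>+ x. ennreal ((cmod (f m x - g x))\<^sup>2) \<partial>lborel)
      = (\<integral>\<^sup>+ x. liminf (\<lambda>n. ennreal ((cmod (f m x - f n x))\<^sup>2)) \<partial>lborel)"
      using conv
    proof (intro nn_integral_cong_AE, eventually_elim)
      case (elim x)
      have "(\<lambda>n. ennreal ((cmod (f m x - f n x))\<^sup>2)) \<longlonglongrightarrow> ennreal ((cmod (f m x - g x))\<^sup>2)"
        using elim unfolding g_def by (intro tendsto_intros)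
      then show ?case by (rule lim_imp_Liminf[OF sequentially_bot, symmetric])
    qed
    also have "\<dots> \<le> liminf (\<lambda>n. \<integral>\<^sup>+ x. ennreal ((cmod (f m x - f n x))\<^sup>2) \<partial>lborel)"
      by (intro nn_integral_liminf) auto
    also have "\<dots> \<le> liminf (\<lambda>n. ennreal (e\<^sup>2))"
      using that unfolding bnd
      by (intro Liminf_mono eventually_sequentiallyI[of N] ennreal_leI power_mono) auto
    also have "\<dots> = ennreal (e\<^sup>2)" by (simp add: Liminf_const)
    finally show ?thesis .
  qed
  have cau: "\<exists>N. \<forall>m\<ge>N. \<forall>n\<ge>N. norm (X m - X n) \<le> e" if "e > 0" for e
  proof -
    obtain N where "\<forall>m\<ge>N. \<forall>n\<ge>N. norm (X m - X n) < e"
      using X \<open>e > 0\<close> unfolding Cauchy_def dist_norm by blast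
    then show ?thesis by (auto intro!: exI[of _ N] less_imp_le)
  qed
  have rn: "n \<le> r n" for n using r(1) by (rule seq_suble)
  obtain N where N: "\<And>m n. m \<ge> N \<Longrightarrow> n \<ge> N \<Longrightarrow> norm (X m - X n) \<le> 1"
    using cau[of 1] by auto
  have "(\<lambda>x. f N x - g x) \<in> L2"
  proof (rule L2_norm_le(1))
    have "norm (X (r N) - X (r n)) \<le> 1" if "N \<le> n" for n
      using N[of "r N" "r n"] rn[of N] rn[of n] that by simp
    then show "(\<integral>\<^sup>+ x. ennreal ((cmod (f N x - g x))\<^sup>2) \<partial>lborel) \<le> ennreal (1\<^sup>2)"
      by (rule fatou) auto
  qed auto
  from L2_diff[OF fL2[of N] this] have g: "g \<in> L2" by simp
  have "(\<lambda>n. X n) \<longlonglongrightarrow> lt g"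
  proof (rule LIMSEQ_I)
    fix e :: real assume "e > 0"
    then obtain N where N: "\<And>m n. m \<ge> N \<Longrightarrow> n \<ge> N \<Longrightarrow> norm (X m - X n) \<le> e/3"
      using cau[of "e/3"] by auto
    have "norm (X (r N) - lt g) \<le> e/3"
    proof -
      have "X (r N) - lt g = lt (\<lambda>x. f N x - g x)"
        using lt_diff[OF fL2[of N] g] by (simp add: f_def)
      moreover have "L2_norm (\<lambda>x. f N x - g x) \<le> e/3"
      proof (rule L2_norm_le(2))
        show "(\<integral>\<^sup>+ x. ennreal ((cmod (f N x - g x))\<^sup>2) \<partial>lborel) \<le> ennreal ((e/3)\<^sup>2)"
        proof (rule fatou)
        show "norm (X (r N) - X (r n)) \<le> e/3" if "N \<le> n" for n
          using N[of "r N" "r n"] rn[of N] rn[of n] that by simp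
      qed (use \<open>e > 0\<close> in simp)
      qed (use \<open>e > 0\<close> in auto)
      ultimately show ?thesis by (simp add: norm_lt L2_diff fL2 g)
    qed
    then have "norm (X n - lt g) < e" if "n \<ge> N" for n
      using norm_triangle_ineq[of "X n - X (r N)" "X (r N) - lt g"] N[of n "r N"] that rn[of N] \<open>e > 0\<close>
      by simp
    then show "\<exists>N. \<forall>n\<ge>N. norm (X n - lt g) < e" by blast
  qed
  then show "convergent X" by (auto simp: convergent_def)
qed

instance ltwo :: banach ..

subsection \<open>The Plancherel theorem\<close>

lemma integrable_pair_bound:
  fixes H :: "real \<times> real \<Rightarrow> complex"
  assumes [measurable]: "H \<in> borel_measurable (lborel \<Otimes>\<^sub>M lborel)"
    and a: "integrable lborel a" and b: "integrable lborel b"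
    and H: "\<And>x y. cmod (H (x, y)) \<le> a x * b y"
  shows "integrable (lborel \<Otimes>\<^sub>M lborel) H"
proof (rule lborel_pair.Fubini_integrable)
  have Habs: "cmod (H (x, y)) \<le> \<bar>a x * b y\<bar>" for x y
    using H[of x y] abs_ge_self[of "a x * b y"] by linarith
  have int: "integrable lborel (\<lambda>y. H (x, y))" for x
    using b by (intro Bochner_Integration.integrable_bound[of _ "\<lambda>y. a x * b y" "\<lambda>y. H (x, y)"])
      (simp_all add: Habs)
  have le: "(LINT y|lborel. norm (H (x, y))) \<le> a x * (LINT y|lborel. b y)" for x
  proof -
    have "(LINT y|lborel. norm (H (x, y))) \<le> (LINT y|lborel. a x * b y)"
      using int b by (intro integral_mono) (auto intro: H)
    then show ?thesis by simp
  qed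
  show "integrable lborel (\<lambda>x. LINT y|lborel. norm (H (x, y)))"
  proof (rule Bochner_Integration.integrable_bound)
    show "integrable lborel (\<lambda>x. a x * (LINT y|lborel. b y))"
      using a by simp
    show "AE x in lborel. norm (LINT y|lborel. norm (H (x, y))) \<le> norm (a x * (LINT y|lborel. b y))"
      using le by (intro AE_I2) (simp add: order_trans[OF le abs_ge_self])
  qed measurable
  show "AE x in lborel. integrable lborel (\<lambda>y. H (x, y))"
    using int by simp
qed measurable

lemma fourier_integral_measurable [measurable (raw)]:
  assumes [measurable]: "f \<in> borel_measurable borel"
  shows "fourier_integral f \<in> borel_measurable borel"
  unfolding fourier_integral_def by measurable

lemma fourier_integrand_integrable:
  assumes "integrable lborel f"
  shows "integrable lborel (\<lambda>x. exp (- \<i> * of_real (x * \<xi>)) * f x)"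
  using assms by (intro Bochner_Integration.integrable_bound[OF assms]) (auto simp: norm_mult)

lemma fourier_integral_le:
  assumes "integrable lborel f"
  shows "cmod (fourier_integral f \<xi>) \<le> (LINT x|lborel. cmod (f x))"
  unfolding fourier_integral_def
  using integral_norm_bound[of lborel "\<lambda>x. exp (- \<i> * of_real (x * \<xi>)) * f x"] by (simp add: norm_mult)

lemma fourier_integral_add:
  "integrable lborel f \<Longrightarrow> integrable lborel g \<Longrightarrow>
    fourier_integral (\<lambda>x. f x + g x) \<xi> = fourier_integral f \<xi> + fourier_integral g \<xi>"
  using fourier_integrand_integrable by (simp add: fourier_integral_def distrib_left)

lemma fourier_integral_diff:
  "integrable lborel f \<Longrightarrow> integrable lborel g \<Longrightarrow>
    fourier_integral (\<lambda>x. f x - g x) \<xi> = fourier_integral f \<xi> - fourier_integral g \<xi>"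
  using fourier_integrand_integrable by (simp add: fourier_integral_def right_diff_distrib)

lemma fourier_integral_scaleR:
  "fourier_integral (\<lambda>x. c *\<^sub>R f x) \<xi> = c *\<^sub>R fourier_integral f \<xi>"
  by (simp add: fourier_integral_def)

lemma fourier_integral_cong_AE:
  assumes "AE x in lborel. f x = g x" "f \<in> borel_measurable borel" "g \<in> borel_measurable borel"
  shows "fourier_integral f = fourier_integral g"
proof
  fix \<xi>
  note [measurable] = assms(2,3)
  show "fourier_integral f \<xi> = fourier_integral g \<xi>"
    unfolding fourier_integral_def by (rule integral_cong_AE) (measurable, use assms(1) in eventually_elim, simp)
qed

lemma fourier_integral_multiplication:
  assumes f: "integrable lborel f" and g: "integrable lborel g"
  shows "(LINT \<xi>|lborel. fourier_integral f \<xi> * g \<xi>) = (LINT x|lborel. f x * fourier_integral g x)"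
proof -
  have [measurable]: "f \<in> borel_measurable borel" "g \<in> borel_measurable borel"
    using f g by (auto dest: borel_measurable_integrable)
  have "(LINT \<xi>|lborel. fourier_integral f \<xi> * g \<xi>)
      = (LINT \<xi>|lborel. LINT x|lborel. exp (- \<i> * of_real (x * \<xi>)) * f x * g \<xi>)"
    unfolding fourier_integral_def by (simp only: integral_mult_left_zero)
  also have "\<dots> = (LINT x|lborel. LINT \<xi>|lborel. exp (- \<i> * of_real (x * \<xi>)) * f x * g \<xi>)"
    by (intro lborel_pair.Fubini_integral integrable_pair_bound[OF _ integrable_norm[OF f] integrable_norm[OF g]])
       (auto simp: norm_mult)
  also have "\<dots> = (LINT x|lborel. f x * (LINT \<xi>|lborel. exp (- \<i> * of_real (\<xi> * x)) * g \<xi>))"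
    by (simp only: integral_mult_right_zero[symmetric] mult_ac)
  finally show ?thesis by (simp add: fourier_integral_def)
qed

text \<open>Up to rescaling by epsilon this is the characteristic function of the standard normal
  distribution. The transform is again a normal density, of width epsilon and total mass 2 pi: 2 pi
  times an approximate identity.\<close>

lemma gaussian_fourier:
  assumes "\<epsilon> > 0"
  shows "integrable lborel (\<lambda>\<xi>. complex_of_real (exp (- (\<epsilon> * \<xi>)\<^sup>2 / 2)))" (is "integrable _ ?G")
    and "fourier_integral (\<lambda>\<xi>. complex_of_real (exp (- (\<epsilon> * \<xi>)\<^sup>2 / 2))) a
      = of_real (2 * pi / \<epsilon> * std_normal_density (a / \<epsilon>))" (is "?L = _")
proof -
  have *: "complex_of_real (exp (- x\<^sup>2 / 2)) = of_real (sqrt (2 * pi)) * of_real (std_normal_density x)" for x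
    by (simp add: std_normal_density_def)
  have int: "integrable lborel (\<lambda>x. complex_of_real (exp (- x\<^sup>2 / 2)))"
    unfolding * using integrable_std_normal_moment[of 0] by (intro integrable_mult_right) (simp add: integrable_of_real)
  show "integrable lborel ?G"
    using lborel_integrable_real_affine[OF int, of \<epsilon> 0] assms by simp
  have "?L = (LINT \<xi>|lborel. exp (- \<i> * of_real (\<xi> * a)) * of_real (exp (- (\<epsilon> * \<xi>)\<^sup>2 / 2)))"
    by (simp add: fourier_integral_def)
  also have "\<dots> = (1 / \<epsilon>) *\<^sub>R (LINT x|lborel. exp (- \<i> * of_real (x / \<epsilon> * a)) * of_real (exp (- x\<^sup>2 / 2)))"
    using assms by (subst lborel_integral_real_affine[of "1 / \<epsilon>" _ 0]) auto
  also have "(LINT x|lborel. exp (- \<i> * of_real (x / \<epsilon> * a)) * of_real (exp (- x\<^sup>2 / 2)))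
      = of_real (sqrt (2 * pi)) * (LINT x|lborel. std_normal_density x *\<^sub>R iexp ((- a / \<epsilon>) * x))"
    unfolding * by (subst integral_mult_right_zero[symmetric], intro Bochner_Integration.integral_cong)
      (auto simp: scaleR_conv_of_real mult_ac)
  also have "(LINT x|lborel. std_normal_density x *\<^sub>R iexp ((- a / \<epsilon>) * x)) = char std_normal_distribution (- a / \<epsilon>)"
    unfolding char_def by (subst integral_density) auto
  also have "\<dots> = of_real (exp (- (a / \<epsilon>)\<^sup>2 / 2))"
    by (simp add: char_std_normal_distribution)
  finally have "?L = (1 / \<epsilon>) *\<^sub>R (of_real (sqrt (2 * pi)) * of_real (exp (- (a / \<epsilon>)\<^sup>2 / 2)))" .
  then show "?L = of_real (2 * pi / \<epsilon> * std_normal_density (a / \<epsilon>))"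
  proof -
    have "sqrt (2 * pi) * exp (- (a / \<epsilon>)\<^sup>2 / 2) = 2 * pi * std_normal_density (a / \<epsilon>)"
    proof -
      have "2 * pi * std_normal_density (a / \<epsilon>) = (2 * pi / sqrt (2 * pi)) * exp (- (a / \<epsilon>)\<^sup>2 / 2)"
        by (simp add: std_normal_density_def)
      also have "2 * pi / sqrt (2 * pi) = sqrt (2 * pi)" by (rule real_div_sqrt) simp
      finally show ?thesis ..
    qed
    then show ?thesis
      using \<open>?L = (1 / \<epsilon>) *\<^sub>R (of_real (sqrt (2 * pi)) * of_real (exp (- (a / \<epsilon>)\<^sup>2 / 2)))\<close>
      by (simp add: scaleR_conv_of_real mult_ac del: real_sqrt_mult flip: of_real_mult)
  qed
qed

text \<open>Lets the conjugate of a transform be treated as a transform, so that the multiplication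
  formula can be applied to the squared modulus.\<close>

lemma fourier_integral_reflect_cnj:
  "fourier_integral (\<lambda>y. cnj (f (- y))) \<xi> = cnj (fourier_integral f \<xi>)"
proof -
  have "fourier_integral (\<lambda>y. cnj (f (- y))) \<xi> = (LINT x|lborel. exp (- \<i> * of_real (- x * \<xi>)) * cnj (f x))"
    unfolding fourier_integral_def by (subst lborel_integral_real_affine[of "-1" _ 0]) auto
  also have "\<dots> = (LINT x|lborel. cnj (exp (- \<i> * of_real (x * \<xi>)) * f x))"
    by (simp add: exp_cnj)
  finally show ?thesis unfolding fourier_integral_def by (simp del: complex_cnj_mult)
qed

text \<open>The Gaussian factor makes the left-hand side converge for a merely integrable f. The
  multiplication formula moves the transforms onto the Gaussian, and the substitution y = - x -
  epsilon z turns the density of width epsilon into an average with a fixed density, where epsilon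
  -> 0 can be taken under the integral.\<close>

lemma plancherel_gaussian:
  assumes f: "integrable lborel f" and "\<epsilon> > 0"
  shows "(LINT \<xi>|lborel. fourier_integral f \<xi> * cnj (fourier_integral f \<xi>) * of_real (exp (- (\<epsilon> * \<xi>)\<^sup>2 / 2)))
    = 2 * pi * (LINT x|lborel. f x * (LINT z|lborel. cnj (f (x + \<epsilon> * z)) * std_normal_density z))"
    and "integrable lborel (\<lambda>\<xi>. fourier_integral f \<xi> * cnj (fourier_integral f \<xi>) * of_real (exp (- (\<epsilon> * \<xi>)\<^sup>2 / 2)))"
proof -
  define G where "G \<xi> = complex_of_real (exp (- (\<epsilon> * \<xi>)\<^sup>2 / 2))" for \<xi>
  have G: "integrable lborel G" unfolding G_def using gaussian_fourier[OF \<open>\<epsilon> > 0\<close>] by simp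
  have [measurable]: "f \<in> borel_measurable borel" "G \<in> borel_measurable borel"
    using f G by (auto dest: borel_measurable_integrable)
  have f': "integrable lborel (\<lambda>y. cnj (f (- y)))"
    using lborel_integrable_real_affine[OF f, of "-1" 0] by simp
  have "integrable lborel (\<lambda>\<xi>. cnj (fourier_integral f \<xi>) * G \<xi>)"
  proof (rule Bochner_Integration.integrable_bound)
    show "integrable lborel (\<lambda>\<xi>. (LINT x|lborel. cmod (f x)) *\<^sub>R G \<xi>)" using G by simp
    show "AE \<xi> in lborel. norm (cnj (fourier_integral f \<xi>) * G \<xi>) \<le> norm ((LINT x|lborel. cmod (f x)) *\<^sub>R G \<xi>)"
      using fourier_integral_le[OF f] by (intro AE_I2) (auto simp: norm_mult intro!: mult_right_mono)
  qed measurable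
  note * = this
  have "integrable lborel (\<lambda>\<xi>. fourier_integral f \<xi> * cnj (fourier_integral f \<xi>) * G \<xi>)"
  proof (rule Bochner_Integration.integrable_bound)
    show "integrable lborel (\<lambda>\<xi>. ((LINT x|lborel. cmod (f x)) * (LINT x|lborel. cmod (f x))) *\<^sub>R G \<xi>)" using G by simp
    show "AE \<xi> in lborel. norm (fourier_integral f \<xi> * cnj (fourier_integral f \<xi>) * G \<xi>)
        \<le> norm (((LINT x|lborel. cmod (f x)) * (LINT x|lborel. cmod (f x))) *\<^sub>R G \<xi>)"
      using fourier_integral_le[OF f] by (intro AE_I2) (auto simp: norm_mult intro!: mult_right_mono mult_mono)
  qed measurable
  then show "integrable lborel (\<lambda>\<xi>. fourier_integral f \<xi> * cnj (fourier_integral f \<xi>) * of_real (exp (- (\<epsilon> * \<xi>)\<^sup>2 / 2)))"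
    by (simp add: G_def)
  have inner: "fourier_integral (\<lambda>\<xi>. cnj (fourier_integral f \<xi>) * G \<xi>) x
     = 2 * pi * (LINT z|lborel. cnj (f (x + \<epsilon> * z)) * std_normal_density z)" for x
  proof -
    have FG: "fourier_integral (\<lambda>\<xi>. exp (- \<i> * of_real (\<xi> * x)) * G \<xi>) y
        = of_real (2 * pi / \<epsilon> * std_normal_density ((x + y) / \<epsilon>))" for y
    proof -
      have "fourier_integral (\<lambda>\<xi>. exp (- \<i> * of_real (\<xi> * x)) * G \<xi>) y = fourier_integral G (x + y)"
        unfolding fourier_integral_def by (intro Bochner_Integration.integral_cong)
          (auto simp: algebra_simps simp flip: exp_add)
      then show ?thesis
        using gaussian_fourier(2)[OF \<open>\<epsilon> > 0\<close>, of "x + y"] by (simp add: G_def[abs_def])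
    qed
    have "fourier_integral (\<lambda>\<xi>. cnj (fourier_integral f \<xi>) * G \<xi>) x
      = (LINT \<xi>|lborel. fourier_integral (\<lambda>y. cnj (f (- y))) \<xi> * (exp (- \<i> * of_real (\<xi> * x)) * G \<xi>))"
      unfolding fourier_integral_reflect_cnj fourier_integral_def[of "\<lambda>\<xi>. cnj (fourier_integral f \<xi>) * G \<xi>"]
      by (simp add: mult_ac)
    also have "\<dots> = (LINT y|lborel. cnj (f (- y)) * fourier_integral (\<lambda>\<xi>. exp (- \<i> * of_real (\<xi> * x)) * G \<xi>) y)"
      by (rule fourier_integral_multiplication[OF f' fourier_integrand_integrable[OF G]])
    also have "\<dots> = (LINT y|lborel. cnj (f (- y)) * of_real (2 * pi / \<epsilon> * std_normal_density ((x + y) / \<epsilon>)))"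
      by (simp only: FG)
    also have "\<dots> = \<epsilon> *\<^sub>R (LINT z|lborel. cnj (f (x + \<epsilon> * z)) * of_real (2 * pi / \<epsilon> * std_normal_density z))"
      using \<open>\<epsilon> > 0\<close> by (subst lborel_integral_real_affine[of "- \<epsilon>" _ "- x"]) (auto simp: std_normal_density_def add.commute)
    also have "(LINT z|lborel. cnj (f (x + \<epsilon> * z)) * of_real (2 * pi / \<epsilon> * std_normal_density z))
        = of_real (2 * pi / \<epsilon>) * (LINT z|lborel. cnj (f (x + \<epsilon> * z)) * std_normal_density z)"
      by (subst integral_mult_right_zero[symmetric], intro Bochner_Integration.integral_cong) auto
    also have "\<epsilon> *\<^sub>R \<dots> = 2 * pi * (LINT z|lborel. cnj (f (x + \<epsilon> * z)) * std_normal_density z)"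
      using \<open>\<epsilon> > 0\<close> by (simp add: scaleR_conv_of_real)
    finally show ?thesis .
  qed
  have "(LINT \<xi>|lborel. fourier_integral f \<xi> * (cnj (fourier_integral f \<xi>) * G \<xi>))
    = (LINT x|lborel. f x * fourier_integral (\<lambda>\<xi>. cnj (fourier_integral f \<xi>) * G \<xi>) x)"
    by (rule fourier_integral_multiplication[OF f *])
  also have "\<dots> = (LINT x|lborel. of_real (2 * pi) * (f x * (LINT z|lborel. cnj (f (x + \<epsilon> * z)) * std_normal_density z)))"
    unfolding inner by (simp only: mult_ac)
  also have "\<dots> = of_real (2 * pi) * (LINT x|lborel. f x * (LINT z|lborel. cnj (f (x + \<epsilon> * z)) * std_normal_density z))"
    by (rule integral_mult_right_zero)
  finally show "(LINT \<xi>|lborel. fourier_integral f \<xi> * cnj (fourier_integral f \<xi>) * of_real (exp (- (\<epsilon> * \<xi>)\<^sup>2 / 2)))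
    = 2 * pi * (LINT x|lborel. f x * (LINT z|lborel. cnj (f (x + \<epsilon> * z)) * std_normal_density z))"
    by (simp add: G_def mult.assoc)
qed

section \<open>Approximation in L^2 by continuous functions with compact support\<close>

lemma L2_norm_dominated_convergence:
  assumes [measurable]: "\<And>n. s n \<in> borel_measurable borel" "f \<in> borel_measurable borel" and w: "integrable lborel w"
    and lim: "AE x in lborel. (\<lambda>n. s n x) \<longlonglongrightarrow> f x"
    and le: "\<And>n. AE x in lborel. (cmod (s n x - f x))\<^sup>2 \<le> w x"
  shows "(\<lambda>n. L2_norm (\<lambda>x. s n x - f x)) \<longlonglongrightarrow> 0"
proof -
  have "(\<lambda>n. LINT x|lborel. (cmod (s n x - f x))\<^sup>2) \<longlonglongrightarrow> (LINT x|(lborel :: real measure). 0)"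
  proof (rule integral_dominated_convergence[OF _ _ w])
    show "AE x in lborel. (\<lambda>n. (cmod (s n x - f x))\<^sup>2) \<longlonglongrightarrow> 0"
      using lim
    proof eventually_elim
      case (elim x)
      then have "(\<lambda>n. (cmod (s n x - f x))\<^sup>2) \<longlonglongrightarrow> (cmod (f x - f x))\<^sup>2"
        by (intro tendsto_intros)
      then show ?case by simp
    qed
    show "AE x in lborel. norm ((cmod (s n x - f x))\<^sup>2) \<le> w x" for n
      using le[of n] by simp
  qed measurable
  then have "(\<lambda>n. sqrt (LINT x|lborel. (cmod (s n x - f x))\<^sup>2)) \<longlonglongrightarrow> sqrt 0"
    by (intro tendsto_real_sqrt) simp
  then show ?thesis by (simp add: L2_norm_def)
qed

lemma compact_support_integrable:
  fixes f :: "real \<Rightarrow> complex"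
  assumes "continuous_on UNIV f" "\<And>x. R < \<bar>x\<bar> \<Longrightarrow> f x = 0"
  shows "integrable lborel f"
proof -
  have "integrable lborel (\<lambda>x. indicator {-R..R} x *\<^sub>R f x)"
    using assms(1) by (intro borel_integrable_compact) (auto intro: continuous_on_subset)
  moreover have "(\<lambda>x. indicator {-R..R} x *\<^sub>R f x) = f"
    using assms(2) by (auto simp: indicator_def fun_eq_iff)
  ultimately show ?thesis by simp
qed

lemma compact_support_L2:
  fixes f :: "real \<Rightarrow> complex"
  assumes "continuous_on UNIV f" "\<And>x. R < \<bar>x\<bar> \<Longrightarrow> f x = 0"
  shows "f \<in> L2"
proof -
  have "integrable lborel (\<lambda>x. complex_of_real ((cmod (f x))\<^sup>2))"
    by (rule compact_support_integrable[of _ R]) (auto intro!: continuous_intros assms simp: assms(2))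
  then have "integrable lborel (\<lambda>x. (cmod (f x))\<^sup>2)" by (simp only: complex_of_real_integrable_eq)
  then show ?thesis using borel_measurable_continuous_onI[OF assms(1)] by (simp add: L2_def)
qed

text \<open>A continuous retraction onto the disc of radius k. Continuity lets it be applied both to
  the given function and to its continuous approximants.\<close>

definition clamp_norm :: "real \<Rightarrow> complex \<Rightarrow> complex" where
  "clamp_norm k z = (k / max k (cmod z)) *\<^sub>R z"

lemma continuous_clamp_norm: "k > 0 \<Longrightarrow> continuous_on UNIV (clamp_norm k)"
  unfolding clamp_norm_def by (intro continuous_intros) auto

lemma clamp_norm_le: "k > 0 \<Longrightarrow> cmod (clamp_norm k z) \<le> k" "k > 0 \<Longrightarrow> cmod (clamp_norm k z) \<le> cmod z"
  by (auto simp: clamp_norm_def max_def divide_simps mult_left_mono)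

lemma clamp_norm_eq: "k > 0 \<Longrightarrow> cmod z \<le> k \<Longrightarrow> clamp_norm k z = z"
  by (auto simp: clamp_norm_def max_def)

lemma clamp_norm_measurable [measurable (raw)]:
  "k > 0 \<Longrightarrow> f \<in> borel_measurable M \<Longrightarrow> (\<lambda>x. clamp_norm k (f x)) \<in> borel_measurable M"
  by (rule measurable_compose[OF _ borel_measurable_continuous_onI[OF continuous_clamp_norm]])

text \<open>Clamping makes f bounded at a small L^2 cost. The bounded function is an almost
  everywhere limit of continuous ones, and clamping and cutting these off supplies the majorant for
  dominated convergence. The continuous cutoff costs one unit of support.\<close>

lemma L2_approx_continuous:
  assumes f: "f \<in> L2" and supp: "\<And>x. R < \<bar>x\<bar> \<Longrightarrow> f x = 0" and "e > 0"
  obtains g where "continuous_on UNIV g" "\<And>x. R + 1 < \<bar>x\<bar> \<Longrightarrow> g x = 0" "L2_norm (\<lambda>x. g x - f x) < e"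
proof -
  note [measurable] = f[THEN L2_measurable]
  define h where "h n x = clamp_norm (real (Suc n)) (f x)" for n x
  have [measurable]: "h n \<in> borel_measurable borel" for n unfolding h_def by measurable
  have "(\<lambda>n. L2_norm (\<lambda>x. h n x - f x)) \<longlonglongrightarrow> 0"
  proof (rule L2_norm_dominated_convergence)
    show "integrable lborel (\<lambda>x. 4 * (cmod (f x))\<^sup>2)" using L2_integrable[OF f] by simp
    show "AE x in lborel. (\<lambda>n. h n x) \<longlonglongrightarrow> f x"
    proof (rule AE_I2, rule tendsto_eventually)
      fix x
      obtain N :: nat where "cmod (f x) \<le> real N" using real_arch_simple by blast
      then show "\<forall>\<^sub>F n in sequentially. h n x = f x"
        by (intro eventually_sequentiallyI[of N]) (auto simp: h_def clamp_norm_eq)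
    qed
    have "(cmod (h n x - f x))\<^sup>2 \<le> 4 * (cmod (f x))\<^sup>2" for n x
    proof -
      have "cmod (h n x - f x) \<le> 2 * cmod (f x)"
        using norm_triangle_ineq4[of "h n x" "f x"] clamp_norm_le(2)[of "real (Suc n)" "f x"]
        unfolding h_def by simp
      then have "(cmod (h n x - f x))\<^sup>2 \<le> (2 * cmod (f x))\<^sup>2" by (intro power_mono) auto
      then show ?thesis by (simp add: power_mult_distrib)
    qed
    then show "AE x in lborel. (cmod (h n x - f x))\<^sup>2 \<le> 4 * (cmod (f x))\<^sup>2" for n
      by simp
  qed measurable
  then have "\<forall>\<^sub>F n in sequentially. L2_norm (\<lambda>x. h n x - f x) < e / 2"
    using \<open>e > 0\<close> by (intro order_tendstoD(2)) auto
  then obtain n where n: "L2_norm (\<lambda>x. h n x - f x) < e / 2"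
    by (auto simp: eventually_sequentially)
  define k where "k = real (Suc n)"
  have k: "k > 0" by (simp add: k_def)
  have h_le: "cmod (h n x) \<le> k" for x
    unfolding h_def using clamp_norm_le(1)[OF k] by (simp add: k_def)
  have h_supp: "h n x = 0" if "R < \<bar>x\<bar>" for x
    using supp[OF that] by (simp add: h_def clamp_norm_def)
  have hL2: "h n \<in> L2"
    by (rule L2_bound(1)[OF _ f, of _ 1]) (auto simp: h_def clamp_norm_le)
  \<comment> \<open>\<open>measurable_on\<close> means precisely that continuous functions converge
    to \<open>h n\<close> outside a negligible set.\<close>
  have "h n measurable_on UNIV"
  proof (subst measurable_on_iff_borel_measurable)
    have "h n \<in> borel_measurable lebesgue" by (rule measurable_completion) simp
    then show "h n \<in> borel_measurable (lebesgue_on UNIV)" by (simp add: lebesgue_on_UNIV_eq)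
  qed simp
  then obtain N G where N: "negligible N" and G: "\<And>m. continuous_on UNIV (G m)"
      "\<And>x. x \<notin> N \<Longrightarrow> (\<lambda>m. G m x) \<longlonglongrightarrow> h n x"
    unfolding measurable_on_def by auto
  define cut where "cut x = max 0 (min 1 (R + 1 - \<bar>x\<bar>))" for x
  have cut: "0 \<le> cut x" "cut x \<le> 1" "R + 1 < \<bar>x\<bar> \<Longrightarrow> cut x = 0" "\<bar>x\<bar> \<le> R \<Longrightarrow> cut x = 1" for x
    by (auto simp: cut_def)
  define g where "g m x = cut x *\<^sub>R clamp_norm k (G m x)" for m x
  have g_cont: "continuous_on UNIV (g m)" for m
    unfolding g_def cut_def
    by (intro continuous_intros continuous_on_compose2[OF continuous_clamp_norm[OF k] G(1)]) auto
  have [measurable]: "g m \<in> borel_measurable borel" for m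
    using g_cont by (rule borel_measurable_continuous_onI)
  have "(\<lambda>m. L2_norm (\<lambda>x. g m x - h n x)) \<longlonglongrightarrow> 0"
  proof (rule L2_norm_dominated_convergence)
    show "integrable lborel (\<lambda>x. (4 * k\<^sup>2) * indicator {- (R + 1) .. R + 1} x :: real)"
      by (intro integrable_mult_right integrable_real_indicator) (auto simp: emeasure_lborel_Icc_eq)
    have "AE x in lborel. x \<notin> N"
      using N AE_not_in[of N lebesgue] by (auto simp: negligible_iff_null_sets AE_completion_iff)
    then show "AE x in lborel. (\<lambda>m. g m x) \<longlonglongrightarrow> h n x"
    proof eventually_elim
      case (elim x)
      have "isCont (clamp_norm k) (h n x)"
        using continuous_clamp_norm[OF k] by (simp add: continuous_on_eq_continuous_at)
      then have "(\<lambda>m. g m x) \<longlonglongrightarrow> cut x *\<^sub>R clamp_norm k (h n x)"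
        unfolding g_def by (intro tendsto_intros isCont_tendsto_compose[OF _ G(2)] elim)
      moreover have "cut x *\<^sub>R clamp_norm k (h n x) = h n x"
        using cut(4)[of x] h_supp[of x] clamp_norm_eq[OF k h_le] by (cases "\<bar>x\<bar> \<le> R") (auto simp: clamp_norm_def)
      ultimately show ?case by simp
    qed
    have "(cmod (g m x - h n x))\<^sup>2 \<le> (4 * k\<^sup>2) * indicator {- (R + 1) .. R + 1} x" for m x
    proof (cases "\<bar>x\<bar> \<le> R + 1")
      case True
      have "cmod (g m x) \<le> 1 * k"
        unfolding g_def norm_scaleR using cut[of x] clamp_norm_le(1)[OF k] by (intro mult_mono) auto
      then have "cmod (g m x - h n x) \<le> 2 * k"
        using norm_triangle_ineq4[of "g m x" "h n x"] h_le[of x] by simp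
      then have "(cmod (g m x - h n x))\<^sup>2 \<le> (2 * k)\<^sup>2" by (intro power_mono) auto
      moreover have "x \<in> {- (R + 1) .. R + 1}" using True by auto
      ultimately show ?thesis by (simp add: power_mult_distrib del: atLeastAtMost_iff minus_add_distrib)
    next
      case False
      then have "g m x = 0" "h n x = 0" using cut(3)[of x] h_supp[of x] by (auto simp: g_def)
      then show ?thesis by simp
    qed
    then show "AE x in lborel. (cmod (g m x - h n x))\<^sup>2 \<le> (4 * k\<^sup>2) * indicator {- (R + 1) .. R + 1} x" for m
      by simp
  qed measurable
  then have "\<forall>\<^sub>F m in sequentially. L2_norm (\<lambda>x. g m x - h n x) < e / 2"
    using \<open>e > 0\<close> by (intro order_tendstoD(2)) auto
  then obtain m where m: "L2_norm (\<lambda>x. g m x - h n x) < e / 2"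
    by (auto simp: eventually_sequentially)
  have g_supp: "g m x = 0" if "R + 1 < \<bar>x\<bar>" for x
    using cut(3)[OF that] by (simp add: g_def)
  then have "g m \<in> L2" by (rule compact_support_L2[OF g_cont])
  then have "L2_norm (\<lambda>x. (g m x - h n x) + (h n x - f x)) < e"
    using L2_norm_triangle[OF L2_diff[OF _ hL2] L2_diff[OF hL2 f], of "g m"] m n by linarith
  then show thesis
    using that[OF g_cont g_supp] by simp
qed

text \<open>Both sides of \<open>plancherel_gaussian\<close> converge as epsilon -> 0: the left by
  monotone convergence, since the Gaussian factors increase to 1, and the right by dominated
  convergence in z and then in x, since f is continuous, bounded and integrable.\<close>

lemma plancherel_continuous:
  assumes cont: "continuous_on UNIV f" and supp: "\<And>x. R < \<bar>x\<bar> \<Longrightarrow> f x = 0"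
  shows "(\<integral>\<^sup>+ \<xi>. ennreal ((cmod (fourier_integral f \<xi>))\<^sup>2) \<partial>lborel)
    = ennreal (2 * pi) * (\<integral>\<^sup>+ x. ennreal ((cmod (f x))\<^sup>2) \<partial>lborel)"
proof -
  have f: "integrable lborel f" using assms by (rule compact_support_integrable)
  then have [measurable]: "f \<in> borel_measurable borel" by (auto dest: borel_measurable_integrable)
  have f2: "integrable lborel (\<lambda>x. f x * cnj (f x))"
    using supp by (intro compact_support_integrable[of _ R] continuous_intros cont) auto
  have "bounded (f ` {-R..R})"
    by (intro compact_imp_bounded compact_continuous_image continuous_on_subset[OF cont]) auto
  then obtain B where B: "B > 0" "\<And>x. x \<in> {-R..R} \<Longrightarrow> cmod (f x) \<le> B"
    by (auto simp: bounded_pos)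
  have fB: "cmod (f x) \<le> B" for x
    using B supp[of x] by (cases "x \<in> {-R..R}") auto
  have le: "norm (cnj (f y) * complex_of_real (std_normal_density z)) \<le> B * std_normal_density z" for y z
    using fB[of y] normal_density_nonneg[of 0 1 z] by (simp add: norm_mult mult_right_mono)
  define \<epsilon> where "\<epsilon> n = inverse (real (Suc n))" for n
  have \<epsilon>: "\<epsilon> n > 0" for n by (simp add: \<epsilon>_def)
  have \<epsilon>0: "\<epsilon> \<longlonglongrightarrow> 0" unfolding \<epsilon>_def by (rule LIMSEQ_inverse_real_of_nat)
  define F where "F n \<xi> = fourier_integral f \<xi> * cnj (fourier_integral f \<xi>) * of_real (exp (- (\<epsilon> n * \<xi>)\<^sup>2 / 2))" for n \<xi>
  have FR: "F n \<xi> = of_real ((cmod (fourier_integral f \<xi>))\<^sup>2 * exp (- (\<epsilon> n * \<xi>)\<^sup>2 / 2))" for n \<xi>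
    unfolding F_def of_real_mult complex_norm_square ..
  have inner: "(\<lambda>n. LINT z|lborel. cnj (f (x + \<epsilon> n * z)) * complex_of_real (std_normal_density z)) \<longlonglongrightarrow> cnj (f x)" for x
  proof -
    have "(\<lambda>n. LINT z|lborel. cnj (f (x + \<epsilon> n * z)) * complex_of_real (std_normal_density z))
      \<longlonglongrightarrow> (LINT z|lborel. cnj (f x) * complex_of_real (std_normal_density z))"
    proof (rule integral_dominated_convergence)
      show "integrable lborel (\<lambda>z. B * std_normal_density z)"
        using integrable_std_normal_moment[of 0] by simp
      show "AE z in lborel. (\<lambda>n. cnj (f (x + \<epsilon> n * z)) * complex_of_real (std_normal_density z))
          \<longlonglongrightarrow> cnj (f x) * complex_of_real (std_normal_density z)"
      proof (rule AE_I2)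
        fix z
        have "(\<lambda>n. x + \<epsilon> n * z) \<longlonglongrightarrow> x + 0 * z" by (intro tendsto_intros \<epsilon>0)
        moreover have "isCont f x" using cont by (simp add: continuous_on_eq_continuous_at)
        ultimately have "(\<lambda>n. f (x + \<epsilon> n * z)) \<longlonglongrightarrow> f x"
          by (intro isCont_tendsto_compose[of x f]) auto
        then show "(\<lambda>n. cnj (f (x + \<epsilon> n * z)) * complex_of_real (std_normal_density z))
          \<longlonglongrightarrow> cnj (f x) * complex_of_real (std_normal_density z)"
          by (intro tendsto_intros)
      qed
      show "AE z in lborel. norm (cnj (f (x + \<epsilon> n * z)) * complex_of_real (std_normal_density z)) \<le> B * std_normal_density z" for n
        by (intro AE_I2 le)
    qed measurable
    then show ?thesis by simp
  qed
  have bnd: "cmod (LINT z|lborel. cnj (f (x + \<epsilon> n * z)) * complex_of_real (std_normal_density z)) \<le> B" for x n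
  proof -
    have i: "integrable lborel (\<lambda>z. B * std_normal_density z)"
      using integrable_std_normal_moment[of 0] by simp
    have "integrable lborel (\<lambda>z. cnj (f (x + \<epsilon> n * z)) * complex_of_real (std_normal_density z))"
      using order_trans[OF le abs_ge_self]
      by (intro Bochner_Integration.integrable_bound[OF i]) simp_all
    then have "cmod (LINT z|lborel. cnj (f (x + \<epsilon> n * z)) * complex_of_real (std_normal_density z))
      \<le> (LINT z|lborel. B * std_normal_density z)"
      using i le by (intro order_trans[OF integral_norm_bound] integral_mono) simp_all
    then show ?thesis by simp
  qed
  have "(\<lambda>n. LINT x|lborel. f x * (LINT z|lborel. cnj (f (x + \<epsilon> n * z)) * complex_of_real (std_normal_density z)))
      \<longlonglongrightarrow> (LINT x|lborel. f x * cnj (f x))"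
  proof (rule integral_dominated_convergence)
    show "integrable lborel (\<lambda>x. cmod (f x) * B)" using f by simp
    show "AE x in lborel. (\<lambda>n. f x * (LINT z|lborel. cnj (f (x + \<epsilon> n * z)) * complex_of_real (std_normal_density z)))
       \<longlonglongrightarrow> f x * cnj (f x)"
      by (intro AE_I2 tendsto_intros inner)
    show "AE x in lborel. norm (f x * (LINT z|lborel. cnj (f (x + \<epsilon> n * z)) * complex_of_real (std_normal_density z)))
      \<le> cmod (f x) * B" for n
      using bnd by (intro AE_I2) (auto simp: norm_mult intro!: mult_left_mono)
  qed measurable
  then have "(\<lambda>n. 2 * pi * (LINT x|lborel. f x * (LINT z|lborel. cnj (f (x + \<epsilon> n * z)) * complex_of_real (std_normal_density z))))
      \<longlonglongrightarrow> 2 * pi * (LINT x|lborel. f x * cnj (f x))"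
    by (intro tendsto_intros)
  then have "(\<lambda>n. LINT \<xi>|lborel. F n \<xi>) \<longlonglongrightarrow> 2 * pi * (LINT x|lborel. f x * cnj (f x))"
    unfolding F_def plancherel_gaussian(1)[OF f \<epsilon>] .
  then have "(\<lambda>n. ennreal (Re (LINT \<xi>|lborel. F n \<xi>))) \<longlonglongrightarrow> ennreal (Re (2 * pi * (LINT x|lborel. f x * cnj (f x))))"
    by (intro tendsto_intros)
  moreover have "ennreal (Re (LINT \<xi>|lborel. F n \<xi>))
      = (\<integral>\<^sup>+ \<xi>. ennreal ((cmod (fourier_integral f \<xi>))\<^sup>2 * exp (- (\<epsilon> n * \<xi>)\<^sup>2 / 2)) \<partial>lborel)" for n
  proof -
    have "integrable lborel (F n)" unfolding F_def using plancherel_gaussian(2)[OF f \<epsilon>] .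
    then have "integrable lborel (\<lambda>\<xi>. Re (F n \<xi>))" by simp
    then show ?thesis using \<open>integrable lborel (F n)\<close>
      by (subst integral_Re[symmetric]) (auto simp: FR nn_integral_eq_integral simp del: of_real_mult of_real_power)
  qed
  moreover have "(\<lambda>n. \<integral>\<^sup>+ \<xi>. ennreal ((cmod (fourier_integral f \<xi>))\<^sup>2 * exp (- (\<epsilon> n * \<xi>)\<^sup>2 / 2)) \<partial>lborel)
      \<longlonglongrightarrow> (\<integral>\<^sup>+ \<xi>. ennreal ((cmod (fourier_integral f \<xi>))\<^sup>2) \<partial>lborel)"
  proof (rule nn_integral_LIMSEQ)
    show "incseq (\<lambda>n \<xi>. ennreal ((cmod (fourier_integral f \<xi>))\<^sup>2 * exp (- (\<epsilon> n * \<xi>)\<^sup>2 / 2)))"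
    proof (intro incseq_SucI le_funI ennreal_leI mult_left_mono)
      fix n \<xi>
      have "\<epsilon> (Suc n) \<le> \<epsilon> n" unfolding \<epsilon>_def by (rule le_imp_inverse_le) auto
      then have "(\<epsilon> (Suc n))\<^sup>2 * \<xi>\<^sup>2 \<le> (\<epsilon> n)\<^sup>2 * \<xi>\<^sup>2"
        using \<epsilon>[of "Suc n"] by (intro mult_right_mono power_mono) auto
      then show "exp (- (\<epsilon> n * \<xi>)\<^sup>2 / 2) \<le> exp (- (\<epsilon> (Suc n) * \<xi>)\<^sup>2 / 2)"
        by (simp add: power_mult_distrib)
    qed simp
    fix \<xi>
    have "(\<lambda>n. ennreal ((cmod (fourier_integral f \<xi>))\<^sup>2 * exp (- (\<epsilon> n * \<xi>)\<^sup>2 / 2)))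
      \<longlonglongrightarrow> ennreal ((cmod (fourier_integral f \<xi>))\<^sup>2 * exp (- (0 * \<xi>)\<^sup>2 / 2))"
      by (intro tendsto_intros \<epsilon>0) auto
    then show "(\<lambda>n. ennreal ((cmod (fourier_integral f \<xi>))\<^sup>2 * exp (- (\<epsilon> n * \<xi>)\<^sup>2 / 2)))
      \<longlonglongrightarrow> ennreal ((cmod (fourier_integral f \<xi>))\<^sup>2)" by simp
  qed measurable
  ultimately have "(\<integral>\<^sup>+ \<xi>. ennreal ((cmod (fourier_integral f \<xi>))\<^sup>2) \<partial>lborel) = ennreal (Re (2 * pi * (LINT x|lborel. f x * cnj (f x))))"
    using LIMSEQ_unique by (simp only:)
  also have "(LINT x|lborel. f x * cnj (f x)) = of_real (LINT x|lborel. (cmod (f x))\<^sup>2)"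
    by (simp only: integral_complex_of_real[symmetric] complex_norm_square)
  also have "Re (2 * pi * complex_of_real (LINT x|lborel. (cmod (f x))\<^sup>2)) = 2 * pi * (LINT x|lborel. (cmod (f x))\<^sup>2)"
    by (simp del: of_real_power)
  also have "ennreal \<dots> = ennreal (2 * pi) * (\<integral>\<^sup>+ x. ennreal ((cmod (f x))\<^sup>2) \<partial>lborel)"
  proof -
    have "integrable lborel (\<lambda>x. complex_of_real ((cmod (f x))\<^sup>2))"
      using f2 by (simp only: complex_norm_square)
    then have "integrable lborel (\<lambda>x. (cmod (f x))\<^sup>2)" by (simp only: complex_of_real_integrable_eq)
    then show ?thesis by (simp add: nn_integral_eq_integral ennreal_mult)
  qed
  finally show ?thesis .
qed

lemma indicator_Icc_L2: "(\<lambda>x. indicator {a..b} x :: complex) \<in> L2"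
proof -
  have "integrable lborel (indicator {a..b} :: real \<Rightarrow> real)"
    by (intro integrable_real_indicator) (auto simp: emeasure_lborel_Icc_eq)
  moreover have "(\<lambda>x. (cmod (indicator {a..b} x))\<^sup>2) = (indicator {a..b} :: real \<Rightarrow> real)"
    by (auto simp: indicator_def)
  ultimately show ?thesis by (simp add: L2_def)
qed

lemma L2_compact_support:
  assumes f: "f \<in> L2" and supp: "\<And>x. R < \<bar>x\<bar> \<Longrightarrow> f x = 0"
  shows "integrable lborel f"
    and "(LINT x|lborel. cmod (f x)) \<le> L2_norm (indicator {-R..R}) * L2_norm f"
proof -
  have eq: "(\<lambda>x. indicator {-R..R} x * f x) = f"
  proof
    fix x show "indicator {-R..R} x * f x = f x"
      using supp[of x] by (cases "x \<in> {-R..R}") auto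
  qed
  show "integrable lborel f"
    using L2_mult_integrable[OF indicator_Icc_L2[of "-R" R] f] by (simp add: eq)
  have "(\<lambda>x. cmod (indicator {-R..R} x) * cmod (f x)) = (\<lambda>x. cmod (f x))"
    by (simp only: norm_mult[symmetric], simp only: fun_cong[OF eq])
  then show "(LINT x|lborel. cmod (f x)) \<le> L2_norm (indicator {-R..R}) * L2_norm f"
    using L2_norm_mult_integral_le[OF indicator_Icc_L2[of "-R" R] f] by simp
qed

text \<open>Continuous functions with supports in a common interval approximate f. Fatou's lemma
  gives one inequality for every f of this kind; the reverse one follows from the triangle
  inequality, with the first applied to the approximation error.\<close>

lemma plancherel_compact_support:
  assumes f: "f \<in> L2" and supp: "\<And>x. R < \<bar>x\<bar> \<Longrightarrow> f x = 0"
  shows "fourier_integral f \<in> L2" "L2_norm (fourier_integral f) = sqrt (2 * pi) * L2_norm f"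
proof -
  define s where "s = sqrt (2 * pi)"
  have s: "s > 0" by (simp add: s_def)
  have cont: "fourier_integral g \<in> L2 \<and> L2_norm (fourier_integral g) = s * L2_norm g"
    if g: "continuous_on UNIV g" "\<And>x. R' < \<bar>x\<bar> \<Longrightarrow> g x = 0" "g \<in> L2" for g R'
  proof -
    have [measurable]: "g \<in> borel_measurable borel" using g(3) by (rule L2_measurable)
    have *: "(\<integral>\<^sup>+ \<xi>. ennreal ((cmod (fourier_integral g \<xi>))\<^sup>2) \<partial>lborel) = ennreal ((s * L2_norm g)\<^sup>2)"
      using plancherel_continuous[OF g(1,2)] nn_integral_L2_norm[OF g(3)]
      by (simp add: s_def power_mult_distrib ennreal_mult)
    have gL2: "fourier_integral g \<in> L2"
      using L2_norm_le(1)[of "fourier_integral g" "s * L2_norm g"] s * by simp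
    then have "(L2_norm (fourier_integral g))\<^sup>2 = (s * L2_norm g)\<^sup>2"
      using * nn_integral_L2_norm[OF gL2] by simp
    then show ?thesis using gL2 s by (simp add: power2_eq_iff_nonneg)
  qed
  have le: "fourier_integral f \<in> L2 \<and> L2_norm (fourier_integral f) \<le> s * L2_norm f"
    if f: "f \<in> L2" and supp: "\<And>x. R' < \<bar>x\<bar> \<Longrightarrow> f x = 0" for f R'
  proof -
    have [measurable]: "f \<in> borel_measurable borel" using f by (rule L2_measurable)
    have "\<exists>g. continuous_on UNIV g \<and> (\<forall>x. R' + 1 < \<bar>x\<bar> \<longrightarrow> g x = 0) \<and> L2_norm (\<lambda>x. g x - f x) < inverse (real (Suc n))" for n
      by (rule L2_approx_continuous[OF f supp, of R' "inverse (real (Suc n))"]) auto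
    then obtain g where g: "\<And>n. continuous_on UNIV (g n)" "\<And>n x. R' + 1 < \<bar>x\<bar> \<Longrightarrow> g n x = 0"
      "\<And>n. L2_norm (\<lambda>x. g n x - f x) < inverse (real (Suc n))" by metis
    have [measurable]: "g n \<in> borel_measurable borel" for n
      using g(1) by (rule borel_measurable_continuous_onI)
    have g2: "g n \<in> L2" for n
      by (rule compact_support_L2[OF g(1,2)])
    define C where "C = L2_norm (indicator {-(R'+1)..R'+1})"
    \<comment> \<open>On a common bounded interval L^2 convergence implies L^1 convergence by
      Cauchy-Schwarz, hence convergence of the Fourier integrals at every point.\<close>
    have lim: "(\<lambda>n. fourier_integral (g n) \<xi>) \<longlonglongrightarrow> fourier_integral f \<xi>" for \<xi>
    proof -
      have le': "norm (fourier_integral (g n) \<xi> - fourier_integral f \<xi>) \<le> C * inverse (real (Suc n))" for n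
      proof -
        have supp': "g n x - f x = 0" if "R' + 1 < \<bar>x\<bar>" for x using that g(2) supp by simp
        have d: "integrable lborel (\<lambda>x. g n x - f x)"
          by (rule L2_compact_support(1)[OF L2_diff[OF g2 f] supp'])
        have "(LINT x|lborel. cmod (g n x - f x)) \<le> C * L2_norm (\<lambda>x. g n x - f x)"
          unfolding C_def by (rule L2_compact_support(2)[OF L2_diff[OF g2 f] supp'])
        note d = d this
        have "fourier_integral (g n) \<xi> - fourier_integral f \<xi> = fourier_integral (\<lambda>x. g n x - f x) \<xi>"
          by (rule fourier_integral_diff[symmetric])
            (auto intro!: L2_compact_support(1)[OF g2, of "R' + 1"] L2_compact_support(1)[OF f, of R'] simp: g(2) supp)
        then have "cmod (fourier_integral (g n) \<xi> - fourier_integral f \<xi>) \<le> (LINT x|lborel. cmod (g n x - f x))"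
          using fourier_integral_le[OF d(1)] by simp
        also have "\<dots> \<le> C * L2_norm (\<lambda>x. g n x - f x)" by (rule d(2))
        also have "\<dots> \<le> C * inverse (real (Suc n))"
          using g(3)[of n] by (intro mult_left_mono) (auto simp: C_def)
        finally show ?thesis .
      qed
      have "(\<lambda>n. C * inverse (real (Suc n))) \<longlonglongrightarrow> C * 0"
        by (intro tendsto_intros LIMSEQ_inverse_real_of_nat)
      then have "(\<lambda>n. C * inverse (real (Suc n))) \<longlonglongrightarrow> 0" by (simp only: mult_zero_right)
      then have "(\<lambda>n. fourier_integral (g n) \<xi> - fourier_integral f \<xi>) \<longlonglongrightarrow> 0"
        by (rule Lim_null_comparison[OF always_eventually[OF allI[OF le']]])
      then show ?thesis by (simp add: LIM_zero_iff)
    qed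
    have "(\<integral>\<^sup>+ \<xi>. ennreal ((cmod (fourier_integral f \<xi>))\<^sup>2) \<partial>lborel)
      = (\<integral>\<^sup>+ \<xi>. liminf (\<lambda>n. ennreal ((cmod (fourier_integral (g n) \<xi>))\<^sup>2)) \<partial>lborel)"
    proof (rule nn_integral_cong)
      fix \<xi>
      have "(\<lambda>n. ennreal ((cmod (fourier_integral (g n) \<xi>))\<^sup>2)) \<longlonglongrightarrow> ennreal ((cmod (fourier_integral f \<xi>))\<^sup>2)"
        by (intro tendsto_intros lim)
      then show "ennreal ((cmod (fourier_integral f \<xi>))\<^sup>2) = liminf (\<lambda>n. ennreal ((cmod (fourier_integral (g n) \<xi>))\<^sup>2))"
        by (rule lim_imp_Liminf[OF sequentially_bot, symmetric])
    qed
    also have "\<dots> \<le> liminf (\<lambda>n. \<integral>\<^sup>+ \<xi>. ennreal ((cmod (fourier_integral (g n) \<xi>))\<^sup>2) \<partial>lborel)"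
      by (intro nn_integral_liminf) measurable
    also have "\<dots> \<le> liminf (\<lambda>n. ennreal ((s * (L2_norm f + inverse (real (Suc n))))\<^sup>2))"
    proof (intro Liminf_mono always_eventually allI)
      fix n
      have "L2_norm (g n) \<le> L2_norm (\<lambda>x. g n x - f x) + L2_norm f"
        using L2_norm_triangle[OF L2_diff[OF g2 f] f, of n] by simp
      then have "L2_norm (g n) \<le> L2_norm f + inverse (real (Suc n))"
        using g(3)[of n] by simp
      then have "(s * L2_norm (g n))\<^sup>2 \<le> (s * (L2_norm f + inverse (real (Suc n))))\<^sup>2"
        using s by (intro power_mono mult_left_mono) auto
      moreover have "(\<integral>\<^sup>+ \<xi>. ennreal ((cmod (fourier_integral (g n) \<xi>))\<^sup>2) \<partial>lborel) = ennreal ((s * L2_norm (g n))\<^sup>2)"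
      proof -
        have "fourier_integral (g n) \<in> L2 \<and> L2_norm (fourier_integral (g n)) = s * L2_norm (g n)"
          by (rule cont[OF g(1,2) g2])
        then show ?thesis by (subst nn_integral_L2_norm) auto
      qed
      ultimately show "(\<integral>\<^sup>+ \<xi>. ennreal ((cmod (fourier_integral (g n) \<xi>))\<^sup>2) \<partial>lborel)
          \<le> ennreal ((s * (L2_norm f + inverse (real (Suc n))))\<^sup>2)"
        by (simp add: ennreal_leI)
    qed
    also have "\<dots> = ennreal ((s * (L2_norm f + 0))\<^sup>2)"
      by (intro lim_imp_Liminf tendsto_intros LIMSEQ_inverse_real_of_nat) simp
    finally show ?thesis
      using L2_norm_le[of "fourier_integral f" "s * L2_norm f"] s by simp
  qed
  show fL2: "fourier_integral f \<in> L2" using le[OF f supp] by blast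
  show "L2_norm (fourier_integral f) = sqrt (2 * pi) * L2_norm f"
    unfolding s_def[symmetric]
  proof (rule antisym)
    show "L2_norm (fourier_integral f) \<le> s * L2_norm f" using le[OF f supp] by blast
    \<comment> \<open>An approximant g at distance less than e / (2 s) satisfies the identity
      exactly. Passing from f to g, and from the transform of g back to that of f, loses at most e /
      2 each time.\<close>
    show "s * L2_norm f \<le> L2_norm (fourier_integral f)"
    proof (rule field_le_epsilon)
      fix e :: real assume "e > 0"
      then have e: "e / (2 * s) > 0" using s by simp
      obtain g where g: "continuous_on UNIV g" "\<And>x. R + 1 < \<bar>x\<bar> \<Longrightarrow> g x = 0" "L2_norm (\<lambda>x. g x - f x) < e / (2 * s)"
        using L2_approx_continuous[OF f supp e] by blast
      have [measurable]: "g \<in> borel_measurable borel"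
        using g(1) by (rule borel_measurable_continuous_onI)
      have g2: "g \<in> L2" by (rule compact_support_L2[OF g(1,2)])
      have cg: "fourier_integral g \<in> L2 \<and> L2_norm (fourier_integral g) = s * L2_norm g"
        by (rule cont[OF g(1,2) g2])
      have d: "f x - g x = 0" if "R + 1 < \<bar>x\<bar>" for x using that g(2) supp by simp
      have fg: "L2_norm (\<lambda>x. f x - g x) < e / (2 * s)"
        using g(3) by (simp add: L2_norm_def norm_minus_commute)
      have "s * L2_norm f \<le> s * (L2_norm (\<lambda>x. f x - g x) + L2_norm g)"
        using L2_norm_triangle[OF L2_diff[OF f g2] g2] s by (intro mult_left_mono) auto
      also have "\<dots> \<le> e / 2 + L2_norm (fourier_integral g)"
        using fg s cg by (simp add: field_simps)
      also have "L2_norm (fourier_integral g) \<le> L2_norm (\<lambda>\<xi>. fourier_integral g \<xi> - fourier_integral f \<xi>) + L2_norm (fourier_integral f)"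
        using L2_norm_triangle[OF L2_diff[OF _ fL2] fL2, of "fourier_integral g"] cg by simp
      also have "(\<lambda>\<xi>. fourier_integral g \<xi> - fourier_integral f \<xi>) = fourier_integral (\<lambda>x. g x - f x)"
        by (rule ext, rule fourier_integral_diff[symmetric])
          (auto intro!: L2_compact_support(1)[OF g2, of "R + 1"] L2_compact_support(1)[OF f, of R] simp: g(2) supp)
      also have "L2_norm \<dots> \<le> s * L2_norm (\<lambda>x. g x - f x)"
        using le[OF L2_diff[OF g2 f], of "R + 1"] g(2) supp by simp
      also have "\<dots> \<le> e / 2" using g(3) s by (simp add: field_simps)
      finally show "s * L2_norm f \<le> L2_norm (fourier_integral f) + e" by simp
    qed
  qed
qed

section \<open>The transform on all of L^2, its symmetry and its inversion\<close>

definition trunc :: "real \<Rightarrow> (real \<Rightarrow> complex) \<Rightarrow> real \<Rightarrow> complex" where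
  "trunc R f x = indicator {-R..R} x * f x"

lemma trunc_L2: "f \<in> L2 \<Longrightarrow> trunc R f \<in> L2"
  by (rule L2_bound(1)[of _ f 1]) (auto simp: trunc_def[abs_def] norm_mult indicator_def)

lemma trunc_supp: "R < \<bar>x\<bar> \<Longrightarrow> trunc R f x = 0"
  by (auto simp: trunc_def indicator_def)

lemma trunc_integrable: "f \<in> L2 \<Longrightarrow> integrable lborel (trunc R f)"
  by (rule L2_compact_support(1)[OF trunc_L2 trunc_supp])

lemma trunc_tendsto:
  assumes f: "f \<in> L2"
  shows "((\<lambda>R. lt (trunc R f)) \<longlongrightarrow> lt f) at_top"
proof (rule tendsto_at_topI_sequentially)
  fix X :: "nat \<Rightarrow> real" assume X: "filterlim X at_top sequentially"
  have [measurable]: "f \<in> borel_measurable borel" using f by (rule L2_measurable)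
  have "(\<lambda>n. L2_norm (\<lambda>x. trunc (X n) f x - f x)) \<longlonglongrightarrow> 0"
  proof (rule L2_norm_dominated_convergence[OF _ _ L2_integrable[OF f]])
    show "AE x in lborel. (\<lambda>n. trunc (X n) f x) \<longlonglongrightarrow> f x"
    proof (rule AE_I2, rule tendsto_eventually)
      fix x
      have "\<forall>\<^sub>F n in sequentially. \<bar>x\<bar> \<le> X n" using X by (simp add: filterlim_at_top)
      then show "\<forall>\<^sub>F n in sequentially. trunc (X n) f x = f x"
        by eventually_elim (auto simp: trunc_def indicator_def)
    qed
    show "AE x in lborel. (cmod (trunc (X n) f x - f x))\<^sup>2 \<le> (cmod (f x))\<^sup>2" for n
      by (auto simp: trunc_def indicator_def)
  qed (auto simp: trunc_def[abs_def])
  then have "(\<lambda>n. norm (lt (trunc (X n) f) - lt f)) \<longlonglongrightarrow> 0"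
    by (simp add: norm_lt L2_diff trunc_L2 f flip: lt_diff)
  then show "(\<lambda>n. lt (trunc (X n) f)) \<longlonglongrightarrow> lt f"
    using tendsto_norm_zero_iff LIM_zero_iff by blast
qed

definition FT :: "ltwo \<Rightarrow> ltwo" where
  "FT V = Lim at_top (\<lambda>R. lt (fourier_integral (trunc R (fn V))))"

lemma lt_fourier_trunc_diff:
  assumes f: "f \<in> L2"
  shows "norm (lt (fourier_integral (trunc R f)) - lt (fourier_integral (trunc R' f)))
      = sqrt (2 * pi) * norm (lt (trunc R f) - lt (trunc R' f))"
proof -
  note T = trunc_L2[OF f] and F = plancherel_compact_support[OF trunc_L2[OF f] trunc_supp]
  have supp: "trunc R f x - trunc R' f x = 0" if "max R R' < \<bar>x\<bar>" for x
    using that by (simp add: trunc_supp)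
  have "(\<lambda>\<xi>. fourier_integral (trunc R f) \<xi> - fourier_integral (trunc R' f) \<xi>)
      = fourier_integral (\<lambda>x. trunc R f x - trunc R' f x)"
    by (rule ext, rule fourier_integral_diff[symmetric]) (auto intro: trunc_integrable f)
  moreover have "fourier_integral (\<lambda>x. trunc R f x - trunc R' f x) \<in> L2"
    by (rule plancherel_compact_support(1)[OF L2_diff[OF T T] supp])
  moreover have "L2_norm (fourier_integral (\<lambda>x. trunc R f x - trunc R' f x))
      = sqrt (2 * pi) * L2_norm (\<lambda>x. trunc R f x - trunc R' f x)"
    by (rule plancherel_compact_support(2)[OF L2_diff[OF T T] supp])
  ultimately show ?thesis
    by (simp add: norm_lt L2_diff T F(1) flip: lt_diff)
qed

text \<open>The truncations converge in L^2, and the differences of their transforms have sqrt(2 pi)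
  times the same norms, so the transforms form a Cauchy family in a complete space.\<close>

lemma FT_tendsto: "((\<lambda>R. lt (fourier_integral (trunc R (fn V)))) \<longlongrightarrow> FT V) at_top"
proof -
  define F where "F R = lt (fourier_integral (trunc R (fn V)))" for R
  define T where "T R = lt (trunc R (fn V))" for R
  have d: "norm (F R - F R') = sqrt (2 * pi) * norm (T R - T R')" for R R'
    unfolding F_def T_def by (rule lt_fourier_trunc_diff) simp
  have T: "(T \<longlongrightarrow> V) at_top"
    using trunc_tendsto[of "fn V"] by (simp add: T_def[abs_def])
  then have Tn: "(\<lambda>n. T (real n)) \<longlonglongrightarrow> V"
    by (rule filterlim_compose[OF _ filterlim_real_sequentially])
  have "Cauchy (\<lambda>n. F (real n))"
  proof (rule CauchyI)
    fix e :: real assume "e > 0"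
    then have "e / sqrt (2 * pi) > 0" by simp
    with LIMSEQ_imp_Cauchy[OF Tn] obtain N where "\<forall>m\<ge>N. \<forall>n\<ge>N. norm (T (real m) - T (real n)) < e / sqrt (2 * pi)"
      by (auto simp: Cauchy_def dist_norm)
    then show "\<exists>N. \<forall>m\<ge>N. \<forall>n\<ge>N. norm (F (real m) - F (real n)) < e"
      unfolding d by (intro exI[of _ N]) (auto simp: field_simps)
  qed
  then obtain G where G: "(\<lambda>n. F (real n)) \<longlonglongrightarrow> G"
    using Cauchy_convergent convergent_def by blast
  \<comment> \<open>The limit G was found along the integers. This exact identity for real R carries
    the convergence over to the filter \<open>at_top\<close> of the definition.\<close>
  have "norm (F R - G) = sqrt (2 * pi) * norm (T R - V)" for R
  proof (rule LIMSEQ_unique)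
    show "(\<lambda>n. norm (F R - F (real n))) \<longlonglongrightarrow> norm (F R - G)" by (intro tendsto_intros G)
    show "(\<lambda>n. norm (F R - F (real n))) \<longlonglongrightarrow> sqrt (2 * pi) * norm (T R - V)"
      unfolding d by (intro tendsto_intros Tn)
  qed
  moreover have "((\<lambda>R. sqrt (2 * pi) * norm (T R - V)) \<longlongrightarrow> sqrt (2 * pi) * norm (V - V)) at_top"
    by (intro tendsto_intros T)
  ultimately have "((\<lambda>R. norm (F R - G)) \<longlongrightarrow> 0) at_top" by simp
  then have "(F \<longlongrightarrow> G) at_top"
    using tendsto_norm_zero_iff LIM_zero_iff by blast
  moreover from this have "FT V = G" unfolding FT_def F_def[symmetric] by (intro tendsto_Lim) auto
  ultimately show ?thesis by (simp add: F_def[abs_def])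
qed

lemma fourier_trunc_cong:
  assumes "f \<in> L2" shows "fourier_integral (trunc R (fn (lt f))) = fourier_integral (trunc R f)"
  using trunc_L2[OF assms, of R] trunc_L2[OF fn_L2, of R "lt f"]
  by (intro fourier_integral_cong_AE) (use fn_lt[OF assms] in \<open>auto elim!: eventually_mono simp: trunc_def\<close>)

text \<open>The bridge between the relation of the definitions and an equation in
  \<open>ltwo\<close>: the integral that tends to 0 in \<open>is_fourier\<close> is a squared
  distance in \<open>ltwo\<close>, and limits there are unique.\<close>

lemma is_fourier_iff: "is_fourier f g \<longleftrightarrow> f \<in> L2 \<and> g \<in> L2 \<and> FT (lt f) = lt g"
proof (cases "f \<in> L2 \<and> g \<in> L2")
  case True
  then have f: "f \<in> L2" and g: "g \<in> L2" by auto
  define F where "F R = lt (fourier_integral (trunc R f))" for R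
  have FL2: "fourier_integral (trunc R f) \<in> L2" for R
    by (rule plancherel_compact_support(1)[OF trunc_L2[OF f] trunc_supp])
  have tr: "(\<lambda>x. indicator {-R..R} x * f x) = trunc R f" for R
    by (simp add: trunc_def[abs_def])
  have lim: "(F \<longlongrightarrow> FT (lt f)) at_top"
    using FT_tendsto[of "lt f"] by (simp add: F_def[abs_def] fourier_trunc_cong f)
  have "is_fourier f g \<longleftrightarrow> ((\<lambda>R. ennreal ((norm (F R - lt g))\<^sup>2)) \<longlongrightarrow> ennreal 0) at_top"
    unfolding is_fourier_def F_def tr
    using nn_integral_L2_norm[OF L2_diff[OF FL2 g]] f g
    by (simp add: norm_lt L2_diff FL2 flip: lt_diff)
  also have "\<dots> \<longleftrightarrow> ((\<lambda>R. (norm (F R - lt g))\<^sup>2) \<longlongrightarrow> 0) at_top"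
    by (rule tendsto_ennreal_iff) auto
  also have "\<dots> \<longleftrightarrow> (F \<longlongrightarrow> lt g) at_top"
  proof
    assume "((\<lambda>R. (norm (F R - lt g))\<^sup>2) \<longlongrightarrow> 0) at_top"
    then have "((\<lambda>R. sqrt ((norm (F R - lt g))\<^sup>2)) \<longlongrightarrow> sqrt 0) at_top"
      by (rule tendsto_real_sqrt)
    then have "((\<lambda>R. norm (F R - lt g)) \<longlongrightarrow> 0) at_top" by simp
    then show "(F \<longlongrightarrow> lt g) at_top" using tendsto_norm_zero_iff LIM_zero_iff by blast
  next
    assume "(F \<longlongrightarrow> lt g) at_top"
    then have "((\<lambda>R. (norm (F R - lt g))\<^sup>2) \<longlongrightarrow> (norm (lt g - lt g))\<^sup>2) at_top"
      by (intro tendsto_intros)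
    then show "((\<lambda>R. (norm (F R - lt g))\<^sup>2) \<longlongrightarrow> 0) at_top" by simp
  qed
  also have "\<dots> \<longleftrightarrow> FT (lt f) = lt g"
    using lim tendsto_unique[OF _ lim, of "lt g"] by auto
  finally show ?thesis using f g by simp
qed (auto simp: is_fourier_def)

lemma norm_FT: "norm (FT V) = sqrt (2 * pi) * norm V"
proof (rule tendsto_unique)
  show "((\<lambda>R. norm (lt (fourier_integral (trunc R (fn V))))) \<longlongrightarrow> norm (FT V)) at_top"
    by (intro tendsto_intros FT_tendsto)
  have "norm (lt (fourier_integral (trunc R (fn V)))) = sqrt (2 * pi) * norm (lt (trunc R (fn V)))" for R
  proof -
    have "fourier_integral (trunc R (fn V)) \<in> L2"
      by (rule plancherel_compact_support(1)[OF trunc_L2[OF fn_L2] trunc_supp])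
    moreover have "L2_norm (fourier_integral (trunc R (fn V))) = sqrt (2 * pi) * L2_norm (trunc R (fn V))"
      by (rule plancherel_compact_support(2)[OF trunc_L2[OF fn_L2] trunc_supp])
    ultimately show ?thesis by (simp add: norm_lt trunc_L2)
  qed
  moreover have "((\<lambda>R. sqrt (2 * pi) * norm (lt (trunc R (fn V)))) \<longlongrightarrow> sqrt (2 * pi) * norm V) at_top"
    using trunc_tendsto[of "fn V"] by (intro tendsto_intros) simp
  ultimately show "((\<lambda>R. norm (lt (fourier_integral (trunc R (fn V))))) \<longlongrightarrow> sqrt (2 * pi) * norm V) at_top"
    by simp
qed simp

lemma linear_FT: "linear FT"
proof (rule linearI)
  have FL2: "fourier_integral (trunc R (fn V)) \<in> L2" for R V
    by (rule plancherel_compact_support(1)[OF trunc_L2[OF fn_L2] trunc_supp])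
  have [measurable]: "trunc R (fn V) \<in> borel_measurable borel" for R V
    using trunc_L2[OF fn_L2] by (rule L2_measurable)
  show "FT (V + W) = FT V + FT W" for V W
  proof (rule tendsto_unique[OF _ FT_tendsto])
    have "lt (fourier_integral (trunc R (fn (V + W)))) = lt (fourier_integral (trunc R (fn V))) + lt (fourier_integral (trunc R (fn W)))" for R
    proof -
      have "fourier_integral (trunc R (fn (V + W))) = fourier_integral (\<lambda>x. trunc R (fn V) x + trunc R (fn W) x)"
        by (rule fourier_integral_cong_AE) (use fn_add[of V W] in \<open>auto elim!: eventually_mono simp: trunc_def algebra_simps\<close>)
      also have "\<dots> = (\<lambda>\<xi>. fourier_integral (trunc R (fn V)) \<xi> + fourier_integral (trunc R (fn W)) \<xi>)"
        by (rule ext, rule fourier_integral_add) (auto intro: trunc_integrable)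
      finally show ?thesis by (simp add: lt_add FL2)
    qed
    then show "((\<lambda>R. lt (fourier_integral (trunc R (fn (V + W))))) \<longlongrightarrow> FT V + FT W) at_top"
      by (simp add: tendsto_add FT_tendsto)
  qed simp
  show "FT (c *\<^sub>R V) = c *\<^sub>R FT V" for c V
  proof (rule tendsto_unique[OF _ FT_tendsto])
    have "lt (fourier_integral (trunc R (fn (c *\<^sub>R V)))) = c *\<^sub>R lt (fourier_integral (trunc R (fn V)))" for R
    proof -
      have "fourier_integral (trunc R (fn (c *\<^sub>R V))) = fourier_integral (\<lambda>x. c *\<^sub>R trunc R (fn V) x)"
        by (rule fourier_integral_cong_AE) (use fn_scaleR[of c V] in \<open>auto elim!: eventually_mono simp: trunc_def algebra_simps\<close>)
      also have "\<dots> = (\<lambda>\<xi>. c *\<^sub>R fourier_integral (trunc R (fn V)) \<xi>)"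
        by (rule ext, rule fourier_integral_scaleR)
      finally show ?thesis by (simp add: lt_scaleR FL2)
    qed
    then show "((\<lambda>R. lt (fourier_integral (trunc R (fn (c *\<^sub>R V))))) \<longlongrightarrow> c *\<^sub>R FT V) at_top"
      by (simp add: tendsto_scaleR FT_tendsto)
  qed simp
qed

lemma inner_lt:
  assumes "f \<in> L2" "g \<in> L2"
  shows "inner (lt f) (lt g) = Re (LINT x|lborel. f x * cnj (g x))"
proof -
  note [measurable] = assms[THEN L2_measurable]
  have "(LINT x|lborel. fn (lt f) x * cnj (fn (lt g) x)) = (LINT x|lborel. f x * cnj (g x))"
    by (rule integral_cong_AE) (measurable, use fn_lt[OF assms(1)] fn_lt[OF assms(2)] in eventually_elim, simp)
  then show ?thesis by (simp add: inner_ltwo_def)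
qed

definition cj :: "ltwo \<Rightarrow> ltwo" where "cj V = lt (\<lambda>x. cnj (fn V x))"

lemma fn_cj: "AE x in lborel. fn (cj V) x = cnj (fn V x)"
  unfolding cj_def by (rule fn_lt) (simp add: L2_cnj)

lemma cj_lt:
  assumes "f \<in> L2" shows "cj (lt f) = lt (\<lambda>x. cnj (f x))"
  by (rule ltwo_eqI) (use fn_cj[of "lt f"] fn_lt[OF assms] fn_lt[OF L2_cnj[OF assms]] in eventually_elim, simp)

lemma cj_cj [simp]: "cj (cj V) = V"
  by (rule ltwo_eqI) (use fn_cj[of "cj V"] fn_cj[of V] in eventually_elim, simp)

lemma norm_cj: "norm (cj V) = norm V"
  unfolding cj_def by (simp only: norm_ltwo[of V] norm_lt[OF L2_cnj[OF fn_L2]] L2_norm_cnj)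

lemma bounded_linear_cj: "bounded_linear cj"
proof (rule bounded_linear_intro[of _ 1])
  show "cj (V + W) = cj V + cj W" for V W
    by (rule ltwo_eqI) (use fn_cj[of V] fn_cj[of W] fn_cj[of "V + W"] fn_add[of V W] fn_add[of "cj V" "cj W"]
      in eventually_elim, simp)
  show "cj (c *\<^sub>R V) = c *\<^sub>R cj V" for c V
    by (rule ltwo_eqI) (use fn_cj[of V] fn_cj[of "c *\<^sub>R V"] fn_scaleR[of c V] fn_scaleR[of c "cj V"]
      in eventually_elim, simp)
qed (simp add: norm_cj)

text \<open>\<open>inner V (cj W)\<close> is the real part of the integral of the product without
  conjugation. The identity is thus the multiplication formula, carried over from truncations by
  continuity.\<close>

lemma FT_symmetric: "inner (FT V) (cj W) = inner V (cj (FT W))"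
proof (rule tendsto_unique)
  define f where "f R = trunc R (fn V)" for R
  define g where "g R = trunc R (fn W)" for R
  have f: "f R \<in> L2" and g: "g R \<in> L2" for R by (simp_all add: f_def g_def trunc_L2)
  have f': "fourier_integral (f R) \<in> L2" for R
    unfolding f_def by (rule plancherel_compact_support(1)[OF trunc_L2[OF fn_L2] trunc_supp])
  have g': "fourier_integral (g R) \<in> L2" for R
    unfolding g_def by (rule plancherel_compact_support(1)[OF trunc_L2[OF fn_L2] trunc_supp])
  have lim: "((\<lambda>R. lt (f R)) \<longlongrightarrow> V) at_top" "((\<lambda>R. lt (g R)) \<longlongrightarrow> W) at_top"
    using trunc_tendsto[of "fn V"] trunc_tendsto[of "fn W"] by (simp_all add: f_def g_def)
  note cjl = bounded_linear.tendsto[OF bounded_linear_cj]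
  show "((\<lambda>R. inner (lt (fourier_integral (f R))) (cj (lt (g R)))) \<longlongrightarrow> inner (FT V) (cj W)) at_top"
    unfolding f_def by (intro tendsto_intros FT_tendsto cjl lim)
  have "inner (lt (fourier_integral (f R))) (cj (lt (g R))) = inner (lt (f R)) (cj (lt (fourier_integral (g R))))" for R
  proof -
    have "integrable lborel (f R)" "integrable lborel (g R)"
      by (simp_all add: f_def g_def trunc_integrable)
    then have "(LINT \<xi>|lborel. fourier_integral (f R) \<xi> * g R \<xi>) = (LINT x|lborel. f R x * fourier_integral (g R) x)"
      by (rule fourier_integral_multiplication)
    then show ?thesis
      by (simp add: cj_lt[OF g] cj_lt[OF g'] inner_lt[OF f L2_cnj[OF g']] inner_lt[OF f' L2_cnj[OF g]])
  qed
  moreover have "((\<lambda>R. inner (lt (f R)) (cj (lt (fourier_integral (g R))))) \<longlongrightarrow> inner V (cj (FT W))) at_top"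
    unfolding g_def by (intro tendsto_intros FT_tendsto cjl lim)
  ultimately show "((\<lambda>R. inner (lt (fourier_integral (f R))) (cj (lt (g R)))) \<longlongrightarrow> inner V (cj (FT W))) at_top"
    by simp
qed simp

lemma bounded_linear_FT: "bounded_linear FT"
  by (rule bounded_linear_intro[of _ "sqrt (2 * pi)"])
    (simp_all add: linear_add[OF linear_FT] linear_scale[OF linear_FT] norm_FT mult.commute)

lemma inner_FT: "inner (FT V) (FT W) = 2 * pi * inner V W"
proof -
  have "inner (FT V) (FT W) = ((norm (FT (V + W)))\<^sup>2 - (norm (FT V))\<^sup>2 - (norm (FT W))\<^sup>2) / 2"
    unfolding linear_add[OF linear_FT] by (rule dot_norm)
  also have "\<dots> = 2 * pi * (((norm (V + W))\<^sup>2 - (norm V)\<^sup>2 - (norm W)\<^sup>2) / 2)"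
    unfolding norm_FT power_mult_distrib by (simp add: algebra_simps)
  also have "((norm (V + W))\<^sup>2 - (norm V)\<^sup>2 - (norm W)\<^sup>2) / 2 = inner V W"
    by (rule dot_norm[symmetric])
  finally show ?thesis .
qed

text \<open>No pointwise inversion formula is involved: by \<open>FT_symmetric\<close> the operator
  \<open>cj \<circ> FT \<circ> cj\<close> is the adjoint of \<open>FT\<close>, and by Plancherel
  \<open>FT\<close> is sqrt(2 pi) times an isometry.\<close>

lemma fourier_inversion: "cj (FT (cj (FT V))) = (2 * pi) *\<^sub>R V"
proof -
  have "inner W (cj (FT (cj (FT V)))) = inner W ((2 * pi) *\<^sub>R V)" for W
  proof -
    have "inner W (cj (FT (cj (FT V)))) = inner (FT W) (cj (cj (FT V)))" by (rule FT_symmetric[symmetric])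
    then show ?thesis by (simp only: cj_cj inner_FT inner_scaleR_right)
  qed
  then show ?thesis by (rule vector_eq_ldot[THEN iffD1, OF allI])
qed

lemma fourier_inversion': "FT (cj (FT (cj V))) = (2 * pi) *\<^sub>R V"
proof -
  have "FT (cj (FT (cj V))) = cj (cj (FT (cj (FT (cj V)))))" by (simp only: cj_cj)
  also have "\<dots> = cj ((2 * pi) *\<^sub>R cj V)" by (simp only: fourier_inversion)
  also have "\<dots> = (2 * pi) *\<^sub>R V"
    by (simp only: linear_scale[OF bounded_linear.linear[OF bounded_linear_cj]] cj_cj)
  finally show ?thesis .
qed

lemma FT_surj: "FT ((1 / (2 * pi)) *\<^sub>R cj (FT (cj V))) = V"
proof -
  have "FT ((1 / (2 * pi)) *\<^sub>R cj (FT (cj V))) = (1 / (2 * pi)) *\<^sub>R FT (cj (FT (cj V)))"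
    by (rule linear_scale[OF linear_FT])
  also have "\<dots> = (1 / (2 * pi)) *\<^sub>R (2 * pi) *\<^sub>R V" by (simp only: fourier_inversion')
  also have "\<dots> = V" by simp
  finally show ?thesis .
qed

lemma L2_limit_AE:
  assumes F: "\<And>n. F n \<in> L2" and lim: "(\<lambda>n. lt (F n)) \<longlonglongrightarrow> G"
    and ptw: "\<And>x. (\<lambda>n. F n x) \<longlonglongrightarrow> h x" and [measurable]: "h \<in> borel_measurable borel"
  shows "AE x in lborel. fn G x = h x"
proof -
  note [measurable] = F[THEN L2_measurable]
  have "(\<integral>\<^sup>+ x. ennreal ((cmod (h x - fn G x))\<^sup>2) \<partial>lborel)
    = (\<integral>\<^sup>+ x. liminf (\<lambda>n. ennreal ((cmod (F n x - fn G x))\<^sup>2)) \<partial>lborel)"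
  proof (rule nn_integral_cong)
    fix x
    have "(\<lambda>n. ennreal ((cmod (F n x - fn G x))\<^sup>2)) \<longlonglongrightarrow> ennreal ((cmod (h x - fn G x))\<^sup>2)"
      by (intro tendsto_intros ptw)
    then show "ennreal ((cmod (h x - fn G x))\<^sup>2) = liminf (\<lambda>n. ennreal ((cmod (F n x - fn G x))\<^sup>2))"
      by (rule lim_imp_Liminf[OF sequentially_bot, symmetric])
  qed
  also have "\<dots> \<le> liminf (\<lambda>n. \<integral>\<^sup>+ x. ennreal ((cmod (F n x - fn G x))\<^sup>2) \<partial>lborel)"
    by (intro nn_integral_liminf) measurable
  also have "(\<lambda>n. \<integral>\<^sup>+ x. ennreal ((cmod (F n x - fn G x))\<^sup>2) \<partial>lborel) = (\<lambda>n. ennreal ((norm (lt (F n) - G))\<^sup>2))"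
  proof
    fix n
    have "lt (F n) - G = lt (\<lambda>x. F n x - fn G x)" using lt_diff[OF F fn_L2] by simp
    then show "(\<integral>\<^sup>+ x. ennreal ((cmod (F n x - fn G x))\<^sup>2) \<partial>lborel) = ennreal ((norm (lt (F n) - G))\<^sup>2)"
      using nn_integral_L2_norm[OF L2_diff[OF F fn_L2], of n G] by (simp add: norm_lt L2_diff F)
  qed
  also have "liminf (\<lambda>n. ennreal ((norm (lt (F n) - G))\<^sup>2)) = ennreal ((norm (G - G))\<^sup>2)"
    by (intro lim_imp_Liminf tendsto_intros lim) simp
  finally have "(\<integral>\<^sup>+ x. ennreal ((cmod (h x - fn G x))\<^sup>2) \<partial>lborel) = 0" by simp
  then have "AE x in lborel. ennreal ((cmod (h x - fn G x))\<^sup>2) = 0"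
    by (subst (asm) nn_integral_0_iff_AE) auto
  then show ?thesis by eventually_elim simp
qed

text \<open>For integrable f the transforms of the truncations converge at every point by dominated
  convergence, so their L^2 limit must be the absolutely convergent integral.\<close>

lemma FT_integrable:
  assumes f: "f \<in> L2" and i: "integrable lborel f"
  shows "fourier_integral f \<in> L2" "FT (lt f) = lt (fourier_integral f)"
proof -
  have [measurable]: "f \<in> borel_measurable borel" using f by (rule L2_measurable)
  have [measurable]: "trunc R f \<in> borel_measurable borel" for R
    using trunc_L2[OF f] by (rule L2_measurable)
  have ae: "AE x in lborel. fn (FT (lt f)) x = fourier_integral f x"
  proof (rule L2_limit_AE)
    show "fourier_integral (trunc (real n) f) \<in> L2" for n
      by (rule plancherel_compact_support(1)[OF trunc_L2[OF f] trunc_supp])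
    show "(\<lambda>n. lt (fourier_integral (trunc (real n) f))) \<longlonglongrightarrow> FT (lt f)"
      using FT_tendsto[of "lt f"] unfolding fourier_trunc_cong[OF f]
      by (rule filterlim_compose[OF _ filterlim_real_sequentially])
    show "(\<lambda>n. fourier_integral (trunc (real n) f) \<xi>) \<longlonglongrightarrow> fourier_integral f \<xi>" for \<xi>
      unfolding fourier_integral_def
    proof (rule integral_dominated_convergence)
      show "integrable lborel (\<lambda>x. cmod (f x))" using i by simp
      show "AE x in lborel. (\<lambda>n. exp (- \<i> * complex_of_real (x * \<xi>)) * trunc (real n) f x)
          \<longlonglongrightarrow> exp (- \<i> * complex_of_real (x * \<xi>)) * f x"
      proof (rule AE_I2, rule tendsto_eventually)
        fix x
        have "\<forall>\<^sub>F n in sequentially. \<bar>x\<bar> \<le> real n"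
          using filterlim_real_sequentially by (simp add: filterlim_at_top)
        then show "\<forall>\<^sub>F n in sequentially. exp (- \<i> * complex_of_real (x * \<xi>)) * trunc (real n) f x
            = exp (- \<i> * complex_of_real (x * \<xi>)) * f x"
          by eventually_elim (auto simp: trunc_def indicator_def)
      qed
      show "AE x in lborel. norm (exp (- \<i> * complex_of_real (x * \<xi>)) * trunc (real n) f x) \<le> cmod (f x)" for n
        by (auto simp: trunc_def indicator_def norm_mult)
    qed measurable
  qed measurable
  then show "fourier_integral f \<in> L2"
    by (intro L2_cong_AE(1)[OF fn_L2[of "FT (lt f)"]]) (auto elim: eventually_mono)
  with ae show "FT (lt f) = lt (fourier_integral f)"
    using lt_eqI[OF fn_L2, of "fourier_integral f" "FT (lt f)"] by simp
qed

section \<open>Convolution and the transform of a square\<close>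

definition convolution :: "(real \<Rightarrow> complex) \<Rightarrow> (real \<Rightarrow> complex) \<Rightarrow> real \<Rightarrow> complex" where
  "convolution v w \<xi> = (LINT \<eta>|lborel. v \<eta> * w (\<xi> - \<eta>))"

lemma convolution_measurable [measurable (raw)]:
  assumes [measurable]: "v \<in> borel_measurable borel" "w \<in> borel_measurable borel"
  shows "convolution v w \<in> borel_measurable borel"
  unfolding convolution_def by measurable

lemma nn_integral_shift:
  "f \<in> borel_measurable borel \<Longrightarrow> (\<integral>\<^sup>+ x. f (x - c) \<partial>lborel) = (\<integral>\<^sup>+ x. f x \<partial>(lborel :: real measure))"
  using nn_integral_real_affine[of f 1 "- c"] by simp

lemma nn_integral_reflect:
  "f \<in> borel_measurable borel \<Longrightarrow> (\<integral>\<^sup>+ x. f (c - x) \<partial>lborel) = (\<integral>\<^sup>+ x. f x \<partial>(lborel :: real measure))"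
  using nn_integral_real_affine[of f "-1" c] by simp

lemma convolution_pair_integrable:
  assumes v: "integrable lborel v" and w: "integrable lborel w"
  shows "integrable (lborel \<Otimes>\<^sub>M lborel) (\<lambda>(\<eta>, \<xi>). (v \<eta> :: complex) * (w (\<xi> - \<eta> :: real) :: complex))"
proof (rule lborel_pair.Fubini_integrable)
  have [measurable]: "v \<in> borel_measurable borel" "w \<in> borel_measurable borel"
    using v w by (auto dest: borel_measurable_integrable)
  show "(\<lambda>(\<eta>, \<xi>). v \<eta> * w (\<xi> - \<eta>)) \<in> borel_measurable (lborel \<Otimes>\<^sub>M lborel)" by measurable
  have int: "integrable lborel (\<lambda>\<xi>. w (\<xi> - \<eta>))" for \<eta>
    using lborel_integrable_real_affine[OF w, of 1 "- \<eta>"] by simp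
  then show "AE \<eta> in lborel. integrable lborel (\<lambda>\<xi>. case (\<eta>, \<xi>) of (\<eta>, \<xi>) \<Rightarrow> v \<eta> * w (\<xi> - \<eta>))"
    by simp
  have "(LINT \<xi>|lborel. cmod (w (\<xi> - \<eta>))) = (LINT \<xi>|lborel. cmod (w \<xi>))" for \<eta>
    using lborel_integral_real_affine[of 1 "\<lambda>\<xi>. cmod (w \<xi>)" "- \<eta>"] by simp
  then show "integrable lborel (\<lambda>\<eta>. LINT \<xi>|lborel. norm (case (\<eta>, \<xi>) of (\<eta>, \<xi>) \<Rightarrow> v \<eta> * w (\<xi> - \<eta>)))"
    using v by (simp add: norm_mult)
qed

lemma convolution_integrable:
  assumes "integrable lborel v" "integrable lborel w"
  shows "integrable lborel (convolution v w)"
  unfolding convolution_def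
  using lborel_pair.integrable_snd[OF convolution_pair_integrable[OF assms]] by simp

lemma fourier_integral_convolution:
  assumes v: "integrable lborel v" and w: "integrable lborel w"
  shows "fourier_integral (convolution v w) x = fourier_integral v x * fourier_integral w x"
proof -
  have [measurable]: "v \<in> borel_measurable borel" "w \<in> borel_measurable borel"
    using v w by (auto dest: borel_measurable_integrable)
  have "fourier_integral (convolution v w) x
      = (LINT \<xi>|lborel. LINT \<eta>|lborel. exp (- \<i> * of_real (\<xi> * x)) * (v \<eta> * w (\<xi> - \<eta>)))"
    unfolding fourier_integral_def convolution_def by (simp only: integral_mult_right_zero)
  also have "\<dots> = (LINT \<eta>|lborel. LINT \<xi>|lborel. exp (- \<i> * of_real (\<xi> * x)) * (v \<eta> * w (\<xi> - \<eta>)))"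
  proof (rule lborel_pair.Fubini_integral, rule Bochner_Integration.integrable_bound[OF convolution_pair_integrable[OF v w]])
    show "AE p in lborel \<Otimes>\<^sub>M lborel. norm (case p of (\<eta>, \<xi>) \<Rightarrow> exp (- \<i> * complex_of_real (\<xi> * x)) * (v \<eta> * w (\<xi> - \<eta>)))
      \<le> norm (case p of (\<eta>, \<xi>) \<Rightarrow> v \<eta> * w (\<xi> - \<eta>))"
      by (intro AE_I2) (auto simp: norm_mult)
  qed measurable
  also have "\<dots> = (LINT \<eta>|lborel. exp (- \<i> * of_real (\<eta> * x)) * v \<eta> * fourier_integral w x)"
  proof (rule Bochner_Integration.integral_cong[OF refl])
    fix \<eta>
    have "(LINT \<xi>|lborel. exp (- \<i> * of_real (\<xi> * x)) * (v \<eta> * w (\<xi> - \<eta>)))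
        = (LINT \<xi>|lborel. exp (- \<i> * of_real ((\<xi> + \<eta>) * x)) * (v \<eta> * w \<xi>))"
      using lborel_integral_real_affine[of 1 "\<lambda>\<xi>. exp (- \<i> * of_real (\<xi> * x)) * (v \<eta> * w (\<xi> - \<eta>))" \<eta>]
      by (simp add: add.commute)
    also have "\<dots> = (LINT \<xi>|lborel. (exp (- \<i> * of_real (\<eta> * x)) * v \<eta>) * (exp (- \<i> * of_real (\<xi> * x)) * w \<xi>))"
    proof (rule Bochner_Integration.integral_cong[OF refl])
      fix \<xi>
      have "exp (- \<i> * complex_of_real ((\<xi> + \<eta>) * x)) = exp (- \<i> * of_real (\<eta> * x)) * exp (- \<i> * of_real (\<xi> * x))"
        by (simp add: algebra_simps flip: exp_add)
      then show "exp (- \<i> * of_real ((\<xi> + \<eta>) * x)) * (v \<eta> * w \<xi>)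
          = (exp (- \<i> * of_real (\<eta> * x)) * v \<eta>) * (exp (- \<i> * of_real (\<xi> * x)) * w \<xi>)"
        by (simp only: mult_ac)
    qed
    also have "\<dots> = exp (- \<i> * of_real (\<eta> * x)) * v \<eta> * fourier_integral w x"
      unfolding fourier_integral_def by (rule integral_mult_right_zero)
    finally show "(LINT \<xi>|lborel. exp (- \<i> * of_real (\<xi> * x)) * (v \<eta> * w (\<xi> - \<eta>)))
        = exp (- \<i> * of_real (\<eta> * x)) * v \<eta> * fourier_integral w x" .
  qed
  also have "\<dots> = fourier_integral v x * fourier_integral w x"
    unfolding fourier_integral_def by (rule integral_mult_left_zero)
  finally show ?thesis .
qed

text \<open>Young's inequality for L^1 and L^2. Cauchy-Schwarz with |v| split into two square roots
  leaves one L^1 norm of v outside, and exchanging the integrals produces the second.\<close>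

lemma convolution_L2:
  assumes v: "integrable lborel v" and w: "w \<in> L2"
  shows "convolution v w \<in> L2"
proof (rule L2_norm_le(1))
  have [measurable]: "v \<in> borel_measurable borel" "w \<in> borel_measurable borel"
    using v w by (auto dest: borel_measurable_integrable)
  show "convolution v w \<in> borel_measurable borel" by measurable
  define A where "A = (LINT \<eta>|lborel. cmod (v \<eta>))"
  have A: "(\<integral>\<^sup>+ \<eta>. ennreal (cmod (v \<eta>)) \<partial>lborel) = ennreal A" "0 \<le> A"
    using v by (auto simp: nn_integral_eq_integral A_def)
  have pw: "ennreal ((cmod (convolution v w \<xi>))\<^sup>2) \<le> ennreal A * (\<integral>\<^sup>+ \<eta>. ennreal (cmod (v \<eta>)) * ennreal ((cmod (w (\<xi> - \<eta>)))\<^sup>2) \<partial>lborel)" for \<xi>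
  proof -
    have "ennreal (cmod (convolution v w \<xi>)) \<le> (\<integral>\<^sup>+ \<eta>. ennreal (cmod (v \<eta> * w (\<xi> - \<eta>))) \<partial>lborel)"
    proof (cases "integrable lborel (\<lambda>\<eta>. v \<eta> * w (\<xi> - \<eta>))")
      case True then show ?thesis unfolding convolution_def by (rule integral_norm_bound_ennreal)
    next
      \<comment> \<open>Where the integrand is not integrable, the Bochner integral is 0 by
        convention and the bound is trivial.\<close>
      case False then show ?thesis by (simp add: convolution_def not_integrable_integral_eq)
    qed
    also have "\<dots> = (\<integral>\<^sup>+ \<eta>. ennreal (sqrt (cmod (v \<eta>))) * ennreal (sqrt (cmod (v \<eta>)) * cmod (w (\<xi> - \<eta>))) \<partial>lborel)"
      by (intro nn_integral_cong) (simp add: norm_mult mult.assoc[symmetric] flip: ennreal_mult)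
    finally have "(ennreal (cmod (convolution v w \<xi>)))\<^sup>2
      \<le> (\<integral>\<^sup>+ \<eta>. ennreal (sqrt (cmod (v \<eta>))) * ennreal (sqrt (cmod (v \<eta>)) * cmod (w (\<xi> - \<eta>))) \<partial>lborel)\<^sup>2"
      by (rule power_mono) simp
    also have "\<dots> \<le> (\<integral>\<^sup>+ \<eta>. (ennreal (sqrt (cmod (v \<eta>))))\<^sup>2 \<partial>lborel) * (\<integral>\<^sup>+ \<eta>. (ennreal (sqrt (cmod (v \<eta>)) * cmod (w (\<xi> - \<eta>))))\<^sup>2 \<partial>lborel)"
      by (rule Cauchy_Schwarz_nn_integral) measurable
    also have "\<dots> = ennreal A * (\<integral>\<^sup>+ \<eta>. ennreal (cmod (v \<eta>)) * ennreal ((cmod (w (\<xi> - \<eta>)))\<^sup>2) \<partial>lborel)"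
      by (simp add: ennreal_power power_mult_distrib A ennreal_mult)
    finally show ?thesis by (simp add: ennreal_power)
  qed
  have "(\<integral>\<^sup>+ \<xi>. ennreal ((cmod (convolution v w \<xi>))\<^sup>2) \<partial>lborel)
    \<le> (\<integral>\<^sup>+ \<xi>. ennreal A * (\<integral>\<^sup>+ \<eta>. ennreal (cmod (v \<eta>)) * ennreal ((cmod (w (\<xi> - \<eta>)))\<^sup>2) \<partial>lborel) \<partial>lborel)"
    by (intro nn_integral_mono pw)
  also have "\<dots> = ennreal A * (\<integral>\<^sup>+ \<xi>. \<integral>\<^sup>+ \<eta>. ennreal (cmod (v \<eta>)) * ennreal ((cmod (w (\<xi> - \<eta>)))\<^sup>2) \<partial>lborel \<partial>lborel)"
    by (rule nn_integral_cmult) measurable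
  also have "(\<integral>\<^sup>+ \<xi>. \<integral>\<^sup>+ \<eta>. ennreal (cmod (v \<eta>)) * ennreal ((cmod (w (\<xi> - \<eta>)))\<^sup>2) \<partial>lborel \<partial>lborel)
     = (\<integral>\<^sup>+ \<eta>. \<integral>\<^sup>+ \<xi>. ennreal (cmod (v \<eta>)) * ennreal ((cmod (w (\<xi> - \<eta>)))\<^sup>2) \<partial>lborel \<partial>lborel)"
    by (rule lborel_pair.Fubini') measurable
  also have "\<dots> = (\<integral>\<^sup>+ \<eta>. ennreal (cmod (v \<eta>)) * ennreal ((L2_norm w)\<^sup>2) \<partial>lborel)"
    using nn_integral_L2_norm[OF w] nn_integral_shift[of "\<lambda>\<xi>. ennreal ((cmod (w \<xi>))\<^sup>2)"]
    by (simp add: nn_integral_cmult)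
  also have "\<dots> = ennreal A * ennreal ((L2_norm w)\<^sup>2)"
    by (simp add: nn_integral_multc A)
  also have "ennreal A * \<dots> = ennreal ((A * L2_norm w)\<^sup>2)"
    using A(2) by (simp add: power_mult_distrib power2_eq_square mult_ac flip: ennreal_mult)
  finally show "(\<integral>\<^sup>+ \<xi>. ennreal ((cmod (convolution v w \<xi>))\<^sup>2) \<partial>lborel) \<le> ennreal ((A * L2_norm w)\<^sup>2)" .
  show "0 \<le> A * L2_norm w" using A(2) by simp
qed

text \<open>Integrability of v lets u be written as a convergent integral: with p the transform of
  the conjugate of v, inversion reads 2 pi u = cnj p almost everywhere. By the convolution theorem
  the square of p is the transform of the conjugate of the convolution, and a second inversion
  returns to the convolution itself.\<close>

theorem is_fourier_square:
  assumes uv: "is_fourier u v" and i: "integrable lborel v"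
  shows "is_fourier (\<lambda>x. (u x)\<^sup>2) (\<lambda>\<xi>. convolution v v \<xi> / (2 * pi))"
proof -
  have u: "u \<in> L2" and v: "v \<in> L2" and FTu: "FT (lt u) = lt v"
    using uv by (auto simp: is_fourier_iff)
  note [measurable] = u[THEN L2_measurable] v[THEN L2_measurable]
  define h where "h = convolution v v"
  have h: "h \<in> L2" "integrable lborel h"
    unfolding h_def by (intro convolution_L2 convolution_integrable i v)+
  define p where "p = fourier_integral (\<lambda>\<xi>. cnj (v \<xi>))"
  have p: "p \<in> L2" "FT (lt (\<lambda>\<xi>. cnj (v \<xi>))) = lt p"
    unfolding p_def using FT_integrable[OF L2_cnj[OF v]] i by auto
  have "(2 * pi) *\<^sub>R lt u = cj (lt p)"
    using fourier_inversion[of "lt u"] by (simp add: FTu cj_lt v p)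
  then have "lt (\<lambda>x. (2 * pi) *\<^sub>R u x) = lt (\<lambda>x. cnj (p x))"
    by (simp only: lt_scaleR[OF u] cj_lt[OF p(1)])
  then have up: "AE x in lborel. (2 * pi) *\<^sub>R u x = cnj (p x)"
    using fn_lt[OF L2_scaleR[OF u, of "2 * pi"]] fn_lt[OF L2_cnj[OF p(1)]]
    by (auto elim!: eventually_elim2)
  have "(\<lambda>x. (p x)\<^sup>2) = fourier_integral (convolution (\<lambda>\<xi>. cnj (v \<xi>)) (\<lambda>\<xi>. cnj (v \<xi>)))"
    using i by (simp add: fun_eq_iff fourier_integral_convolution p_def power2_eq_square)
  also have "convolution (\<lambda>\<xi>. cnj (v \<xi>)) (\<lambda>\<xi>. cnj (v \<xi>)) = (\<lambda>\<xi>. cnj (h \<xi>))"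
    unfolding h_def convolution_def by (simp flip: complex_cnj_mult)
  finally have p2: "(\<lambda>x. (p x)\<^sup>2) = fourier_integral (\<lambda>\<xi>. cnj (h \<xi>))" .
  have q: "(\<lambda>x. (p x)\<^sup>2) \<in> L2" "FT (lt (\<lambda>\<xi>. cnj (h \<xi>))) = lt (\<lambda>x. (p x)\<^sup>2)"
    unfolding p2 using FT_integrable[OF L2_cnj[OF h(1)]] h(2) by auto
  \<comment> \<open>Squaring cnj p / (2 pi) gives two factors 1 / (2 pi); the inversion at the end
    restores one factor 2 pi.\<close>
  define c where "c = 1 / (2 * pi)\<^sup>2"
  have usq: "AE x in lborel. (u x)\<^sup>2 = c *\<^sub>R cnj ((p x)\<^sup>2)"
    using up
  proof eventually_elim
    case (elim x)
    have "c *\<^sub>R cnj ((p x)\<^sup>2) = c *\<^sub>R ((2 * pi) *\<^sub>R u x)\<^sup>2"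
      by (simp add: elim)
    also have "\<dots> = (u x)\<^sup>2" by (simp add: c_def scaleR_power)
    finally show ?case by simp
  qed
  have u2: "(\<lambda>x. (u x)\<^sup>2) \<in> L2"
    by (rule L2_cong_AE(1)[OF L2_scaleR[OF L2_cnj[OF q(1)], of c] _ usq]) measurable
  have "lt (\<lambda>x. (u x)\<^sup>2) = lt (\<lambda>x. c *\<^sub>R cnj ((p x)\<^sup>2))"
    by (rule lt_eqI[OF u2 L2_scaleR[OF L2_cnj[OF q(1)]] usq])
  also have "\<dots> = c *\<^sub>R cj (lt (\<lambda>x. (p x)\<^sup>2))"
    by (simp only: lt_scaleR[OF L2_cnj[OF q(1)]] cj_lt[OF q(1)])
  also have "lt (\<lambda>x. (p x)\<^sup>2) = FT (cj (lt h))"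
    by (simp only: q(2) cj_lt[OF h(1)])
  finally have "FT (lt (\<lambda>x. (u x)\<^sup>2)) = c *\<^sub>R (2 * pi) *\<^sub>R lt h"
    by (simp only: linear_scale[OF linear_FT] fourier_inversion')
  also have "\<dots> = (1 / (2 * pi)) *\<^sub>R lt h" by (simp add: c_def power2_eq_square)
  also have "\<dots> = lt (\<lambda>\<xi>. (1 / (2 * pi)) *\<^sub>R h \<xi>)" by (simp only: lt_scaleR[OF h(1)])
  also have "(\<lambda>\<xi>. (1 / (2 * pi)) *\<^sub>R h \<xi>) = (\<lambda>\<xi>. h \<xi> / (2 * pi))"
    by (simp add: scaleR_conv_of_real)
  finally show ?thesis
    unfolding is_fourier_iff h_def[symmetric]
    using u2 L2_scaleR[OF h(1), of "1 / (2 * pi)"] by (simp add: scaleR_conv_of_real)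
qed

subsection \<open>Ordinary differential equations in Banach spaces\<close>

lemma integral_exp_weight:
  fixes L :: real assumes "L > 0" "t \<ge> 0"
  shows "(\<lambda>s. K * exp (2 * L * s)) integrable_on {0..t}"
    and "integral {0..t} (\<lambda>s. K * exp (2 * L * s)) = K / (2 * L) * (exp (2 * L * t) - 1)"
proof -
  have "((\<lambda>s. K * exp (2 * L * s)) has_integral K / (2 * L) * exp (2 * L * t) - K / (2 * L) * exp (2 * L * 0)) {0..t}"
    using assms by (intro fundamental_theorem_of_calculus)
      (auto intro!: derivative_eq_intros simp flip: has_real_derivative_iff_has_vector_derivative)
  then have *: "((\<lambda>s. K * exp (2 * L * s)) has_integral K / (2 * L) * (exp (2 * L * t) - 1)) {0..t}"
    by (simp add: algebra_simps)
  show "(\<lambda>s. K * exp (2 * L * s)) integrable_on {0..t}"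
    using * by blast
  show "integral {0..t} (\<lambda>s. K * exp (2 * L * s)) = K / (2 * L) * (exp (2 * L * t) - 1)"
    using * by (rule integral_unique)
qed

text \<open>The weight \<open>exp (- 2 L t)\<close> (Bielecki) makes the Picard operator a contraction on the whole half-line.\<close>

lemma lipschitz_ode_solution:
  fixes G :: "'a :: banach \<Rightarrow> 'a"
  assumes L: "L > 0" and lip: "\<And>x y. norm (G x - G y) \<le> L * norm (x - y)"
  shows "\<exists>x :: real \<Rightarrow> 'a. continuous_on {0..} x \<and> (\<forall>t\<ge>0. x t = x0 + integral {0..t} (\<lambda>s. G (x s)))"
proof -
  have contG: "continuous_on UNIV G"
  proof (rule continuous_on_iff[THEN iffD2], intro ballI allI impI)
    fix x and e :: real assume "e > 0"
    have "dist (G x') (G x) < e" if "dist x' x < e / L" for x'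
      using lip[of x' x] that L by (simp add: dist_norm field_simps)
    then show "\<exists>d>0. \<forall>x'\<in>UNIV. dist x' x < d \<longrightarrow> dist (G x') (G x) < e"
      using \<open>e > 0\<close> L by (intro exI[of _ "e / L"]) auto
  qed
  \<comment> \<open>The unknown is y s = exp (- 2 L s) x s, which stays bounded although x may grow
    exponentially.\<close>
  define I where "I y t = integral {0..t} (\<lambda>s. G (exp (2 * L * s) *\<^sub>R apply_bcontfun y s))" for y :: "real \<Rightarrow>\<^sub>C 'a" and t
  have contI: "continuous_on {0..b} (\<lambda>s. G (exp (2 * L * s) *\<^sub>R apply_bcontfun y s))" for y b
    by (intro continuous_on_compose2[OF contG] continuous_intros) auto
  have intI: "(\<lambda>s. G (exp (2 * L * s) *\<^sub>R apply_bcontfun y s)) integrable_on {0..b}" for y b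
    by (rule integrable_continuous_interval) (rule contI)
  \<comment> \<open>The Banach space used consists of bounded continuous functions on the whole
    line. The absolute value extends the operator to negative times, and only t >= 0 is read off at
    the end.\<close>
  define \<Phi> where "\<Phi> y t = exp (- 2 * L * \<bar>t\<bar>) *\<^sub>R (x0 + I y \<bar>t\<bar>)" for y t
  have cont: "continuous_on UNIV (\<Phi> y)" for y
  proof -
    have "continuous_on {0..} (I y)"
    \<comment> \<open>Continuity of an indefinite integral is available on compact intervals. The
      half-open intervals place each t >= 0 strictly below the right end of one of these, where the
      relative neighbourhoods agree.\<close>
    proof (rule continuous_on_subset[where s = "\<Union>n::nat. {0..<real n}"])
      show "continuous_on (\<Union>n::nat. {0..<real n}) (I y)"
        unfolding continuous_on_eq_continuous_within
      proof
        fix t assume "t \<in> (\<Union>n::nat. {0..<real n})"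
        then obtain n :: nat where t: "0 \<le> t" "t < real n" by auto
        have "continuous_on {0..real n} (I y)"
          unfolding I_def by (rule indefinite_integral_continuous_1[OF intI])
        then have "continuous (at t within {0..real n}) (I y)"
          using t by (auto simp: continuous_on_eq_continuous_within)
        moreover have "at t within {0..real n} = at t within (\<Union>n::nat. {0..<real n})"
        proof (rule at_within_nhd[of _ "{..<real n}"])
          show "{0..real n} \<inter> {..<real n} - {t} = (\<Union>n::nat. {0..<real n}) \<inter> {..<real n} - {t}"
            by fastforce
        qed (use t in auto)
        ultimately show "continuous (at t within (\<Union>n::nat. {0..<real n})) (I y)" by simp
      qed
      show "{0..} \<subseteq> (\<Union>n::nat. {0..<real n})"
        using reals_Archimedean2 by auto
    qed
    then show ?thesis
      unfolding \<Phi>_def by (intro continuous_intros continuous_on_compose2[of "{0..}" "I y" UNIV abs]) auto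
  qed
  have bound: "norm (\<Phi> y t) \<le> norm x0 + (norm (G 0) + L * norm y) / (2 * L)" for y t
  proof -
    define K where "K = norm (G 0) + L * norm y"
    have K: "K \<ge> 0" using L by (simp add: K_def)
    have "norm (G (exp (2 * L * s) *\<^sub>R apply_bcontfun y s)) \<le> K * exp (2 * L * s)" if "s \<ge> 0" for s
    proof -
      have "norm (G (exp (2 * L * s) *\<^sub>R apply_bcontfun y s)) \<le> norm (G 0) + L * norm (exp (2 * L * s) *\<^sub>R apply_bcontfun y s)"
        using lip[of "exp (2 * L * s) *\<^sub>R apply_bcontfun y s" 0]
          norm_triangle_sub[of "G (exp (2 * L * s) *\<^sub>R apply_bcontfun y s)" "G 0"] by simp
      also have "\<dots> \<le> norm (G 0) * exp (2 * L * s) + L * (exp (2 * L * s) * norm y)"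
        using L that norm_bounded[of y s] by (intro add_mono mult_left_mono) (auto intro: mult_left_mono simp: mult_le_cancel_left1)
      finally show ?thesis by (simp add: K_def algebra_simps)
    qed
    then have "norm (I y \<bar>t\<bar>) \<le> integral {0..\<bar>t\<bar>} (\<lambda>s. K * exp (2 * L * s))"
      unfolding I_def by (intro integral_norm_bound_integral intI integral_exp_weight L) auto
    also have "\<dots> = K / (2 * L) * (exp (2 * L * \<bar>t\<bar>) - 1)" by (rule integral_exp_weight(2)[OF L]) simp
    also have "\<dots> \<le> K / (2 * L) * exp (2 * L * \<bar>t\<bar>)" using K L by (intro mult_left_mono) auto
    finally have "norm (x0 + I y \<bar>t\<bar>) \<le> norm x0 + K / (2 * L) * exp (2 * L * \<bar>t\<bar>)"
      by (intro order_trans[OF norm_triangle_ineq] add_left_mono)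
    then have "norm (\<Phi> y t) \<le> exp (- 2 * L * \<bar>t\<bar>) * (norm x0 + K / (2 * L) * exp (2 * L * \<bar>t\<bar>))"
      unfolding \<Phi>_def norm_scaleR by (intro mult_mono) auto
    also have "\<dots> = exp (- 2 * L * \<bar>t\<bar>) * norm x0 + K / (2 * L)"
      by (simp add: algebra_simps exp_minus_inverse flip: exp_add)
    also have "\<dots> \<le> 1 * norm x0 + K / (2 * L)"
      using L by (intro add_right_mono mult_right_mono) auto
    finally show ?thesis by (simp add: K_def)
  qed
  have mem: "\<Phi> y \<in> bcontfun" for y
    by (rule bcontfun_normI[OF cont bound])
  define \<Psi> where "\<Psi> y = Bcontfun (\<Phi> y)" for y
  have \<Psi>: "apply_bcontfun (\<Psi> y) = \<Phi> y" for y
    unfolding \<Psi>_def by (rule Bcontfun_inverse[OF mem])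
  have "\<exists>!y. \<Psi> y = y"
  proof (rule banach_fix_type[where c = "1/2"])
    \<comment> \<open>The rate 2 L in the weight gives L times the integral of exp (2 L s) over
      [0,t] at most exp (2 L t) / 2, hence the contraction factor 1/2.\<close>
    have "dist (\<Psi> y) (\<Psi> z) \<le> 1 / 2 * dist y z" for y z
    proof (rule dist_bound)
      fix t
      have "norm (G (exp (2 * L * s) *\<^sub>R apply_bcontfun y s) - G (exp (2 * L * s) *\<^sub>R apply_bcontfun z s))
          \<le> (L * dist y z) * exp (2 * L * s)" for s
      proof -
        have "norm (G (exp (2 * L * s) *\<^sub>R apply_bcontfun y s) - G (exp (2 * L * s) *\<^sub>R apply_bcontfun z s))
           \<le> L * norm (exp (2 * L * s) *\<^sub>R apply_bcontfun y s - exp (2 * L * s) *\<^sub>R apply_bcontfun z s)" by (rule lip)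
        also have "\<dots> = L * (exp (2 * L * s) * dist (apply_bcontfun y s) (apply_bcontfun z s))"
          by (simp add: dist_norm flip: scaleR_diff_right)
        also have "\<dots> \<le> L * (exp (2 * L * s) * dist y z)"
          using L by (intro mult_left_mono dist_bounded) auto
        finally show ?thesis by (simp add: mult_ac)
      qed
      then have "norm (integral {0..\<bar>t\<bar>} (\<lambda>s. G (exp (2 * L * s) *\<^sub>R apply_bcontfun y s) - G (exp (2 * L * s) *\<^sub>R apply_bcontfun z s)))
          \<le> integral {0..\<bar>t\<bar>} (\<lambda>s. (L * dist y z) * exp (2 * L * s))"
        by (intro integral_norm_bound_integral integrable_diff intI integral_exp_weight L) auto
      then have "norm (I y \<bar>t\<bar> - I z \<bar>t\<bar>) \<le> integral {0..\<bar>t\<bar>} (\<lambda>s. (L * dist y z) * exp (2 * L * s))"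
        unfolding I_def by (simp only: Henstock_Kurzweil_Integration.integral_diff[OF intI intI])
      also have "\<dots> = (L * dist y z) / (2 * L) * (exp (2 * L * \<bar>t\<bar>) - 1)" by (rule integral_exp_weight(2)[OF L]) simp
      also have "\<dots> \<le> dist y z / 2 * exp (2 * L * \<bar>t\<bar>)"
        using L by (simp add: field_simps)
      finally have le: "norm (I y \<bar>t\<bar> - I z \<bar>t\<bar>) \<le> dist y z / 2 * exp (2 * L * \<bar>t\<bar>)" .
      have "dist (\<Phi> y t) (\<Phi> z t) = exp (- 2 * L * \<bar>t\<bar>) * norm (I y \<bar>t\<bar> - I z \<bar>t\<bar>)"
        by (simp add: \<Phi>_def dist_norm flip: scaleR_diff_right)
      also have "\<dots> \<le> exp (- 2 * L * \<bar>t\<bar>) * (dist y z / 2 * exp (2 * L * \<bar>t\<bar>))"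
        by (intro mult_left_mono le) auto
      also have "\<dots> = 1 / 2 * dist y z" by (simp add: exp_minus field_simps)
      finally show "dist (apply_bcontfun (\<Psi> y) t) (apply_bcontfun (\<Psi> z) t) \<le> 1 / 2 * dist y z"
        by (simp only: \<Psi>)
    qed
    then show "\<forall>y. \<forall>z. dist (\<Psi> y) (\<Psi> z) \<le> 1 / 2 * dist y z" by blast
  qed auto
  then obtain y where y: "\<Psi> y = y" by blast
  define x where "x t = exp (2 * L * t) *\<^sub>R apply_bcontfun y t" for t
  show ?thesis
  proof (intro exI[of _ x] conjI allI impI)
    show "continuous_on {0..} x" unfolding x_def by (intro continuous_intros continuous_on_apply_bcontfun)
    fix t :: real assume t: "t \<ge> 0"
    have "apply_bcontfun y t = \<Phi> y t" using \<Psi>[of y] y by simp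
    then have "x t = (exp (2 * L * t) * exp (- 2 * L * t)) *\<^sub>R (x0 + I y t)"
      using t by (simp add: x_def \<Phi>_def)
    also have "\<dots> = x0 + I y t" by (simp flip: exp_add)
    finally show "x t = x0 + integral {0..t} (\<lambda>s. G (x s))"
      unfolding I_def x_def .
  qed
qed

text \<open>A Gronwall argument by maximum: at a maximum m of the weighted distance d, the integral
  equations yield d m <= d m / 2. The right-hand sides are separate functions f and g of time, so
  that the Lipschitz bound is required only along the two given curves.\<close>

lemma ode_unique:
  fixes x y :: "real \<Rightarrow> 'a :: banach"
  assumes L: "L > 0" and T: "T \<ge> 0"
    and cont: "continuous_on {0..T} x" "continuous_on {0..T} y"
    and int: "continuous_on {0..T} f" "continuous_on {0..T} g"
    and x: "\<And>t. t \<in> {0..T} \<Longrightarrow> x t = x0 + integral {0..t} f"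
    and y: "\<And>t. t \<in> {0..T} \<Longrightarrow> y t = x0 + integral {0..t} g"
    and lip: "\<And>t. t \<in> {0..T} \<Longrightarrow> norm (f t - g t) \<le> L * norm (x t - y t)"
    and t: "t \<in> {0..T}"
  shows "x t = y t"
proof -
  define d where "d t = exp (- 2 * L * t) * norm (x t - y t)" for t
  have "continuous_on {0..T} d"
    unfolding d_def by (intro continuous_intros cont)
  moreover have "{0..T} \<noteq> {}" using T by simp
  ultimately obtain m where m: "m \<in> {0..T}" "\<And>t. t \<in> {0..T} \<Longrightarrow> d t \<le> d m"
    using continuous_attains_sup[OF compact_Icc] by metis
  have sub: "{0..m} \<subseteq> {0..T}" using m(1) by auto
  have fi: "f integrable_on {0..m}" and gi: "g integrable_on {0..m}"
    by (intro integrable_continuous_interval continuous_on_subset[OF _ sub] int)+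
  have "norm (f s - g s) \<le> (L * d m) * exp (2 * L * s)" if "s \<in> {0..m}" for s
  proof -
    have s: "s \<in> {0..T}" using that m(1) by auto
    have "norm (x s - y s) = exp (2 * L * s) * d s"
      by (simp add: d_def flip: exp_add mult.assoc)
    also have "\<dots> \<le> exp (2 * L * s) * d m" using m(2)[OF s] by (intro mult_left_mono) auto
    finally have "L * norm (x s - y s) \<le> L * (exp (2 * L * s) * d m)" using L by (intro mult_left_mono) auto
    then show ?thesis using lip[OF s] by (simp add: mult_ac)
  qed
  then have "norm (integral {0..m} (\<lambda>s. f s - g s)) \<le> integral {0..m} (\<lambda>s. (L * d m) * exp (2 * L * s))"
    using m(1) by (intro integral_norm_bound_integral integrable_diff fi gi integral_exp_weight L) auto
  also have "\<dots> = (L * d m) / (2 * L) * (exp (2 * L * m) - 1)"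
    using m(1) by (intro integral_exp_weight(2) L) auto
  also have "\<dots> \<le> d m / 2 * exp (2 * L * m)"
  proof -
    have "0 \<le> d m" by (simp add: d_def)
    then show ?thesis using L by (simp add: field_simps)
  qed
  also have "integral {0..m} (\<lambda>s. f s - g s) = x m - y m"
    using Henstock_Kurzweil_Integration.integral_diff[OF fi gi] x[OF m(1)] y[OF m(1)] by simp
  finally have "exp (- 2 * L * m) * norm (x m - y m) \<le> exp (- 2 * L * m) * (d m / 2 * exp (2 * L * m))"
    by (intro mult_left_mono) auto
  also have "\<dots> = d m / 2" by (simp add: exp_minus field_simps)
  finally have "d m \<le> 0" by (simp add: d_def)
  then have "d t \<le> 0" using m(2)[OF t] by simp
  then show ?thesis by (simp add: d_def mult_le_0_iff)
qed

section \<open>Global solutions from an energy inequality\<close>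

definition radial_clamp :: "real \<Rightarrow> 'a \<Rightarrow> 'a :: real_normed_vector" where
  "radial_clamp r x = (r / max r (norm x)) *\<^sub>R x"

lemma radial_clamp_le: "r > 0 \<Longrightarrow> norm (radial_clamp r x) \<le> r"
  by (auto simp: radial_clamp_def max_def divide_simps)

lemma radial_clamp_eq: "r > 0 \<Longrightarrow> norm x \<le> r \<Longrightarrow> radial_clamp r x = x"
  by (auto simp: radial_clamp_def max_def)

text \<open>Changing the vector while keeping the factor of x, and then changing the factor, each
  costs at most \<open>norm (x - y)\<close>. The second step uses that the norm is
  1-Lipschitz.\<close>

lemma radial_clamp_lipschitz:
  assumes r: "r > 0" shows "norm (radial_clamp r x - radial_clamp r y) \<le> 2 * norm (x - y)"
proof -
  define p q where "p = max r (norm x)" and "q = max r (norm y)"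
  have pq: "r \<le> p" "r \<le> q" "p > 0" "q > 0" "norm y \<le> q" using r by (auto simp: p_def q_def)
  have "radial_clamp r x - radial_clamp r y = (r / p) *\<^sub>R (x - y) + (r / p - r / q) *\<^sub>R y"
    by (simp add: radial_clamp_def p_def q_def algebra_simps)
  moreover have "norm ((r / p) *\<^sub>R (x - y)) \<le> 1 * norm (x - y)"
    unfolding norm_scaleR using pq r by (intro mult_right_mono) auto
  moreover have "norm ((r / p - r / q) *\<^sub>R y) \<le> norm (x - y)"
  proof -
    have "r / p - r / q = (r / p) * ((q - p) / q)" using pq by (simp add: field_simps)
    then have "norm ((r / p - r / q) *\<^sub>R y) = (r / p) * (\<bar>q - p\<bar> * (norm y / q))"
      using pq r by (simp add: abs_mult)
    also have "\<dots> \<le> 1 * (\<bar>q - p\<bar> * 1)"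
      using pq r by (intro mult_mono) auto
    also have "\<bar>q - p\<bar> \<le> norm (x - y)"
      using norm_triangle_ineq3[of x y] by (auto simp: p_def q_def max_def)
    finally show ?thesis by simp
  qed
  ultimately show ?thesis
    using norm_triangle_ineq[of "(r / p) *\<^sub>R (x - y)" "(r / p - r / q) *\<^sub>R y"] by simp
qed

text \<open>Since the vector field is truncated outside the ball of radius \<open>r\<close>, the solution is global
  from the start, and the energy inequality only has to show that it never meets the truncation.\<close>

lemma energy_ode_solution:
  fixes F :: "'a :: {real_inner, banach} \<Rightarrow> 'a"
  assumes L: "L > 0" and r: "r > 0" and D: "D \<ge> 0"
    and lip: "\<And>x y. norm x \<le> r \<Longrightarrow> norm y \<le> r \<Longrightarrow> norm (F x - F y) \<le> L * norm (x - y)"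
    and J: "bounded_linear J" "\<And>x. norm (J x) = norm x" "\<And>x. F (J x) = J (F x)"
    and energy: "\<And>x. J x = x \<Longrightarrow> inner x (F x) \<le> D * norm x ^ 3"
    and x0: "norm x0 \<le> r / 2" "J x0 = x0"
  obtains x :: "real \<Rightarrow> 'a" where "continuous_on {0..} x"
    "\<And>T t. T \<ge> 0 \<Longrightarrow> 8 * T * D * r \<le> 1 \<Longrightarrow> t \<in> {0..T} \<Longrightarrow> norm (x t) \<le> r"
    "\<And>T t. T \<ge> 0 \<Longrightarrow> 8 * T * D * r \<le> 1 \<Longrightarrow> t \<in> {0..T} \<Longrightarrow> x t = x0 + integral {0..t} (\<lambda>s. F (x s))"
proof -
  define G where "G x = F (radial_clamp r x)" for x
  have lipG: "norm (G x - G y) \<le> (2 * L) * norm (x - y)" for x y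
  proof -
    have "norm (G x - G y) \<le> L * norm (radial_clamp r x - radial_clamp r y)"
      unfolding G_def by (intro lip radial_clamp_le r)
    also have "\<dots> \<le> L * (2 * norm (x - y))" using L by (intro mult_left_mono radial_clamp_lipschitz r) auto
    finally show ?thesis by simp
  qed
  have L2: "0 < 2 * L" using L by simp
  obtain x :: "real \<Rightarrow> 'a" where x: "continuous_on {0..} x" "\<And>t. t \<ge> 0 \<Longrightarrow> x t = x0 + integral {0..t} (\<lambda>s. G (x s))"
    using lipschitz_ode_solution[OF L2 lipG, of x0] by blast
  have contG: "continuous_on UNIV G"
  proof (rule continuous_on_iff[THEN iffD2], intro ballI allI impI)
    fix x and e :: real assume "e > 0"
    have "dist (G x') (G x) < e" if "dist x' x < e / (2 * L)" for x'
      using lipG[of x' x] that L by (simp add: dist_norm field_simps)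
    then show "\<exists>d>0. \<forall>x'\<in>UNIV. dist x' x < d \<longrightarrow> dist (G x') (G x) < e"
      using \<open>e > 0\<close> L by (intro exI[of _ "e / (2 * L)"]) auto
  qed
  have contx: "continuous_on {0..T} x" for T
    using x(1) by (rule continuous_on_subset) auto
  have contGx: "continuous_on {0..T} (\<lambda>s. G (x s))" for T
    by (rule continuous_on_compose2[OF contG contx]) auto
  have JG: "G (J x) = J (G x)" for x
    by (simp add: G_def radial_clamp_def J linear_scale[OF bounded_linear.linear[OF J(1)], symmetric])
  \<comment> \<open>J commutes with G and fixes the datum, so J x solves the same equation as x.
    Uniqueness keeps the solution in the fixed space of J, where alone the energy inequality is
    available.\<close>
  have Jx: "J (x t) = x t" if t: "t \<ge> 0" for t
  proof (rule ode_unique[where L = "2 * L" and T = t and x = "\<lambda>t :: real. J (x t)" and y = x])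
    show "continuous_on {0..t} (\<lambda>t. J (x t))"
      by (rule bounded_linear.continuous_on[OF J(1) contx])
    show "continuous_on {0..t} (\<lambda>s. J (G (x s)))"
      by (rule bounded_linear.continuous_on[OF J(1) contGx])
    show "continuous_on {0..t} (\<lambda>s. G (x s))" by (rule contGx)
    show "x s = x0 + integral {0..s} (\<lambda>s. G (x s))" if "s \<in> {0..t}" for s
      using that by (intro x) auto
    show "J (x s) = x0 + integral {0..s} (\<lambda>s. J (G (x s)))" if "s \<in> {0..t}" for s
    proof -
      have "integral {0..s} (J \<circ> (\<lambda>s. G (x s))) = J (integral {0..s} (\<lambda>s. G (x s)))"
        by (rule integral_linear[OF integrable_continuous_interval[OF contGx] J(1)])
      then show ?thesis
        using x(2)[of s] that by (simp add: o_def x0 linear_add[OF bounded_linear.linear[OF J(1)]])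
    qed
    show "norm (J (G (x s)) - G (x s)) \<le> (2 * L) * norm (J (x s) - x s)" if "s \<in> {0..t}" for s
      using lipG[of "J (x s)" "x s"] by (simp add: JG)
  qed (use L t contx in auto)
  have le: "norm (x t) \<le> r" if T: "T \<ge> 0" "8 * T * D * r \<le> 1" and t: "t \<in> {0..T}" for T t
  proof (rule ccontr)
    assume "\<not> norm (x t) \<le> r"
    have "continuous_on {0..T} (\<lambda>t. norm (x t))" by (intro continuous_intros contx)
    moreover have "{0..T} \<noteq> {}" using T by simp
    ultimately obtain m where m: "m \<in> {0..T}" "\<And>t. t \<in> {0..T} \<Longrightarrow> norm (x t) \<le> norm (x m)"
      using continuous_attains_sup[OF compact_Icc] by metis
    define S where "S = norm (x m)"
    have S: "S > r" using m(2)[OF t] \<open>\<not> norm (x t) \<le> r\<close> by (simp add: S_def)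
    have deriv: "((\<lambda>t. inner (x t) (x t)) has_real_derivative 2 * inner (x s) (G (x s))) (at s within {0..T})"
      if s: "s \<in> {0..T}" for s
    proof -
      have "((\<lambda>t. x0 + integral {0..t} (\<lambda>s. G (x s))) has_vector_derivative (0 + G (x s))) (at s within {0..T})"
        by (intro has_vector_derivative_add has_vector_derivative_const integral_has_vector_derivative contGx s)
      then have *: "((\<lambda>t. x0 + integral {0..t} (\<lambda>s. G (x s))) has_vector_derivative G (x s)) (at s within {0..T})"
        by simp
      have "(x has_vector_derivative G (x s)) (at s within {0..T})"
        by (rule has_vector_derivative_transform[OF s _ *]) (rule x(2), simp)
      then have "(x has_derivative (\<lambda>h. h *\<^sub>R G (x s))) (at s within {0..T})"
        by (simp add: has_vector_derivative_def)
      from has_derivative_inner[OF this this]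
      have "((\<lambda>t. inner (x t) (x t)) has_derivative (\<lambda>h. inner (x s) (h *\<^sub>R G (x s)) + inner (h *\<^sub>R G (x s)) (x s))) (at s within {0..T})" .
      then show ?thesis
        by (simp add: has_field_derivative_def inner_commute mult_commute_abs algebra_simps)
    qed
    have bnd: "inner (x s) (G (x s)) \<le> D * r\<^sup>2 * S" if s: "s \<in> {0..T}" for s
    proof -
      define p where "p = radial_clamp r (x s)"
      define k where "k = max r (norm (x s)) / r"
      have k: "k > 0" using r by (simp add: k_def)
      have xp: "x s = k *\<^sub>R p" using r by (auto simp: k_def p_def radial_clamp_def max_def)
      have "J p = p"
        using Jx[of s] s by (simp add: p_def radial_clamp_def linear_scale[OF bounded_linear.linear[OF J(1)]])
      then have "inner p (F p) \<le> D * norm p ^ 3" by (rule energy)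
      also have "\<dots> \<le> D * r ^ 3" unfolding p_def using D by (intro mult_left_mono power_mono radial_clamp_le r) auto
      finally have "k * inner p (F p) \<le> k * (D * r ^ 3)" using k by (intro mult_left_mono) auto
      also have "\<dots> = max r (norm (x s)) * (D * r\<^sup>2)" using r by (simp add: k_def power2_eq_square power3_eq_cube)
      also have "\<dots> \<le> S * (D * r\<^sup>2)"
        using S m(2)[OF s] D by (intro mult_right_mono) (auto simp: S_def)
      finally show ?thesis by (subst xp) (simp add: G_def p_def mult_ac)
    qed
    \<comment> \<open>At the maximal norm S > r the squared norm has grown by at most (8 T D r) r S
      / 4 <= S^2 / 4, and the datum contributes at most r^2 / 4 < S^2 / 4. Their sum is below S^2, a
      contradiction; this is the purpose of the factor 8.\<close>
    have "inner (x m) (x m) - inner (x 0) (x 0) \<le> 2 * (D * r\<^sup>2 * S) * (m - 0)"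
    proof (cases "m = 0")
      case False
      then have m0: "0 < m" using m(1) by simp
      have "\<exists>z\<in>{0<..<m}. inner (x m) (x m) - inner (x 0) (x 0) = (m - 0) * (2 * inner (x z) (G (x z)))"
      proof (rule mvt_simple[OF m0, of "\<lambda>t. inner (x t) (x t)" "\<lambda>s h. h * (2 * inner (x s) (G (x s)))"])
        fix s assume "0 \<le> s" "s \<le> m"
        then have s: "s \<in> {0..T}" using m(1) by auto
        show "((\<lambda>t. inner (x t) (x t)) has_derivative (\<lambda>h. h * (2 * inner (x s) (G (x s))))) (at s within {0..m})"
          using has_field_derivative_subset[OF deriv[OF s], of "{0..m}"] m(1)
          by (simp add: has_field_derivative_def mult_commute_abs)
      qed
      then obtain z where z: "0 < z" "z < m" "inner (x m) (x m) - inner (x 0) (x 0) = (m - 0) * (2 * inner (x z) (G (x z)))"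
        by auto
      have "(m - 0) * (2 * inner (x z) (G (x z))) \<le> (m - 0) * (2 * (D * r\<^sup>2 * S))"
        using bnd[of z] z m(1) by (intro mult_left_mono) auto
      then show ?thesis using z(3) by (simp add: mult_ac)
    qed simp
    also have "\<dots> \<le> 2 * (D * r\<^sup>2 * S) * T"
      using m(1) D S r by (intro mult_left_mono) auto
    also have "\<dots> = (8 * T * D * r) * (r * S) / 4" by (simp add: power2_eq_square)
    also have "\<dots> \<le> 1 * (r * S) / 4"
      using T S r by (intro divide_right_mono mult_right_mono) auto
    also have "\<dots> \<le> S\<^sup>2 / 4" using S r by (simp add: power2_eq_square)
    finally have "S\<^sup>2 - (norm x0)\<^sup>2 \<le> S\<^sup>2 / 4"
      using x(2)[of 0] by (simp add: S_def power2_norm_eq_inner)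
    moreover have "(norm x0)\<^sup>2 \<le> r\<^sup>2 / 4"
      using power_mono[OF x0(1) norm_ge_zero, of 2] by (simp add: power_divide)
    moreover have "r\<^sup>2 < S\<^sup>2" using S r by (intro power_strict_mono) auto
    ultimately show False
      using zero_le_power2[of S] by linarith
  qed
  show thesis
  proof (rule that[OF x(1)])
    fix T t assume T: "T \<ge> 0" "8 * T * D * r \<le> 1" and t: "t \<in> {0..T}"
    show "norm (x t) \<le> r" by (rule le[OF T t])
    have "integral {0..t} (\<lambda>s. G (x s)) = integral {0..t} (\<lambda>s. F (x s))"
    proof (rule integral_cong)
      fix s assume "s \<in> {0..t}"
      then have "norm (x s) \<le> r" using t by (intro le[OF T]) auto
      then show "G (x s) = F (x s)" by (simp add: G_def radial_clamp_eq r)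
    qed
    then show "x t = x0 + integral {0..t} (\<lambda>s. F (x s))" using x(2)[of t] t by simp
  qed
qed

subsection \<open>Multiplication operators and convolution kernels\<close>

text \<open>Used for bounded measurable symbols g. For others the product may leave
  \<open>L2\<close>, where \<open>lt\<close> is unspecified.\<close>

definition mult_op :: "(real \<Rightarrow> complex) \<Rightarrow> ltwo \<Rightarrow> ltwo" where
  "mult_op g V = lt (\<lambda>x. g x * fn V x)"

lemma mult_op_L2:
  assumes "g \<in> borel_measurable borel" "\<And>x. cmod (g x) \<le> c" "f \<in> L2"
  shows "(\<lambda>x. g x * f x) \<in> L2" "L2_norm (\<lambda>x. g x * f x) \<le> c * L2_norm f"
proof -
  note [measurable] = assms(1) L2_measurable[OF assms(3)]
  have "0 \<le> c" using assms(2)[of 0] norm_ge_zero order_trans by blast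
  moreover have "AE x in lborel. cmod (g x * f x) \<le> c * cmod (f x)"
    using assms(2) by (auto simp: norm_mult intro!: mult_right_mono)
  ultimately show "(\<lambda>x. g x * f x) \<in> L2" "L2_norm (\<lambda>x. g x * f x) \<le> c * L2_norm f"
    using L2_bound[of "\<lambda>x. g x * f x" f c] assms(3) by auto
qed

lemma fn_mult_op:
  assumes "g \<in> borel_measurable borel" "\<And>x. cmod (g x) \<le> c"
  shows "AE x in lborel. fn (mult_op g V) x = g x * fn V x"
  unfolding mult_op_def by (rule fn_lt) (rule mult_op_L2(1)[OF assms fn_L2])

lemma mult_op_lt:
  assumes "g \<in> borel_measurable borel" "\<And>x. cmod (g x) \<le> c" "f \<in> L2"
  shows "mult_op g (lt f) = lt (\<lambda>x. g x * f x)"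
  by (rule ltwo_eqI) (use fn_mult_op[OF assms(1,2), of "lt f"] fn_lt[OF assms(3)] fn_lt[OF mult_op_L2(1)[OF assms]]
      in eventually_elim, simp)

lemma norm_mult_op_le:
  assumes "g \<in> borel_measurable borel" "\<And>x. cmod (g x) \<le> c"
  shows "norm (mult_op g V) \<le> c * norm V"
  unfolding mult_op_def norm_ltwo[of V] norm_lt[OF mult_op_L2(1)[OF assms fn_L2]]
  by (rule mult_op_L2(2)[OF assms fn_L2])

lemma bounded_linear_mult_op:
  assumes "g \<in> borel_measurable borel" "\<And>x. cmod (g x) \<le> c"
  shows "bounded_linear (mult_op g)"
proof (rule bounded_linear_intro)
  note fn = fn_mult_op[OF assms]
  show "mult_op g (V + W) = mult_op g V + mult_op g W" for V W
    by (rule ltwo_eqI) (use fn[of V] fn[of W] fn[of "V + W"] fn_add[of V W] fn_add[of "mult_op g V" "mult_op g W"]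
      in eventually_elim, simp add: algebra_simps)
  show "mult_op g (k *\<^sub>R V) = k *\<^sub>R mult_op g V" for k V
    by (rule ltwo_eqI) (use fn[of V] fn[of "k *\<^sub>R V"] fn_scaleR[of k V] fn_scaleR[of k "mult_op g V"]
      in eventually_elim, simp)
  show "norm (mult_op g V) \<le> norm V * c" for V
    using norm_mult_op_le[OF assms] by (simp add: mult.commute)
qed

lemma mult_op_mult_op:
  assumes g: "g \<in> borel_measurable borel" "\<And>x. cmod (g x) \<le> c" and h: "h \<in> borel_measurable borel" "\<And>x. cmod (h x) \<le> d"
  shows "mult_op g (mult_op h V) = mult_op (\<lambda>x. g x * h x) V"
proof -
  have [measurable]: "g \<in> borel_measurable borel" "h \<in> borel_measurable borel" by fact+
  have "cmod (g x * h x) \<le> c * d" for x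
    unfolding norm_mult using g(2)[of x] h(2)[of x] order_trans[OF norm_ge_zero g(2)] by (intro mult_mono) auto
  then have gh: "AE x in lborel. fn (mult_op (\<lambda>x. g x * h x) V) x = g x * h x * fn V x"
    by (rule fn_mult_op[rotated]) measurable
  show ?thesis
    by (rule ltwo_eqI) (use gh fn_mult_op[OF g, of "mult_op h V"] fn_mult_op[OF h, of V] in eventually_elim, simp)
qed

text \<open>Cauchy-Schwarz in y separates the kernel from the functions, and after exchanging the
  integrals the remaining double integral factorises by translation invariance.\<close>

lemma kernel_bound:
  fixes K :: "real \<Rightarrow> real \<Rightarrow> ennreal"
  assumes [measurable]: "(\<lambda>(x, y). K x y) \<in> borel_measurable (borel \<Otimes>\<^sub>M borel)"
    "a \<in> borel_measurable borel" "b \<in> borel_measurable borel"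
    and K: "\<And>x. (\<integral>\<^sup>+ y. (K x y)\<^sup>2 \<partial>lborel) \<le> B"
  shows "(\<integral>\<^sup>+ x. (\<integral>\<^sup>+ y. K x y * (a y * b (x - y)) \<partial>lborel)\<^sup>2 \<partial>lborel)
    \<le> B * (\<integral>\<^sup>+ x. (a x)\<^sup>2 \<partial>lborel) * (\<integral>\<^sup>+ x. (b x)\<^sup>2 \<partial>lborel)"
proof -
  have "(\<integral>\<^sup>+ x. (\<integral>\<^sup>+ y. K x y * (a y * b (x - y)) \<partial>lborel)\<^sup>2 \<partial>lborel)
    \<le> (\<integral>\<^sup>+ x. B * (\<integral>\<^sup>+ y. (a y)\<^sup>2 * (b (x - y))\<^sup>2 \<partial>lborel) \<partial>lborel)"
  proof (rule nn_integral_mono)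
    fix x
    have "(\<integral>\<^sup>+ y. K x y * (a y * b (x - y)) \<partial>lborel)\<^sup>2
        \<le> (\<integral>\<^sup>+ y. (K x y)\<^sup>2 \<partial>lborel) * (\<integral>\<^sup>+ y. (a y * b (x - y))\<^sup>2 \<partial>lborel)"
      by (rule Cauchy_Schwarz_nn_integral) measurable
    also have "\<dots> \<le> B * (\<integral>\<^sup>+ y. (a y)\<^sup>2 * (b (x - y))\<^sup>2 \<partial>lborel)"
      using K by (intro mult_mono) (auto simp: power_mult_distrib)
    finally show "(\<integral>\<^sup>+ y. K x y * (a y * b (x - y)) \<partial>lborel)\<^sup>2 \<le> B * (\<integral>\<^sup>+ y. (a y)\<^sup>2 * (b (x - y))\<^sup>2 \<partial>lborel)" .
  qed
  also have "\<dots> = B * (\<integral>\<^sup>+ x. \<integral>\<^sup>+ y. (a y)\<^sup>2 * (b (x - y))\<^sup>2 \<partial>lborel \<partial>lborel)"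
    by (rule nn_integral_cmult) measurable
  also have "(\<integral>\<^sup>+ x. \<integral>\<^sup>+ y. (a y)\<^sup>2 * (b (x - y))\<^sup>2 \<partial>lborel \<partial>lborel) = (\<integral>\<^sup>+ y. \<integral>\<^sup>+ x. (a y)\<^sup>2 * (b (x - y))\<^sup>2 \<partial>lborel \<partial>lborel)"
    by (rule lborel_pair.Fubini') measurable
  also have "\<dots> = (\<integral>\<^sup>+ y. (a y)\<^sup>2 * (\<integral>\<^sup>+ x. (b x)\<^sup>2 \<partial>lborel) \<partial>lborel)"
    using nn_integral_shift[of "\<lambda>x. (b x)\<^sup>2"] by (simp add: nn_integral_cmult)
  also have "\<dots> = (\<integral>\<^sup>+ y. (a y)\<^sup>2 \<partial>lborel) * (\<integral>\<^sup>+ x. (b x)\<^sup>2 \<partial>lborel)"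
    by (rule nn_integral_multc) measurable
  finally show ?thesis by (simp only: mult.assoc)
qed

lemma trilinear_bound:
  fixes K :: "real \<Rightarrow> real \<Rightarrow> ennreal"
  assumes [measurable]: "(\<lambda>(x, y). K x y) \<in> borel_measurable (borel \<Otimes>\<^sub>M borel)"
    "a \<in> borel_measurable borel" "b \<in> borel_measurable borel" "c \<in> borel_measurable borel"
    and K: "\<And>x. (\<integral>\<^sup>+ y. (K x y)\<^sup>2 \<partial>lborel) \<le> B"
  shows "(\<integral>\<^sup>+ x. \<integral>\<^sup>+ y. K x y * (a x * (b y * c (x - y))) \<partial>lborel \<partial>lborel)\<^sup>2
    \<le> B * (\<integral>\<^sup>+ x. (a x)\<^sup>2 \<partial>lborel) * (\<integral>\<^sup>+ x. (b x)\<^sup>2 \<partial>lborel) * (\<integral>\<^sup>+ x. (c x)\<^sup>2 \<partial>lborel)"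
proof -
  have "(\<integral>\<^sup>+ x. \<integral>\<^sup>+ y. K x y * (a x * (b y * c (x - y))) \<partial>lborel \<partial>lborel)
    = (\<integral>\<^sup>+ x. a x * (\<integral>\<^sup>+ y. K x y * (b y * c (x - y)) \<partial>lborel) \<partial>lborel)"
    by (intro nn_integral_cong, subst nn_integral_cmult[symmetric]) (auto intro!: nn_integral_cong simp: mult_ac)
  also have "\<dots>\<^sup>2 \<le> (\<integral>\<^sup>+ x. (a x)\<^sup>2 \<partial>lborel) * (\<integral>\<^sup>+ x. (\<integral>\<^sup>+ y. K x y * (b y * c (x - y)) \<partial>lborel)\<^sup>2 \<partial>lborel)"
    by (rule Cauchy_Schwarz_nn_integral) measurable
  also have "\<dots> \<le> (\<integral>\<^sup>+ x. (a x)\<^sup>2 \<partial>lborel) * (B * (\<integral>\<^sup>+ x. (b x)\<^sup>2 \<partial>lborel) * (\<integral>\<^sup>+ x. (c x)\<^sup>2 \<partial>lborel))"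
    by (intro mult_left_mono kernel_bound K) auto
  finally show ?thesis by (simp only: mult_ac)
qed

text \<open>The counterpart for kernels that are square integrable in the first variable: exchanging
  the integrals makes a and b swap roles, and c is replaced by its reflection, which has the same
  norm.\<close>

lemma trilinear_bound':
  fixes K :: "real \<Rightarrow> real \<Rightarrow> ennreal"
  assumes [measurable]: "(\<lambda>(x, y). K x y) \<in> borel_measurable (borel \<Otimes>\<^sub>M borel)"
    "a \<in> borel_measurable borel" "b \<in> borel_measurable borel" "c \<in> borel_measurable borel"
    and K: "\<And>y. (\<integral>\<^sup>+ x. (K x y)\<^sup>2 \<partial>lborel) \<le> B"
  shows "(\<integral>\<^sup>+ x. \<integral>\<^sup>+ y. K x y * (a x * (b y * c (x - y))) \<partial>lborel \<partial>lborel)\<^sup>2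
    \<le> B * (\<integral>\<^sup>+ x. (a x)\<^sup>2 \<partial>lborel) * (\<integral>\<^sup>+ x. (b x)\<^sup>2 \<partial>lborel) * (\<integral>\<^sup>+ x. (c x)\<^sup>2 \<partial>lborel)"
proof -
  have "(\<integral>\<^sup>+ x. \<integral>\<^sup>+ y. K x y * (a x * (b y * c (x - y))) \<partial>lborel \<partial>lborel)
    = (\<integral>\<^sup>+ y. \<integral>\<^sup>+ x. K x y * (a x * (b y * c (x - y))) \<partial>lborel \<partial>lborel)"
    by (rule lborel_pair.Fubini') measurable
  also have "\<dots> = (\<integral>\<^sup>+ y. \<integral>\<^sup>+ x. (\<lambda>y x. K x y) y x * (b y * (a x * (\<lambda>z. c (- z)) (y - x))) \<partial>lborel \<partial>lborel)"
    by (simp add: mult_ac)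
  also have "\<dots>\<^sup>2 \<le> B * (\<integral>\<^sup>+ x. (b x)\<^sup>2 \<partial>lborel) * (\<integral>\<^sup>+ x. (a x)\<^sup>2 \<partial>lborel) * (\<integral>\<^sup>+ x. (c (- x))\<^sup>2 \<partial>lborel)"
    by (rule trilinear_bound[OF _ _ _ _ K]) measurable
  also have "(\<integral>\<^sup>+ x. (c (- x))\<^sup>2 \<partial>lborel) = (\<integral>\<^sup>+ x. (c x)\<^sup>2 \<partial>lborel)"
    using nn_integral_reflect[of "\<lambda>x. (c x)\<^sup>2" 0] by simp
  finally show ?thesis by (simp only: mult_ac)
qed

subsection \<open>The quadratic nonlinearity on the Fourier side\<close>

text \<open>Both the denominator of \<open>bbm_symbol\<close> and the square of the Sobolev weight.
  The equivalent weight (1 + |xi|)^\<alpha> would not do, since the cubic cancellation needs the two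
  to cancel exactly.\<close>

definition sob :: "real \<Rightarrow> real \<Rightarrow> real" where
  "sob \<alpha> \<xi> = 1 + \<bar>\<xi>\<bar> powr \<alpha>"

definition wt :: "real \<Rightarrow> real \<Rightarrow> real \<Rightarrow> real" where
  "wt \<alpha> \<sigma> \<xi> = sqrt (sob \<alpha> \<xi>) * cosh (\<sigma> * \<xi>)"

lemma sob_ge_1: "1 \<le> sob \<alpha> \<xi>" and sob_pos [simp]: "0 < sob \<alpha> \<xi>" and sob_nz [simp]: "sob \<alpha> \<xi> \<noteq> 0"
  by (auto simp: sob_def add_pos_nonneg add_nonneg_eq_0_iff)

lemma sob_measurable [measurable]: "sob \<alpha> \<in> borel_measurable borel"
  unfolding sob_def by measurable

lemma sob_minus [simp]: "sob \<alpha> (- \<xi>) = sob \<alpha> \<xi>" by (simp add: sob_def)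

lemma wt_ge_1: "1 \<le> wt \<alpha> \<sigma> \<xi>"
proof -
  have "1 * 1 \<le> sqrt (sob \<alpha> \<xi>) * cosh (\<sigma> * \<xi>)"
    by (intro mult_mono) (simp_all add: sob_ge_1 cosh_real_ge_1 less_imp_le[OF sob_pos])
  then show ?thesis by (simp add: wt_def)
qed

lemma wt_pos [simp]: "0 < wt \<alpha> \<sigma> \<xi>" and wt_nz [simp]: "wt \<alpha> \<sigma> \<xi> \<noteq> 0"
  using wt_ge_1[of \<alpha> \<sigma> \<xi>] by auto

lemma cosh_measurable [measurable]: "(cosh :: real \<Rightarrow> real) \<in> borel_measurable borel"
  by (intro borel_measurable_continuous_onI continuous_intros)

lemma wt_measurable [measurable]: "wt \<alpha> \<sigma> \<in> borel_measurable borel"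
  unfolding wt_def by measurable

lemma wt_minus [simp]: "wt \<alpha> \<sigma> (- \<xi>) = wt \<alpha> \<sigma> \<xi>" by (simp add: wt_def)

lemma bbm_symbol_measurable [measurable]: "bbm_symbol \<alpha> \<in> borel_measurable borel"
  unfolding bbm_symbol_def by measurable

lemma abs_le_sob: "1 \<le> \<alpha> \<Longrightarrow> \<bar>\<xi>\<bar> \<le> sob \<alpha> \<xi>"
proof (cases "\<bar>\<xi>\<bar> \<le> 1")
  case False
  assume "1 \<le> \<alpha>"
  then have "\<bar>\<xi>\<bar> powr 1 \<le> \<bar>\<xi>\<bar> powr \<alpha>" using False by (intro powr_mono) auto
  then show ?thesis using False by (simp add: sob_def)
qed (use sob_ge_1[of \<alpha> \<xi>] in linarith)

lemma bbm_symbol_eq: "bbm_symbol \<alpha> \<xi> = \<i> * of_real (\<xi> / sob \<alpha> \<xi>)"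
  by (simp add: bbm_symbol_def sob_def)

lemma cmod_bbm_symbol: "cmod (bbm_symbol \<alpha> \<xi>) = \<bar>\<xi>\<bar> / sob \<alpha> \<xi>"
  unfolding bbm_symbol_eq norm_mult norm_of_real using sob_ge_1[of \<alpha> \<xi>] by simp

lemma cmod_bbm_symbol_le: "1 \<le> \<alpha> \<Longrightarrow> cmod (bbm_symbol \<alpha> \<xi>) \<le> 1"
  using abs_le_sob[of \<alpha> \<xi>] sob_ge_1[of \<alpha> \<xi>] by (simp add: cmod_bbm_symbol divide_le_eq)

lemma nn_integral_even:
  fixes f :: "real \<Rightarrow> ennreal"
  assumes [measurable]: "f \<in> borel_measurable borel"
  shows "(\<integral>\<^sup>+ x. f \<bar>x\<bar> \<partial>lborel) \<le> 2 * (\<integral>\<^sup>+ x. f x * indicator {0..} x \<partial>lborel)"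
proof -
  have "(\<integral>\<^sup>+ x. f \<bar>x\<bar> \<partial>lborel) \<le> (\<integral>\<^sup>+ x. f x * indicator {0..} x + f (0 - x) * indicator {0..} (0 - x) \<partial>lborel)"
    by (intro nn_integral_mono) (auto simp: indicator_def abs_if)
  also have "\<dots> = (\<integral>\<^sup>+ x. f x * indicator {0..} x \<partial>lborel) + (\<integral>\<^sup>+ x. f (0 - x) * indicator {0..} (0 - x) \<partial>lborel)"
    by (rule nn_integral_add) measurable
  also have "(\<integral>\<^sup>+ x. f (0 - x) * indicator {0..} (0 - x) \<partial>lborel) = (\<integral>\<^sup>+ x. f x * indicator {0..} x \<partial>lborel)"
    by (rule nn_integral_reflect) measurable
  finally show ?thesis by (simp add: mult_2)
qed

lemma nn_integral_inverse_sob: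
  assumes "1 < \<alpha>"
  shows "(\<integral>\<^sup>+ x. ennreal (1 / sob \<alpha> x) \<partial>lborel) < \<infinity>"
proof -
  define f where "f x = 1 / (1 + x powr \<alpha>)" for x
  have [measurable]: "f \<in> borel_measurable borel" unfolding f_def by measurable
  have "(\<integral>\<^sup>+ x. ennreal (1 / sob \<alpha> x) \<partial>lborel) = (\<integral>\<^sup>+ x. ennreal (f \<bar>x\<bar>) \<partial>lborel)"
    by (simp add: f_def sob_def)
  also have "\<dots> \<le> 2 * (\<integral>\<^sup>+ x. ennreal (f x) * indicator {0..} x \<partial>lborel)"
    by (rule nn_integral_even) measurable
  finally have le: "(\<integral>\<^sup>+ x. ennreal (1 / sob \<alpha> x) \<partial>lborel) \<le> 2 * (\<integral>\<^sup>+ x. ennreal (f x) * indicator {0..} x \<partial>lborel)" .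
  have "(\<integral>\<^sup>+ x. ennreal (f x) * indicator {0..} x \<partial>lborel)
    \<le> (\<integral>\<^sup>+ x. indicator {0..1} x + ennreal (x powr (- \<alpha>)) * indicator {1..} x \<partial>lborel)"
  proof (rule nn_integral_mono)
    fix x :: real
    have pos: "0 < 1 + x powr \<alpha>" by (simp add: add_pos_nonneg)
    consider "x < 0" | "0 \<le> x" "x \<le> 1" | "1 < x" by linarith
    then show "ennreal (f x) * indicator {0..} x \<le> indicator {0..1} x + ennreal (x powr (- \<alpha>)) * indicator {1..} x"
    proof cases
      case 2
      have "ennreal (f x) \<le> ennreal 1"
        using pos by (intro ennreal_leI) (simp add: f_def divide_le_eq)
      also have "\<dots> \<le> 1 + ennreal (x powr (- \<alpha>)) * indicator {1..} x" by simp
      finally show ?thesis using 2 by simp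
    next
      case 3
      then have "f x \<le> x powr (- \<alpha>)"
        unfolding f_def powr_minus_divide by (intro divide_left_mono mult_pos_pos pos) auto
      then show ?thesis using 3 by (simp add: ennreal_leI)
    qed simp
  qed
  also have "\<dots> = (\<integral>\<^sup>+ x. indicator {0..1::real} x \<partial>lborel) + (\<integral>\<^sup>+ x. ennreal (x powr (- \<alpha>)) * indicator {1..} x \<partial>lborel)"
    by (rule nn_integral_add) measurable
  also have "(\<integral>\<^sup>+ x. indicator {0..1::real} x \<partial>lborel) = 1"
    by simp
  also have "(\<integral>\<^sup>+ x. ennreal (x powr (- \<alpha>)) * indicator {1..} x \<partial>lborel) = ennreal (- (1 powr (- \<alpha> + 1)) / (- \<alpha> + 1))"
    using has_integral_powr_to_inf[of "- \<alpha>" 1] assms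
    by (intro nn_integral_has_integral_lebesgue') auto
  finally have "(\<integral>\<^sup>+ x. ennreal (f x) * indicator {0..} x \<partial>lborel) < \<infinity>"
    by (rule le_less_trans) simp
  then have "2 * (\<integral>\<^sup>+ x. ennreal (f x) * indicator {0..} x \<partial>lborel) < \<infinity>"
    by (simp add: ennreal_mult_less_top)
  with le show ?thesis by (rule le_less_trans)
qed

lemma sob_nonneg [simp]: "0 \<le> sob \<alpha> \<xi>" and abs_wt [simp]: "\<bar>wt \<alpha> \<sigma> \<xi>\<bar> = wt \<alpha> \<sigma> \<xi>"
  by (simp_all add: less_imp_le)

lemma L2_reflect:
  assumes "f \<in> L2" shows "(\<lambda>x. f (c - x)) \<in> L2"
proof -
  have [measurable]: "f \<in> borel_measurable borel" using assms by (rule L2_measurable)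
  show ?thesis
    using assms nn_integral_reflect[of "\<lambda>x. ennreal ((cmod (f x))\<^sup>2)" c] by (simp add: L2_iff_nn_integral)
qed

lemma convolution_integrand: "v \<in> L2 \<Longrightarrow> w \<in> L2 \<Longrightarrow> integrable lborel (\<lambda>\<eta>. v \<eta> * w (\<xi> - \<eta>))"
  by (intro L2_mult_integrable L2_reflect)

lemma convolution_cong_AE:
  assumes "AE x in lborel. v x = v' x" "AE x in lborel. w x = w' x"
    and [measurable]: "v \<in> borel_measurable borel" "v' \<in> borel_measurable borel"
      "w \<in> borel_measurable borel" "w' \<in> borel_measurable borel"
  shows "convolution v w = convolution v' w'"
proof
  fix \<xi>
  have "AE x in lborel. w (\<xi> + -1 * x) = w' (\<xi> + -1 * x)"
    by (rule AE_borel_affine[OF _ _ assms(2)]) auto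
  with assms(1) have "AE x in lborel. v x * w (\<xi> - x) = v' x * w' (\<xi> - x)"
    by eventually_elim simp
  then show "convolution v w \<xi> = convolution v' w' \<xi>"
    unfolding convolution_def by (intro integral_cong_AE) measurable
qed

lemma convolution_add_left: "v \<in> L2 \<Longrightarrow> v' \<in> L2 \<Longrightarrow> w \<in> L2 \<Longrightarrow>
    convolution (\<lambda>x. v x + v' x) w \<xi> = convolution v w \<xi> + convolution v' w \<xi>"
  unfolding convolution_def by (simp add: distrib_right convolution_integrand)

lemma convolution_add_right: "v \<in> L2 \<Longrightarrow> w \<in> L2 \<Longrightarrow> w' \<in> L2 \<Longrightarrow>
    convolution v (\<lambda>x. w x + w' x) \<xi> = convolution v w \<xi> + convolution v w' \<xi>"
  unfolding convolution_def by (simp add: distrib_left convolution_integrand)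

text \<open>For a weighted unknown V this is the Fourier transform of u. The same u has different V
  for different sigma but, up to null sets, the same \<open>unweight\<close>.\<close>

definition unweight :: "real \<Rightarrow> real \<Rightarrow> ltwo \<Rightarrow> real \<Rightarrow> complex" where
  "unweight \<alpha> \<sigma> V \<xi> = fn V \<xi> / of_real (wt \<alpha> \<sigma> \<xi>)"

text \<open>The weighted transform of 2 pi times \<open>\<phi>(D)\<close> of a product, where the
  two factors have the unweighted arguments as transforms. The 2 pi is that of the convolution
  theorem.\<close>

definition bil_fun :: "real \<Rightarrow> real \<Rightarrow> ltwo \<Rightarrow> ltwo \<Rightarrow> real \<Rightarrow> complex" where
  "bil_fun \<alpha> \<sigma> V W \<xi> = bbm_symbol \<alpha> \<xi> * of_real (wt \<alpha> \<sigma> \<xi>) * convolution (unweight \<alpha> \<sigma> V) (unweight \<alpha> \<sigma> W) \<xi>"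

definition bil :: "real \<Rightarrow> real \<Rightarrow> ltwo \<Rightarrow> ltwo \<Rightarrow> ltwo" where
  "bil \<alpha> \<sigma> V W = lt (bil_fun \<alpha> \<sigma> V W)"

lemma unweight_measurable [measurable]: "unweight \<alpha> \<sigma> V \<in> borel_measurable borel"
  unfolding unweight_def by measurable

lemma unweight_L2: "unweight \<alpha> \<sigma> V \<in> L2"
proof (rule L2_bound(1)[of _ "fn V" 1])
  have "cmod (fn V x) / wt \<alpha> \<sigma> x \<le> cmod (fn V x) / 1" for x
    using wt_ge_1 by (intro divide_left_mono) auto
  then show "AE x in lborel. cmod (unweight \<alpha> \<sigma> V x) \<le> 1 * cmod (fn V x)"
    by (simp add: unweight_def norm_divide)
qed auto

lemma inverse_sob_integrable: "1 < \<alpha> \<Longrightarrow> integrable lborel (\<lambda>x. 1 / sob \<alpha> x)"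
  using nn_integral_inverse_sob[of \<alpha>] by (simp add: integrable_iff_bounded less_imp_le)

text \<open>For \<alpha> > 1 the reciprocal weight lies in \<open>L2\<close>, so Cauchy-Schwarz
  applies. This is the Fourier side of the embedding of H^(\<alpha>/2) into bounded functions, and
  it is what \<open>is_fourier_square\<close> requires.\<close>

lemma unweight_integrable:
  assumes "1 < \<alpha>" shows "integrable lborel (unweight \<alpha> \<sigma> V)"
proof -
  have "(\<lambda>x. complex_of_real (1 / wt \<alpha> \<sigma> x)) \<in> L2"
  proof -
    have "integrable lborel (\<lambda>x. (1 / wt \<alpha> \<sigma> x)\<^sup>2)"
    proof (rule Bochner_Integration.integrable_bound[OF inverse_sob_integrable[OF assms]])
      show "AE x in lborel. norm ((1 / wt \<alpha> \<sigma> x)\<^sup>2) \<le> norm (1 / sob \<alpha> x)"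
      proof (rule AE_I2)
        fix x
        have "1 * sob \<alpha> x \<le> (cosh (\<sigma> * x))\<^sup>2 * sob \<alpha> x"
          by (intro mult_right_mono) (simp_all add: cosh_real_ge_1 less_imp_le)
        then have "sob \<alpha> x \<le> (wt \<alpha> \<sigma> x)\<^sup>2"
          by (simp add: wt_def power_mult_distrib less_imp_le mult.commute)
        then have "1 / (wt \<alpha> \<sigma> x)\<^sup>2 \<le> 1 / sob \<alpha> x" by (intro divide_left_mono) auto
        then show "norm ((1 / wt \<alpha> \<sigma> x)\<^sup>2) \<le> norm (1 / sob \<alpha> x)"
          by (simp add: power_divide less_imp_le)
      qed
    qed measurable
    then show ?thesis by (simp add: L2_def norm_divide)
  qed
  from L2_mult_integrable[OF this fn_L2[of V]] show ?thesis
    by (simp add: unweight_def[abs_def])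
qed

lemma sob_add_le:
  assumes "0 \<le> \<alpha>"
  shows "sob \<alpha> \<xi> \<le> 2 powr \<alpha> * (sob \<alpha> \<eta> + sob \<alpha> (\<xi> - \<eta>))"
proof -
  have "\<bar>\<xi>\<bar> \<le> 2 * max \<bar>\<eta>\<bar> \<bar>\<xi> - \<eta>\<bar>" by (simp add: max_def abs_if)
  then have "\<bar>\<xi>\<bar> powr \<alpha> \<le> (2 * max \<bar>\<eta>\<bar> \<bar>\<xi> - \<eta>\<bar>) powr \<alpha>"
    using assms by (intro powr_mono2) auto
  also have "\<dots> = 2 powr \<alpha> * (max \<bar>\<eta>\<bar> \<bar>\<xi> - \<eta>\<bar>) powr \<alpha>" by (simp add: powr_mult)
  also have "\<dots> \<le> 2 powr \<alpha> * (\<bar>\<eta>\<bar> powr \<alpha> + \<bar>\<xi> - \<eta>\<bar> powr \<alpha>)"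
    by (intro mult_left_mono) (auto simp: max_def)
  finally have "\<bar>\<xi>\<bar> powr \<alpha> \<le> 2 powr \<alpha> * (\<bar>\<eta>\<bar> powr \<alpha> + \<bar>\<xi> - \<eta>\<bar> powr \<alpha>)" .
  moreover have "1 \<le> 2 powr \<alpha>" using assms by (simp add: ge_one_powr_ge_zero)
  ultimately show ?thesis by (simp add: sob_def algebra_simps)
qed

definition sob_kernel :: "real \<Rightarrow> real \<Rightarrow> real \<Rightarrow> real" where
  "sob_kernel \<alpha> \<xi> \<eta> = \<bar>\<xi>\<bar> / (sqrt (sob \<alpha> \<xi>) * sqrt (sob \<alpha> \<eta>) * sqrt (sob \<alpha> (\<xi> - \<eta>)))"

lemma sob_kernel_nonneg [simp]: "0 \<le> sob_kernel \<alpha> \<xi> \<eta>"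
  by (simp add: sob_kernel_def less_imp_le)

lemma sob_kernel_measurable [measurable]: "(\<lambda>(\<xi>, \<eta>). sob_kernel \<alpha> \<xi> \<eta>) \<in> borel_measurable (borel \<Otimes>\<^sub>M borel)"
  unfolding sob_kernel_def by measurable

text \<open>The square of xi is absorbed by the square of \<open>sob \<alpha> \<xi>\<close>; one of
  the two factors cancels, and \<open>sob_add_le\<close> distributes the other over the frequencies
  eta and xi - eta. Each resulting term depends on one frequency only and is integrable in
  eta.\<close>

lemma sob_kernel_power2_le:
  assumes "1 \<le> \<alpha>"
  shows "(sob_kernel \<alpha> \<xi> \<eta>)\<^sup>2 \<le> 2 powr \<alpha> * (1 / sob \<alpha> \<eta> + 1 / sob \<alpha> (\<xi> - \<eta>))"
proof -
  define a b c where "a = sob \<alpha> \<xi>" and "b = sob \<alpha> \<eta>" and "c = sob \<alpha> (\<xi> - \<eta>)"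
  have pos: "a > 0" "b > 0" "c > 0" by (simp_all add: a_def b_def c_def)
  have "\<bar>\<xi>\<bar>\<^sup>2 \<le> a\<^sup>2" unfolding a_def using abs_le_sob[OF assms] by (intro power_mono) auto
  then have xi: "\<xi>\<^sup>2 \<le> a * a" by (simp add: power2_eq_square)
  have ab: "a \<le> 2 powr \<alpha> * (b + c)" unfolding a_def b_def c_def using assms by (intro sob_add_le) auto
  have "(sob_kernel \<alpha> \<xi> \<eta>)\<^sup>2 = \<xi>\<^sup>2 / (a * b * c)"
    using pos by (simp add: sob_kernel_def a_def b_def c_def power_divide power_mult_distrib)
  also have "\<dots> \<le> (a * a) / (a * b * c)" using xi pos by (intro divide_right_mono) auto
  also have "\<dots> = a / (b * c)" using pos by simp
  also have "\<dots> \<le> 2 powr \<alpha> * (b + c) / (b * c)" using ab pos by (intro divide_right_mono) auto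
  also have "\<dots> = 2 powr \<alpha> * (1 / b + 1 / c)" using pos by (simp add: field_simps)
  finally show ?thesis by (simp add: b_def c_def)
qed

lemma sob_kernel_bound:
  assumes "1 < \<alpha>"
  obtains B where "B \<ge> 0" "\<And>\<xi>. (\<integral>\<^sup>+ \<eta>. (ennreal (sob_kernel \<alpha> \<xi> \<eta>))\<^sup>2 \<partial>lborel) \<le> ennreal B"
proof -
  define I where "I = (LINT x|lborel. 1 / sob \<alpha> x)"
  have I: "(\<integral>\<^sup>+ x. ennreal (1 / sob \<alpha> x) \<partial>lborel) = ennreal I" "0 \<le> I"
    unfolding I_def using inverse_sob_integrable[OF assms]
    by (auto intro!: nn_integral_eq_integral Bochner_Integration.integral_nonneg simp: less_imp_le)
  have "(\<integral>\<^sup>+ \<eta>. (ennreal (sob_kernel \<alpha> \<xi> \<eta>))\<^sup>2 \<partial>lborel) \<le> ennreal (2 powr \<alpha> * (I + I))" for \<xi>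
  proof -
    have "(\<integral>\<^sup>+ \<eta>. (ennreal (sob_kernel \<alpha> \<xi> \<eta>))\<^sup>2 \<partial>lborel)
      \<le> (\<integral>\<^sup>+ \<eta>. ennreal (2 powr \<alpha>) * (ennreal (1 / sob \<alpha> \<eta>) + ennreal (1 / sob \<alpha> (\<xi> - \<eta>))) \<partial>lborel)"
      using sob_kernel_power2_le[of \<alpha> \<xi>] assms
      by (intro nn_integral_mono) (simp add: ennreal_power less_imp_le ennreal_leI flip: ennreal_plus ennreal_mult)
    also have "\<dots> = ennreal (2 powr \<alpha>) * ((\<integral>\<^sup>+ \<eta>. ennreal (1 / sob \<alpha> \<eta>) \<partial>lborel) + (\<integral>\<^sup>+ \<eta>. ennreal (1 / sob \<alpha> (\<xi> - \<eta>)) \<partial>lborel))"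
      by (subst nn_integral_cmult, measurable) (subst nn_integral_add, auto)
    also have "(\<integral>\<^sup>+ \<eta>. ennreal (1 / sob \<alpha> (\<xi> - \<eta>)) \<partial>lborel) = (\<integral>\<^sup>+ \<eta>. ennreal (1 / sob \<alpha> \<eta>) \<partial>lborel)"
      by (rule nn_integral_reflect) measurable
    finally show ?thesis unfolding I(1) using I(2) by (simp flip: ennreal_plus ennreal_mult)
  qed
  then show thesis using I(2) by (intro that[of "2 powr \<alpha> * (I + I)"]) auto
qed

lemma cosh_add_le: "cosh (a + b) \<le> 2 * (cosh a * cosh (b :: real))"
proof -
  have "sinh a * sinh b \<le> \<bar>sinh a\<bar> * \<bar>sinh b\<bar>" by (simp flip: abs_mult)
  also have "\<dots> \<le> cosh a * cosh b"
    using cosh_square_eq[of a] cosh_square_eq[of b] cosh_real_pos[of a] cosh_real_pos[of b]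
    by (intro mult_mono) (auto intro!: power2_le_imp_le[of "\<bar>sinh a\<bar>"] power2_le_imp_le[of "\<bar>sinh b\<bar>"])
  finally show ?thesis by (simp add: cosh_add)
qed

lemma bil_fun_measurable [measurable]: "bil_fun \<alpha> \<sigma> V W \<in> borel_measurable borel"
  unfolding bil_fun_def by measurable

text \<open>By \<open>cosh_add_le\<close> the exponential weight of a sum of frequencies is at most
  twice the product of the weights. The dependence on sigma thereby disappears, and only
  \<open>sob_kernel\<close> and a factor 2 are left.\<close>

lemma bil_fun_pointwise:
  assumes "1 < \<alpha>"
  shows "ennreal (cmod (bil_fun \<alpha> \<sigma> V W \<xi>))
    \<le> (\<integral>\<^sup>+ \<eta>. ennreal (sob_kernel \<alpha> \<xi> \<eta>) * (ennreal (2 * cmod (fn V \<eta>)) * ennreal (cmod (fn W (\<xi> - \<eta>)))) \<partial>lborel)"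
proof -
  define M where "M = cmod (bbm_symbol \<alpha> \<xi>) * wt \<alpha> \<sigma> \<xi>"
  have M: "M = \<bar>\<xi>\<bar> / sqrt (sob \<alpha> \<xi>) * cosh (\<sigma> * \<xi>)" "0 \<le> M"
  proof -
    have "sqrt (sob \<alpha> \<xi>) * sqrt (sob \<alpha> \<xi>) = sob \<alpha> \<xi>" by (simp add: less_imp_le)
    then show "M = \<bar>\<xi>\<bar> / sqrt (sob \<alpha> \<xi>) * cosh (\<sigma> * \<xi>)"
      unfolding M_def cmod_bbm_symbol wt_def by (simp add: field_simps)
    show "0 \<le> M" by (simp add: M_def less_imp_le)
  qed
  have "ennreal (cmod (bil_fun \<alpha> \<sigma> V W \<xi>)) = ennreal M * ennreal (cmod (convolution (unweight \<alpha> \<sigma> V) (unweight \<alpha> \<sigma> W) \<xi>))"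
    using M(2) by (simp add: bil_fun_def norm_mult M_def abs_of_pos flip: ennreal_mult)
  also have "\<dots> \<le> ennreal M * (\<integral>\<^sup>+ \<eta>. ennreal (cmod (unweight \<alpha> \<sigma> V \<eta> * unweight \<alpha> \<sigma> W (\<xi> - \<eta>))) \<partial>lborel)"
    unfolding convolution_def
    by (intro mult_left_mono integral_norm_bound_ennreal convolution_integrand unweight_L2) simp
  also have "\<dots> = (\<integral>\<^sup>+ \<eta>. ennreal M * ennreal (cmod (unweight \<alpha> \<sigma> V \<eta> * unweight \<alpha> \<sigma> W (\<xi> - \<eta>))) \<partial>lborel)"
    by (rule nn_integral_cmult[symmetric]) measurable
  also have "\<dots> \<le> (\<integral>\<^sup>+ \<eta>. ennreal (sob_kernel \<alpha> \<xi> \<eta>) * (ennreal (2 * cmod (fn V \<eta>)) * ennreal (cmod (fn W (\<xi> - \<eta>)))) \<partial>lborel)"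
  proof (rule nn_integral_mono)
    fix \<eta>
    define p where "p = cmod (fn V \<eta>) * cmod (fn W (\<xi> - \<eta>))"
    define q where "q = wt \<alpha> \<sigma> \<eta> * wt \<alpha> \<sigma> (\<xi> - \<eta>)"
    have pq: "0 \<le> p" "0 < q" by (simp_all add: p_def q_def)
    have "cosh (\<sigma> * \<xi>) \<le> 2 * (cosh (\<sigma> * \<eta>) * cosh (\<sigma> * (\<xi> - \<eta>)))"
      using cosh_add_le[of "\<sigma> * \<eta>" "\<sigma> * (\<xi> - \<eta>)"] by (simp add: algebra_simps)
    then have "M \<le> \<bar>\<xi>\<bar> / sqrt (sob \<alpha> \<xi>) * (2 * (cosh (\<sigma> * \<eta>) * cosh (\<sigma> * (\<xi> - \<eta>))))"
      unfolding M(1) by (intro mult_left_mono) (simp_all add: less_imp_le)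
    also have "\<dots> = 2 * sob_kernel \<alpha> \<xi> \<eta> * q"
      by (simp add: sob_kernel_def q_def wt_def field_simps)
    finally have "M * (p / q) \<le> 2 * sob_kernel \<alpha> \<xi> \<eta> * q * (p / q)"
      using pq by (intro mult_right_mono) auto
    also have "\<dots> = sob_kernel \<alpha> \<xi> \<eta> * (2 * p)" using pq by simp
    finally have "M * (p / q) \<le> sob_kernel \<alpha> \<xi> \<eta> * (2 * p)" .
    moreover have "cmod (unweight \<alpha> \<sigma> V \<eta> * unweight \<alpha> \<sigma> W (\<xi> - \<eta>)) = p / q"
      by (simp add: unweight_def norm_mult norm_divide p_def q_def)
    ultimately show "ennreal M * ennreal (cmod (unweight \<alpha> \<sigma> V \<eta> * unweight \<alpha> \<sigma> W (\<xi> - \<eta>)))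
      \<le> ennreal (sob_kernel \<alpha> \<xi> \<eta>) * (ennreal (2 * cmod (fn V \<eta>)) * ennreal (cmod (fn W (\<xi> - \<eta>))))"
      using M(2) pq by (simp add: p_def ennreal_leI mult.assoc flip: ennreal_mult)
  qed
  finally show ?thesis .
qed

lemma nn_integral_fn: "(\<integral>\<^sup>+ x. (ennreal (cmod (fn V x)))\<^sup>2 \<partial>lborel) = (ennreal (norm V))\<^sup>2"
  using nn_integral_L2_norm[OF fn_L2, of V] by (simp add: ennreal_power norm_ltwo)

lemma bil_bound:
  assumes "1 < \<alpha>"
  obtains B where "B \<ge> 0" "\<And>\<sigma> V W. bil_fun \<alpha> \<sigma> V W \<in> L2" "\<And>\<sigma> V W. norm (bil \<alpha> \<sigma> V W) \<le> B * norm V * norm W"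
proof -
  obtain B where B: "B \<ge> 0" "\<And>\<xi>. (\<integral>\<^sup>+ \<eta>. (ennreal (sob_kernel \<alpha> \<xi> \<eta>))\<^sup>2 \<partial>lborel) \<le> ennreal B"
    using sob_kernel_bound[OF assms] by metis
  have le: "(\<integral>\<^sup>+ \<xi>. ennreal ((cmod (bil_fun \<alpha> \<sigma> V W \<xi>))\<^sup>2) \<partial>lborel) \<le> ennreal ((2 * sqrt B * norm V * norm W)\<^sup>2)" for \<sigma> V W
  proof -
    have "(\<integral>\<^sup>+ \<xi>. ennreal ((cmod (bil_fun \<alpha> \<sigma> V W \<xi>))\<^sup>2) \<partial>lborel)
      \<le> (\<integral>\<^sup>+ \<xi>. (\<integral>\<^sup>+ \<eta>. ennreal (sob_kernel \<alpha> \<xi> \<eta>) * (ennreal (2 * cmod (fn V \<eta>)) * ennreal (cmod (fn W (\<xi> - \<eta>)))) \<partial>lborel)\<^sup>2 \<partial>lborel)"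
      using bil_fun_pointwise[OF assms]
      by (intro nn_integral_mono) (simp add: power_mono flip: ennreal_power)
    also have "\<dots> \<le> ennreal B * (\<integral>\<^sup>+ x. (ennreal (2 * cmod (fn V x)))\<^sup>2 \<partial>lborel) * (\<integral>\<^sup>+ x. (ennreal (cmod (fn W x)))\<^sup>2 \<partial>lborel)"
      by (rule kernel_bound) (measurable, rule B(2))
    also have "(\<integral>\<^sup>+ x. (ennreal (2 * cmod (fn V x)))\<^sup>2 \<partial>lborel) = 4 * (ennreal (norm V))\<^sup>2"
      unfolding nn_integral_fn[symmetric]
      by (subst nn_integral_cmult[symmetric]) (auto intro!: nn_integral_cong simp: ennreal_mult power_mult_distrib)
    also have "ennreal B * (4 * (ennreal (norm V))\<^sup>2) * (\<integral>\<^sup>+ x. (ennreal (cmod (fn W x)))\<^sup>2 \<partial>lborel)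
        = ennreal ((2 * sqrt B * norm V * norm W)\<^sup>2)"
      unfolding nn_integral_fn using B(1) by (simp add: ennreal_power power_mult_distrib ennreal_mult mult_ac)
    finally show ?thesis .
  qed
  have L2: "bil_fun \<alpha> \<sigma> V W \<in> L2" for \<sigma> V W
    using L2_norm_le(1)[OF bil_fun_measurable _ le] B(1) by simp
  show thesis
  proof (rule that[of "2 * sqrt B"])
    show "norm (bil \<alpha> \<sigma> V W) \<le> 2 * sqrt B * norm V * norm W" for \<sigma> V W
      unfolding bil_def norm_lt[OF L2] by (rule L2_norm_le(2)[OF bil_fun_measurable _ le]) (use B(1) in simp)
  qed (use B(1) L2 in auto)
qed

lemma bil_fun_L2: "1 < \<alpha> \<Longrightarrow> bil_fun \<alpha> \<sigma> V W \<in> L2"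
  using bil_bound[of \<alpha>] by metis

lemma fn_bil: "1 < \<alpha> \<Longrightarrow> AE x in lborel. fn (bil \<alpha> \<sigma> V W) x = bil_fun \<alpha> \<sigma> V W x"
  unfolding bil_def by (rule fn_lt[OF bil_fun_L2])

lemma unweight_add: "AE x in lborel. unweight \<alpha> \<sigma> (V + W) x = unweight \<alpha> \<sigma> V x + unweight \<alpha> \<sigma> W x"
  using fn_add[of V W] by eventually_elim (simp add: unweight_def add_divide_distrib)

lemma bil_fun_add_left: "bil_fun \<alpha> \<sigma> (U + V) W \<xi> = bil_fun \<alpha> \<sigma> U W \<xi> + bil_fun \<alpha> \<sigma> V W \<xi>"
proof -
  have "convolution (unweight \<alpha> \<sigma> (U + V)) (unweight \<alpha> \<sigma> W) = convolution (\<lambda>x. unweight \<alpha> \<sigma> U x + unweight \<alpha> \<sigma> V x) (unweight \<alpha> \<sigma> W)"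
    by (rule convolution_cong_AE[OF unweight_add]) auto
  then show ?thesis
    by (simp add: bil_fun_def convolution_add_left unweight_L2 distrib_left)
qed

lemma bil_fun_add_right: "bil_fun \<alpha> \<sigma> U (V + W) \<xi> = bil_fun \<alpha> \<sigma> U V \<xi> + bil_fun \<alpha> \<sigma> U W \<xi>"
proof -
  have "convolution (unweight \<alpha> \<sigma> U) (unweight \<alpha> \<sigma> (V + W)) = convolution (unweight \<alpha> \<sigma> U) (\<lambda>x. unweight \<alpha> \<sigma> V x + unweight \<alpha> \<sigma> W x)"
    by (rule convolution_cong_AE[OF _ unweight_add]) auto
  then show ?thesis
    by (simp add: bil_fun_def convolution_add_right unweight_L2 distrib_left)
qed

lemma bil_diff:
  assumes "1 < \<alpha>"
  shows "bil \<alpha> \<sigma> V V - bil \<alpha> \<sigma> W W = bil \<alpha> \<sigma> (V - W) V + bil \<alpha> \<sigma> W (V - W)"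
proof -
  have "bil_fun \<alpha> \<sigma> V V x - bil_fun \<alpha> \<sigma> W W x = bil_fun \<alpha> \<sigma> (V - W) V x + bil_fun \<alpha> \<sigma> W (V - W) x" for x
    using bil_fun_add_left[of \<alpha> \<sigma> "V - W" W V x] bil_fun_add_right[of \<alpha> \<sigma> W "V - W" W x] by simp
  then show ?thesis
    using bil_fun_L2[OF assms] by (simp add: bil_def flip: lt_add lt_diff)
qed

text \<open>The factor \<open>1 / (4 \<pi>)\<close> is \<open>1 / 2\<close> times the factor \<open>1 / (2 \<pi>)\<close> of the convolution theorem.\<close>

definition bbm_field :: "real \<Rightarrow> real \<Rightarrow> ltwo \<Rightarrow> ltwo" where
  "bbm_field \<alpha> \<sigma> V = - mult_op (bbm_symbol \<alpha>) V - (1 / (4 * pi)) *\<^sub>R bil \<alpha> \<sigma> V V"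

text \<open>The linear part contributes 1 because its symbol is bounded by 1. The quadratic part is
  handled by \<open>bil_diff\<close>, each of its two terms being linear in V - W and bounded by r
  in the other argument.\<close>

lemma bbm_field_lipschitz:
  assumes "1 < \<alpha>"
  obtains B where "B \<ge> 0" "\<And>\<sigma> r (V :: ltwo) W. norm V \<le> r \<Longrightarrow> norm W \<le> r \<Longrightarrow>
    norm (bbm_field \<alpha> \<sigma> V - bbm_field \<alpha> \<sigma> W) \<le> (1 + B * r) * norm (V - W)"
proof -
  obtain B where B: "B \<ge> 0" "\<And>\<sigma> V W. norm (bil \<alpha> \<sigma> V W) \<le> B * norm V * norm W"
    using bil_bound[OF assms] by metis
  have M: "bounded_linear (mult_op (bbm_symbol \<alpha>))"
    by (rule bounded_linear_mult_op[of _ 1]) (use assms cmod_bbm_symbol_le in auto)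
  show thesis
  proof (rule that[of "2 * B / (4 * pi)"])
    fix \<sigma> r and V W :: ltwo assume r: "norm V \<le> r" "norm W \<le> r"
    have "bbm_field \<alpha> \<sigma> V - bbm_field \<alpha> \<sigma> W
      = - mult_op (bbm_symbol \<alpha>) (V - W) - (1 / (4 * pi)) *\<^sub>R (bil \<alpha> \<sigma> V V - bil \<alpha> \<sigma> W W)"
      by (simp add: bbm_field_def linear_diff[OF bounded_linear.linear[OF M]] algebra_simps)
    also have "norm \<dots> \<le> norm (mult_op (bbm_symbol \<alpha>) (V - W)) + norm ((1 / (4 * pi)) *\<^sub>R (bil \<alpha> \<sigma> V V - bil \<alpha> \<sigma> W W))"
      using norm_triangle_ineq4[of "- mult_op (bbm_symbol \<alpha>) (V - W)" "(1 / (4 * pi)) *\<^sub>R (bil \<alpha> \<sigma> V V - bil \<alpha> \<sigma> W W)"]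
      by (simp only: norm_minus_cancel)
    also have "\<dots> \<le> 1 * norm (V - W) + (1 / (4 * pi)) * (2 * B * r * norm (V - W))"
    proof (rule add_mono)
      show "norm (mult_op (bbm_symbol \<alpha>) (V - W)) \<le> 1 * norm (V - W)"
        by (rule norm_mult_op_le) (use assms cmod_bbm_symbol_le in auto)
      have "norm (bil \<alpha> \<sigma> V V - bil \<alpha> \<sigma> W W) \<le> norm (bil \<alpha> \<sigma> (V - W) V) + norm (bil \<alpha> \<sigma> W (V - W))"
        unfolding bil_diff[OF assms] by (rule norm_triangle_ineq)
      also have "\<dots> \<le> B * norm (V - W) * norm V + B * norm W * norm (V - W)"
        by (intro add_mono B(2))
      also have "\<dots> \<le> B * norm (V - W) * r + B * r * norm (V - W)"
        using r B(1) by (intro add_mono mult_left_mono mult_right_mono) auto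
      finally have "norm (bil \<alpha> \<sigma> V V - bil \<alpha> \<sigma> W W) \<le> 2 * B * r * norm (V - W)" by (simp add: mult_ac)
      then have "(1 / (4 * pi)) * norm (bil \<alpha> \<sigma> V V - bil \<alpha> \<sigma> W W) \<le> (1 / (4 * pi)) * (2 * B * r * norm (V - W))"
        by (rule mult_left_mono) simp
      then show "norm ((1 / (4 * pi)) *\<^sub>R (bil \<alpha> \<sigma> V V - bil \<alpha> \<sigma> W W)) \<le> (1 / (4 * pi)) * (2 * B * r * norm (V - W))"
        by simp
    qed
    finally show "norm (bbm_field \<alpha> \<sigma> V - bbm_field \<alpha> \<sigma> W) \<le> (1 + 2 * B / (4 * pi) * r) * norm (V - W)"
      by (simp add: algebra_simps)
  qed (use B(1) in auto)
qed

subsection \<open>The energy inequality\<close>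

text \<open>The indicator makes y the smaller frequency. The two larger frequencies are comparable,
  so both of their powers are carried by x.\<close>

definition power_kernel :: "real \<Rightarrow> real \<Rightarrow> real \<Rightarrow> real \<Rightarrow> real" where
  "power_kernel e f x y = indicator {-\<bar>x\<bar>..\<bar>x\<bar>} y * (\<bar>x\<bar> powr e * \<bar>y\<bar> powr f)"

lemma power_kernel_nonneg [simp]: "0 \<le> power_kernel e f x y"
  by (simp add: power_kernel_def)

lemma power_kernel_alt: "power_kernel e f x y = (if \<bar>y\<bar> \<le> \<bar>x\<bar> then \<bar>x\<bar> powr e * \<bar>y\<bar> powr f else 0)"
  by (auto simp: power_kernel_def indicator_def abs_le_iff)

lemma power_kernel_measurable [measurable]:
  "(\<lambda>(x, y). power_kernel e f x y) \<in> borel_measurable (borel \<Otimes>\<^sub>M borel)"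
  "(\<lambda>(x, y). power_kernel e f y x) \<in> borel_measurable (borel \<Otimes>\<^sub>M borel)"
  "(\<lambda>(x, y). power_kernel e f x (x - y)) \<in> borel_measurable (borel \<Otimes>\<^sub>M borel)"
  unfolding power_kernel_alt by measurable

lemma power_kernel_measurable' [measurable]: "power_kernel e f x \<in> borel_measurable borel"
  unfolding power_kernel_def by measurable

text \<open>Integration over |y| <= |x| yields |x| to the power 2e + 2f + 1, which is 0 by
  homogeneity. The condition on f is convergence at y = 0.\<close>

lemma power_kernel_bound:
  assumes f: "2 * f > -1" and ef: "2 * e + 2 * f = -1"
  shows "(\<integral>\<^sup>+ y. (ennreal (power_kernel e f x y))\<^sup>2 \<partial>lborel) \<le> ennreal (2 / (2 * f + 1))"
proof (cases "x = 0")
  case True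
  then show ?thesis by (simp add: power_kernel_def)
next
  case False
  define X where "X = \<bar>x\<bar>"
  have X: "X > 0" using False by (simp add: X_def)
  have "(\<integral>\<^sup>+ y. (ennreal (power_kernel e f x y))\<^sup>2 \<partial>lborel)
    = (\<integral>\<^sup>+ y. ennreal (X powr (2 * e)) * (ennreal (\<bar>y\<bar> powr (2 * f)) * indicator {..X} \<bar>y\<bar>) \<partial>lborel)"
  proof (rule nn_integral_cong)
    fix y
    have sq: "(\<bar>z\<bar> powr g)\<^sup>2 = \<bar>z\<bar> powr (2 * g)" for z g :: real
      by (simp add: power2_eq_square flip: powr_add)
    show "(ennreal (power_kernel e f x y))\<^sup>2 = ennreal (X powr (2 * e)) * (ennreal (\<bar>y\<bar> powr (2 * f)) * indicator {..X} \<bar>y\<bar>)"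
      by (simp add: power_kernel_alt X_def ennreal_power power_mult_distrib sq flip: ennreal_mult)
  qed
  also have "\<dots> = ennreal (X powr (2 * e)) * (\<integral>\<^sup>+ y. ennreal (\<bar>y\<bar> powr (2 * f)) * indicator {..X} \<bar>y\<bar> \<partial>lborel)"
    by (rule nn_integral_cmult) measurable
  also have "\<dots> \<le> ennreal (X powr (2 * e)) * (2 * (\<integral>\<^sup>+ y. ennreal (y powr (2 * f)) * indicator {..X} y * indicator {0..} y \<partial>lborel))"
    by (intro mult_left_mono nn_integral_even[of "\<lambda>y. ennreal (y powr (2 * f)) * indicator {..X} y"]) auto
  also have "(\<integral>\<^sup>+ y. ennreal (y powr (2 * f)) * indicator {..X} y * indicator {0..} y \<partial>lborel)
      = (\<integral>\<^sup>+ y. ennreal (y powr (2 * f)) * indicator {0..X} y \<partial>lborel)"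
    by (intro nn_integral_cong) (auto simp: indicator_def)
  also have "\<dots> = ennreal (X powr (2 * f + 1) / (2 * f + 1))"
    using has_integral_powr_from_0[of "2 * f" X] f X
    by (intro nn_integral_has_integral_lebesgue') auto
  also have "ennreal (X powr (2 * e)) * (2 * ennreal (X powr (2 * f + 1) / (2 * f + 1)))
      = ennreal (X powr (2 * e) * (2 * (X powr (2 * f + 1) / (2 * f + 1))))"
  proof -
    have "ennreal a * (2 * ennreal b) = ennreal (a * (2 * b))" if "0 \<le> a" "0 \<le> b" for a b
      using that by (simp add: ennreal_mult)
    then show ?thesis using f by simp
  qed
  also have "X powr (2 * e) * (2 * (X powr (2 * f + 1) / (2 * f + 1))) = (X powr (2 * e) * X powr (2 * f + 1)) * (2 / (2 * f + 1))"
    by simp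
  also have "X powr (2 * e) * X powr (2 * f + 1) = X powr (2 * e + 2 * f + 1)"
    by (simp add: powr_add)
  also have "\<dots> = 1" using ef X by simp
  finally show ?thesis by simp
qed

text \<open>Each of xi, eta and xi - eta is a sum or difference of the other two, so the two of
  largest modulus agree up to a factor 2. The three kernels correspond to the choice of the smallest
  one, and 2^(-q) is the price for replacing one large frequency by the other in a nonpositive
  power.\<close>

lemma homogeneous_kernel_le:
  fixes \<xi> \<eta> p q :: real
  assumes q: "q \<le> 0"
  shows "\<bar>\<xi>\<bar> powr p * (\<bar>\<eta>\<bar> powr q * \<bar>\<xi> - \<eta>\<bar> powr q)
    \<le> 2 powr (- q) * (power_kernel (p + q) q \<xi> \<eta> + power_kernel (p + q) q \<xi> (\<xi> - \<eta>) + power_kernel (2 * q) p \<eta> \<xi>)"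
proof (cases "\<xi> = 0 \<or> \<eta> = 0 \<or> \<xi> - \<eta> = 0")
  case True
  then have "\<bar>\<xi>\<bar> powr p * (\<bar>\<eta>\<bar> powr q * \<bar>\<xi> - \<eta>\<bar> powr q) = 0" by auto
  moreover have "0 \<le> 2 powr (- q) * (power_kernel (p + q) q \<xi> \<eta> + power_kernel (p + q) q \<xi> (\<xi> - \<eta>) + power_kernel (2 * q) p \<eta> \<xi>)"
    by (intro mult_nonneg_nonneg add_nonneg_nonneg) simp_all
  ultimately show ?thesis by linarith
next
  case False
  then have nz: "\<bar>\<xi>\<bar> > 0" "\<bar>\<eta>\<bar> > 0" "\<bar>\<xi> - \<eta>\<bar> > 0" by auto
  have half: "\<bar>y\<bar> powr q \<le> 2 powr (- q) * \<bar>x\<bar> powr q" if "\<bar>x\<bar> > 0" "\<bar>x\<bar> \<le> 2 * \<bar>y\<bar>" for x y :: real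
  proof -
    have "\<bar>y\<bar> powr q \<le> (\<bar>x\<bar> / 2) powr q" using that by (intro powr_mono2' q) auto
    also have "\<dots> = 2 powr (- q) * \<bar>x\<bar> powr q" by (simp add: powr_divide powr_minus field_simps)
    finally show ?thesis .
  qed
  have t: "\<bar>\<xi>\<bar> \<le> \<bar>\<eta>\<bar> + \<bar>\<xi> - \<eta>\<bar>" "\<bar>\<eta>\<bar> \<le> \<bar>\<xi>\<bar> + \<bar>\<xi> - \<eta>\<bar>" by linarith+
  have k: "0 \<le> 2 powr (- q) * power_kernel e f x y" for e f x y by simp
  consider "\<bar>\<eta>\<bar> \<le> \<bar>\<xi>\<bar>" "\<bar>\<eta>\<bar> \<le> \<bar>\<xi> - \<eta>\<bar>" | "\<bar>\<xi> - \<eta>\<bar> \<le> \<bar>\<xi>\<bar>" "\<bar>\<xi> - \<eta>\<bar> \<le> \<bar>\<eta>\<bar>" | "\<bar>\<xi>\<bar> \<le> \<bar>\<eta>\<bar>" "\<bar>\<xi>\<bar> \<le> \<bar>\<xi> - \<eta>\<bar>"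
    by linarith
  then show ?thesis
  proof cases
    case 1
    have "\<bar>\<xi>\<bar> \<le> 2 * \<bar>\<xi> - \<eta>\<bar>" using 1 t by linarith
    then have "\<bar>\<xi>\<bar> powr p * (\<bar>\<eta>\<bar> powr q * \<bar>\<xi> - \<eta>\<bar> powr q) \<le> \<bar>\<xi>\<bar> powr p * (\<bar>\<eta>\<bar> powr q * (2 powr (- q) * \<bar>\<xi>\<bar> powr q))"
      using 1 nz by (intro mult_left_mono half) auto
    also have "\<dots> = 2 powr (- q) * power_kernel (p + q) q \<xi> \<eta>"
      using 1 by (simp add: power_kernel_alt powr_add mult_ac)
    finally show ?thesis using k[of "p + q" q \<xi> "\<xi> - \<eta>"] k[of "2 * q" p \<eta> \<xi>] unfolding distrib_left by linarith
  next
    case 2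
    have "\<bar>\<xi>\<bar> \<le> 2 * \<bar>\<eta>\<bar>" using 2 t by linarith
    then have "\<bar>\<xi>\<bar> powr p * (\<bar>\<eta>\<bar> powr q * \<bar>\<xi> - \<eta>\<bar> powr q) \<le> \<bar>\<xi>\<bar> powr p * ((2 powr (- q) * \<bar>\<xi>\<bar> powr q) * \<bar>\<xi> - \<eta>\<bar> powr q)"
      using 2 nz by (intro mult_left_mono mult_right_mono half) auto
    also have "\<dots> = 2 powr (- q) * power_kernel (p + q) q \<xi> (\<xi> - \<eta>)"
      using 2 by (simp add: power_kernel_alt powr_add mult_ac)
    finally show ?thesis using k[of "p + q" q \<xi> \<eta>] k[of "2 * q" p \<eta> \<xi>] unfolding distrib_left by linarith
  next
    case 3
    have "\<bar>\<eta>\<bar> \<le> 2 * \<bar>\<xi> - \<eta>\<bar>" using 3 t by linarith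
    then have "\<bar>\<xi>\<bar> powr p * (\<bar>\<eta>\<bar> powr q * \<bar>\<xi> - \<eta>\<bar> powr q) \<le> \<bar>\<xi>\<bar> powr p * (\<bar>\<eta>\<bar> powr q * (2 powr (- q) * \<bar>\<eta>\<bar> powr q))"
      using 3 nz by (intro mult_left_mono half) auto
    also have "\<dots> = 2 powr (- q) * power_kernel (2 * q) p \<eta> \<xi>"
      using 3 powr_add[of "\<bar>\<eta>\<bar>" q q] by (simp add: power_kernel_alt mult_ac)
    finally show ?thesis using k[of "p + q" q \<xi> \<eta>] k[of "p + q" q \<xi> "\<xi> - \<eta>"] unfolding distrib_left by linarith
  qed
qed

lemma ennreal_le_of_power2_le:
  assumes "(x :: ennreal)\<^sup>2 \<le> ennreal (y\<^sup>2)" "0 \<le> y"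
  shows "x \<le> ennreal y"
proof (cases x)
  case (real r)
  then have "r\<^sup>2 \<le> y\<^sup>2" using assms by (simp add: ennreal_power)
  then have "r \<le> y" using assms(2) by (rule power2_le_imp_le)
  then show ?thesis using real by (simp add: ennreal_leI)
next
  case top
  then show ?thesis using assms by (simp add: ennreal_top_mult power2_eq_square top_unique)
qed

text \<open>The relation 2p + 4q = -1 is forced by dilations of h and makes all three kernels of
  \<open>homogeneous_kernel_le\<close> meet \<open>power_kernel_bound\<close>. The first two are
  square integrable in eta, where 2q > -1 enters; the third is square integrable in xi, where 2p >
  -1 enters and the exchanged trilinear bound is used.\<close>

lemma homogeneous_trilinear_bound:
  assumes q: "q \<le> 0" "2 * q > -1" and p: "2 * p > -1" and pq: "2 * p + 4 * q = -1"
  shows "\<exists>C\<ge>0. \<forall>h\<in>L2.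
    (\<integral>\<^sup>+ \<xi>. \<integral>\<^sup>+ \<eta>. ennreal (\<bar>\<xi>\<bar> powr p * (\<bar>\<eta>\<bar> powr q * \<bar>\<xi> - \<eta>\<bar> powr q) * (cmod (h \<xi>) * (cmod (h \<eta>) * cmod (h (\<xi> - \<eta>))))) \<partial>lborel \<partial>lborel)
      \<le> ennreal (C * L2_norm h ^ 3)"
proof -
  define B1 B3 where "B1 = 2 / (2 * q + 1)" and "B3 = 2 / (2 * p + 1)"
  have B: "B1 \<ge> 0" "B3 \<ge> 0" using p q by (auto simp: B1_def B3_def)
  define K1 where "K1 \<xi> \<eta> = ennreal (power_kernel (p + q) q \<xi> \<eta>)" for \<xi> \<eta>
  define K2 where "K2 \<xi> \<eta> = ennreal (power_kernel (p + q) q \<xi> (\<xi> - \<eta>))" for \<xi> \<eta>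
  define K3 where "K3 \<xi> \<eta> = ennreal (power_kernel (2 * q) p \<eta> \<xi>)" for \<xi> \<eta>
  have Km [measurable]: "(\<lambda>(\<xi>, \<eta>). K1 \<xi> \<eta>) \<in> borel_measurable (borel \<Otimes>\<^sub>M borel)"
    "(\<lambda>(\<xi>, \<eta>). K2 \<xi> \<eta>) \<in> borel_measurable (borel \<Otimes>\<^sub>M borel)"
    "(\<lambda>(\<xi>, \<eta>). K3 \<xi> \<eta>) \<in> borel_measurable (borel \<Otimes>\<^sub>M borel)"
    unfolding K1_def K2_def K3_def by measurable
  have b1: "(\<integral>\<^sup>+ \<eta>. (K1 \<xi> \<eta>)\<^sup>2 \<partial>lborel) \<le> ennreal B1" for \<xi>
    unfolding K1_def B1_def using q pq by (intro power_kernel_bound) auto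
  have b2: "(\<integral>\<^sup>+ \<eta>. (K2 \<xi> \<eta>)\<^sup>2 \<partial>lborel) \<le> ennreal B1" for \<xi>
  proof -
    have "(\<integral>\<^sup>+ \<eta>. (K2 \<xi> \<eta>)\<^sup>2 \<partial>lborel) = (\<integral>\<^sup>+ \<eta>. (K1 \<xi> \<eta>)\<^sup>2 \<partial>lborel)"
      unfolding K1_def K2_def by (rule nn_integral_reflect) measurable
    then show ?thesis using b1 by simp
  qed
  have b3: "(\<integral>\<^sup>+ \<xi>. (K3 \<xi> \<eta>)\<^sup>2 \<partial>lborel) \<le> ennreal B3" for \<eta>
    unfolding K3_def B3_def using p pq by (intro power_kernel_bound) auto
  define C where "C = 2 powr (- q) * (sqrt B1 + sqrt B1 + sqrt B3)"
  show ?thesis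
  proof (intro exI[of _ C] conjI ballI)
    show "C \<ge> 0" using B by (simp add: C_def)
    fix h :: "real \<Rightarrow> complex" assume h: "h \<in> L2"
    note [measurable] = L2_measurable[OF h]
    define a where "a \<xi> = ennreal (cmod (h \<xi>))" for \<xi>
    have [measurable]: "a \<in> borel_measurable borel" unfolding a_def by measurable
    define N where "N = L2_norm h"
    have a2: "(\<integral>\<^sup>+ x. (a x)\<^sup>2 \<partial>lborel) = ennreal (N\<^sup>2)"
      using nn_integral_L2_norm[OF h] by (simp add: a_def N_def ennreal_power)
    have N: "0 \<le> N" by (simp add: N_def)
    define T where "T K = (\<integral>\<^sup>+ \<xi>. \<integral>\<^sup>+ \<eta>. K \<xi> \<eta> * (a \<xi> * (a \<eta> * a (\<xi> - \<eta>))) \<partial>lborel \<partial>lborel)" for K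
    have fin: "T K \<le> ennreal (sqrt B * N ^ 3)" if "(T K)\<^sup>2 \<le> ennreal B * ennreal (N\<^sup>2) * ennreal (N\<^sup>2) * ennreal (N\<^sup>2)" "0 \<le> B" for K B
    proof (rule ennreal_le_of_power2_le)
      have "ennreal B * ennreal (N\<^sup>2) * ennreal (N\<^sup>2) * ennreal (N\<^sup>2) = ennreal (B * N\<^sup>2 * N\<^sup>2 * N\<^sup>2)"
        using that(2) by (simp add: ennreal_mult)
      also have "B * N\<^sup>2 * N\<^sup>2 * N\<^sup>2 = (sqrt B * N ^ 3)\<^sup>2"
        using that(2) by (simp add: power_mult_distrib power2_eq_square power3_eq_cube)
      finally show "(T K)\<^sup>2 \<le> ennreal ((sqrt B * N ^ 3)\<^sup>2)" using that(1) by simp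
    qed (use N that(2) in simp)
    have T1: "T K1 \<le> ennreal (sqrt B1 * N ^ 3)"
      using trilinear_bound[OF Km(1) _ _ _ b1, of a a a] B by (intro fin) (auto simp: T_def a2)
    have T2: "T K2 \<le> ennreal (sqrt B1 * N ^ 3)"
      using trilinear_bound[OF Km(2) _ _ _ b2, of a a a] B by (intro fin) (auto simp: T_def a2)
    have T3: "T K3 \<le> ennreal (sqrt B3 * N ^ 3)"
      using trilinear_bound'[OF Km(3) _ _ _ b3, of a a a] B by (intro fin) (auto simp: T_def a2)
    have "(\<integral>\<^sup>+ \<xi>. \<integral>\<^sup>+ \<eta>. ennreal (\<bar>\<xi>\<bar> powr p * (\<bar>\<eta>\<bar> powr q * \<bar>\<xi> - \<eta>\<bar> powr q) * (cmod (h \<xi>) * (cmod (h \<eta>) * cmod (h (\<xi> - \<eta>))))) \<partial>lborel \<partial>lborel)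
      \<le> (\<integral>\<^sup>+ \<xi>. \<integral>\<^sup>+ \<eta>. ennreal (2 powr (- q)) * (K1 \<xi> \<eta> * (a \<xi> * (a \<eta> * a (\<xi> - \<eta>)))
          + K2 \<xi> \<eta> * (a \<xi> * (a \<eta> * a (\<xi> - \<eta>))) + K3 \<xi> \<eta> * (a \<xi> * (a \<eta> * a (\<xi> - \<eta>)))) \<partial>lborel \<partial>lborel)"
    proof (intro nn_integral_mono)
      fix \<xi> \<eta>
      define m where "m = cmod (h \<xi>) * (cmod (h \<eta>) * cmod (h (\<xi> - \<eta>)))"
      have m: "0 \<le> m" "a \<xi> * (a \<eta> * a (\<xi> - \<eta>)) = ennreal m"
        by (simp_all add: m_def a_def ennreal_mult)
      have "\<bar>\<xi>\<bar> powr p * (\<bar>\<eta>\<bar> powr q * \<bar>\<xi> - \<eta>\<bar> powr q) * m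
        \<le> 2 powr (- q) * (power_kernel (p + q) q \<xi> \<eta> + power_kernel (p + q) q \<xi> (\<xi> - \<eta>) + power_kernel (2 * q) p \<eta> \<xi>) * m"
        by (intro mult_right_mono homogeneous_kernel_le q m)
      then have "ennreal (\<bar>\<xi>\<bar> powr p * (\<bar>\<eta>\<bar> powr q * \<bar>\<xi> - \<eta>\<bar> powr q) * m)
        \<le> ennreal (2 powr (- q) * (power_kernel (p + q) q \<xi> \<eta> + power_kernel (p + q) q \<xi> (\<xi> - \<eta>) + power_kernel (2 * q) p \<eta> \<xi>) * m)"
        by (rule ennreal_leI)
      also have "\<dots> = ennreal (2 powr (- q)) * (K1 \<xi> \<eta> * ennreal m + K2 \<xi> \<eta> * ennreal m + K3 \<xi> \<eta> * ennreal m)"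
        using m(1) by (simp add: K1_def K2_def K3_def ennreal_mult add_nonneg_nonneg distrib_right mult.assoc)
      finally show "ennreal (\<bar>\<xi>\<bar> powr p * (\<bar>\<eta>\<bar> powr q * \<bar>\<xi> - \<eta>\<bar> powr q) * (cmod (h \<xi>) * (cmod (h \<eta>) * cmod (h (\<xi> - \<eta>)))))
        \<le> ennreal (2 powr (- q)) * (K1 \<xi> \<eta> * (a \<xi> * (a \<eta> * a (\<xi> - \<eta>)))
          + K2 \<xi> \<eta> * (a \<xi> * (a \<eta> * a (\<xi> - \<eta>))) + K3 \<xi> \<eta> * (a \<xi> * (a \<eta> * a (\<xi> - \<eta>))))"
        unfolding m(2) unfolding m_def .
    qed
    also have "\<dots> = ennreal (2 powr (- q)) * (T K1 + T K2 + T K3)"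
      unfolding T_def by (simp add: nn_integral_cmult nn_integral_add)
    also have "\<dots> \<le> ennreal (2 powr (- q)) * (ennreal (sqrt B1 * N ^ 3) + ennreal (sqrt B1 * N ^ 3) + ennreal (sqrt B3 * N ^ 3))"
      by (intro mult_left_mono add_mono T1 T2 T3) auto
    also have "\<dots> = ennreal (2 powr (- q) * (sqrt B1 * N ^ 3 + sqrt B1 * N ^ 3 + sqrt B3 * N ^ 3))"
    proof -
      have "ennreal c * (ennreal x + ennreal y + ennreal z) = ennreal (c * (x + y + z))"
        if "0 \<le> c" "0 \<le> x" "0 \<le> y" "0 \<le> z" for c x y z
        using that by (simp add: ennreal_mult add_nonneg_nonneg)
      then show ?thesis using B N by simp
    qed
    also have "2 powr (- q) * (sqrt B1 * N ^ 3 + sqrt B1 * N ^ 3 + sqrt B3 * N ^ 3) = C * N ^ 3"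
      by (simp add: C_def algebra_simps)
    finally show "(\<integral>\<^sup>+ \<xi>. \<integral>\<^sup>+ \<eta>. ennreal (\<bar>\<xi>\<bar> powr p * (\<bar>\<eta>\<bar> powr q * \<bar>\<xi> - \<eta>\<bar> powr q) * (cmod (h \<xi>) * (cmod (h \<eta>) * cmod (h (\<xi> - \<eta>))))) \<partial>lborel \<partial>lborel)
      \<le> ennreal (C * L2_norm h ^ 3)" unfolding N_def .
  qed
qed

section \<open>Pointwise bounds for tanh and for the Sobolev weight\<close>

lemma abs_tanh_le: "\<bar>tanh x\<bar> \<le> \<bar>x :: real\<bar>"
proof -
  have "tanh y \<le> y" if "0 \<le> y" for y :: real
  proof -
    have "0 - tanh 0 \<le> y - tanh y"
    proof (rule DERIV_nonneg_imp_nondecreasing[OF that])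
      fix x :: real
      have "((\<lambda>x. x - tanh x) has_real_derivative (tanh x)\<^sup>2) (at x)"
        by (auto intro!: derivative_eq_intros)
      then show "\<exists>z. ((\<lambda>x. x - tanh x) has_real_derivative z) (at x) \<and> 0 \<le> z"
        by (intro exI[of _ "(tanh x)\<^sup>2"]) simp
    qed
    then show ?thesis by simp
  qed
  from this[of "\<bar>x\<bar>"] show ?thesis by (cases "0 \<le> x") (auto simp: abs_if)
qed

text \<open>Interpolates between |tanh x| <= |x|, used where sigma |x| <= 1, and |tanh x| <= 1, used
  elsewhere.\<close>

lemma abs_tanh_le_powr:
  fixes \<theta> \<sigma> x :: real
  assumes "0 < \<theta>" "\<theta> \<le> 1" "0 \<le> \<sigma>"
  shows "\<bar>tanh (\<sigma> * x)\<bar> \<le> \<sigma> powr \<theta> * \<bar>x\<bar> powr \<theta>"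
proof -
  define y where "y = \<sigma> * \<bar>x\<bar>"
  have y: "0 \<le> y" "\<bar>\<sigma> * x\<bar> = y" using assms by (auto simp: y_def abs_mult)
  have "\<bar>tanh (\<sigma> * x)\<bar> \<le> y powr \<theta>"
  proof (cases "y \<le> 1")
    case True
    have "y powr 1 \<le> y powr \<theta>"
      by (rule powr_mono') (use assms y True in auto)
    then show ?thesis using abs_tanh_le[of "\<sigma> * x"] y by simp
  next
    case False
    then have "1 \<le> y powr \<theta>" using assms by (intro ge_one_powr_ge_zero) auto
    then show ?thesis using tanh_real_bounds[of "\<sigma> * x"] by (auto simp: abs_if)
  qed
  then show ?thesis using assms by (simp add: y_def powr_mult)
qed

text \<open>\<open>sob\<close> dominates every power |x|^a with 0 <= a <= \<alpha>, for small x by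
  its constant term. A freely chosen a makes the bound homogeneous and lets large \<alpha> be used
  only in part.\<close>

lemma powr_div_sob_le:
  assumes "0 \<le> a" "a \<le> \<alpha>"
  shows "\<bar>x\<bar> powr s / sqrt (sob \<alpha> x) \<le> \<bar>x\<bar> powr (s - a / 2)"
proof (cases "x = 0")
  case False
  then have x: "\<bar>x\<bar> > 0" by simp
  have "\<bar>x\<bar> powr a \<le> sob \<alpha> x"
  proof (cases "\<bar>x\<bar> \<le> 1")
    case True
    then have "\<bar>x\<bar> powr a \<le> 1" using assms by (intro powr_le1) auto
    then show ?thesis using sob_ge_1[of \<alpha> x] by linarith
  next
    case False
    then have "\<bar>x\<bar> powr a \<le> \<bar>x\<bar> powr \<alpha>" using assms by (intro powr_mono) auto
    then show ?thesis by (simp add: sob_def)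
  qed
  then have "sqrt (\<bar>x\<bar> powr a) \<le> sqrt (sob \<alpha> x)" by simp
  moreover have "sqrt (\<bar>x\<bar> powr a) = \<bar>x\<bar> powr (a / 2)"
    by (simp add: powr_half_sqrt[symmetric] powr_powr)
  ultimately have "\<bar>x\<bar> powr s / sqrt (sob \<alpha> x) \<le> \<bar>x\<bar> powr s / \<bar>x\<bar> powr (a / 2)"
    using x by (intro divide_left_mono) auto
  then show ?thesis by (simp add: powr_diff)
qed simp

text \<open>The Fourier transforms of real-valued functions are the fixed points of \<open>herm\<close>.\<close>

definition herm :: "ltwo \<Rightarrow> ltwo" where
  "herm V = lt (\<lambda>\<xi>. cnj (fn V (- \<xi>)))"

lemma L2_reflect0: "f \<in> L2 \<Longrightarrow> (\<lambda>x. f (- x)) \<in> L2"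
  using L2_reflect[of f 0] by simp

lemma AE_reflect:
  assumes "AE x in lborel. P x" "Measurable.pred borel P"
  shows "AE x in lborel. P (- x :: real)"
  using AE_borel_affine[OF _ assms(2,1), of "-1" 0] by simp

lemma fn_herm: "AE \<xi> in lborel. fn (herm V) \<xi> = cnj (fn V (- \<xi>))"
  unfolding herm_def by (intro fn_lt L2_cnj L2_reflect0) simp

lemma herm_lt:
  assumes f: "f \<in> L2" shows "herm (lt f) = lt (\<lambda>\<xi>. cnj (f (- \<xi>)))"
proof -
  have [measurable]: "f \<in> borel_measurable borel" using f by (rule L2_measurable)
  have "AE x in lborel. fn (lt f) (- x) = f (- x)"
    by (rule AE_reflect[OF fn_lt[OF f]]) measurable
  then show ?thesis
    unfolding herm_def using f by (intro lt_eqI L2_cnj L2_reflect0) (auto elim: eventually_mono)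
qed

lemma norm_herm: "norm (herm V) = norm V"
proof -
  have "(\<lambda>\<xi>. cnj (fn V (- \<xi>))) \<in> L2" by (intro L2_cnj L2_reflect0) simp
  then have "ennreal ((norm (herm V))\<^sup>2) = ennreal ((norm V)\<^sup>2)"
    using nn_integral_reflect[of "\<lambda>x. ennreal ((cmod (fn V x))\<^sup>2)" 0]
    by (simp add: herm_def norm_lt norm_ltwo[of V] flip: nn_integral_L2_norm)
  then show ?thesis by (simp add: power2_eq_iff_nonneg)
qed

lemma bounded_linear_herm: "bounded_linear herm"
proof (rule bounded_linear_intro[of _ 1])
  fix V W c
  have a: "AE x in lborel. fn (V + W) (- x) = fn V (- x) + fn W (- x)"
    by (rule AE_reflect[OF fn_add]) measurable
  show "herm (V + W) = herm V + herm W"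
    by (intro ltwo_eqI) (use a fn_herm[of V] fn_herm[of W] fn_herm[of "V + W"] fn_add[of "herm V" "herm W"]
      in eventually_elim, simp)
  have b: "AE x in lborel. fn (c *\<^sub>R V) (- x) = c *\<^sub>R fn V (- x)"
    by (rule AE_reflect[OF fn_scaleR]) measurable
  show "herm (c *\<^sub>R V) = c *\<^sub>R herm V"
    by (intro ltwo_eqI) (use b fn_herm[of V] fn_herm[of "c *\<^sub>R V"] fn_scaleR[of c "herm V"]
      in eventually_elim, simp)
qed (simp add: norm_herm)

lemma bbm_symbol_minus: "cnj (bbm_symbol \<alpha> (- \<xi>)) = bbm_symbol \<alpha> \<xi>"
  by (simp add: bbm_symbol_eq)

lemma convolution_reflect_cnj:
  "convolution (\<lambda>\<eta>. cnj (v (- \<eta>))) (\<lambda>\<eta>. cnj (w (- \<eta>))) \<xi> = cnj (convolution v w (- \<xi>))"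
proof -
  have "convolution (\<lambda>\<eta>. cnj (v (- \<eta>))) (\<lambda>\<eta>. cnj (w (- \<eta>))) \<xi>
    = (LINT \<eta>|lborel. cnj (v \<eta> * w (- \<xi> - \<eta>)))"
    unfolding convolution_def by (subst lborel_integral_real_affine[of "-1" _ 0]) auto
  then show ?thesis unfolding convolution_def by (simp del: complex_cnj_mult)
qed

lemma bil_herm:
  assumes "1 < \<alpha>" shows "bil \<alpha> \<sigma> (herm V) (herm W) = herm (bil \<alpha> \<sigma> V W)"
proof -
  have u: "AE \<eta> in lborel. unweight \<alpha> \<sigma> (herm V) \<eta> = cnj (unweight \<alpha> \<sigma> V (- \<eta>))" for V
    using fn_herm[of V] by eventually_elim (simp add: unweight_def)
  have "convolution (unweight \<alpha> \<sigma> (herm V)) (unweight \<alpha> \<sigma> (herm W))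
    = convolution (\<lambda>\<eta>. cnj (unweight \<alpha> \<sigma> V (- \<eta>))) (\<lambda>\<eta>. cnj (unweight \<alpha> \<sigma> W (- \<eta>)))"
    by (rule convolution_cong_AE[OF u u]) measurable
  then have "bil_fun \<alpha> \<sigma> (herm V) (herm W) = (\<lambda>\<xi>. cnj (bil_fun \<alpha> \<sigma> V W (- \<xi>)))"
    by (simp add: fun_eq_iff bil_fun_def convolution_reflect_cnj bbm_symbol_minus)
  then show ?thesis
    using herm_lt[OF bil_fun_L2[OF assms]] by (simp add: bil_def)
qed

lemma mult_op_herm:
  assumes "1 \<le> \<alpha>" shows "mult_op (bbm_symbol \<alpha>) (herm V) = herm (mult_op (bbm_symbol \<alpha>) V)"
proof -
  note b = bbm_symbol_measurable[of \<alpha>] cmod_bbm_symbol_le[OF assms]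
  have a: "AE x in lborel. fn (mult_op (bbm_symbol \<alpha>) V) (- x) = bbm_symbol \<alpha> (- x) * fn V (- x)"
    by (rule AE_reflect[OF fn_mult_op[OF b]]) measurable
  show ?thesis
    by (intro ltwo_eqI) (use a fn_mult_op[OF b, of "herm V"] fn_herm[of V] fn_herm[of "mult_op (bbm_symbol \<alpha>) V"]
      in eventually_elim, simp add: bbm_symbol_minus)
qed

lemma bbm_field_herm:
  assumes "1 < \<alpha>" shows "bbm_field \<alpha> \<sigma> (herm V) = herm (bbm_field \<alpha> \<sigma> V)"
proof -
  interpret herm: bounded_linear herm by (rule bounded_linear_herm)
  show ?thesis
    using assms by (simp add: bbm_field_def bil_herm mult_op_herm herm.neg herm.diff herm.scaleR)
qed

text \<open>The symbol is purely imaginary, so the integrand of the complex inner product has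
  vanishing real part: the dispersive term does not change the energy.\<close>

lemma inner_mult_op_bbm:
  assumes "1 \<le> \<alpha>" shows "inner V (mult_op (bbm_symbol \<alpha>) V) = 0"
proof -
  have "inner V (mult_op (bbm_symbol \<alpha>) V) = (LINT x|lborel. Re (fn V x * cnj (fn (mult_op (bbm_symbol \<alpha>) V) x)))"
    unfolding inner_ltwo_def by (rule integral_Re[symmetric]) (rule fn_integrable)
  also have "\<dots> = 0"
  proof (rule integral_eq_zero_AE)
    show "AE x in lborel. Re (fn V x * cnj (fn (mult_op (bbm_symbol \<alpha>) V) x)) = 0"
      using fn_mult_op[OF bbm_symbol_measurable cmod_bbm_symbol_le[OF assms], of V]
    proof eventually_elim
      case (elim x)
      have "fn V x * cnj (fn (mult_op (bbm_symbol \<alpha>) V) x) = cnj (bbm_symbol \<alpha> x) * of_real ((cmod (fn V x))\<^sup>2)"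
        unfolding elim complex_norm_square by simp
      then show ?case by (simp add: bbm_symbol_eq del: of_real_power)
    qed
  qed
  finally show ?thesis .
qed

text \<open>The Fourier side of the vanishing of the integral of \<open>u\<^sup>2 u\<^sub>x\<close>.\<close>

lemma cubic_cancellation:
  fixes U :: "real \<Rightarrow> complex"
  defines "X \<equiv> (\<lambda>(\<xi>, \<eta>). of_real \<xi> * (cnj (U \<xi>) * (U \<eta> * U (\<xi> - \<eta>))))"
  assumes herm: "\<And>\<xi>. U (- \<xi>) = cnj (U \<xi>)" and X: "integrable (lborel \<Otimes>\<^sub>M lborel) X"
  shows "integral\<^sup>L (lborel \<Otimes>\<^sub>M lborel) X = 0"
proof -
  \<comment> \<open>The integrand X with the factor eta in place of xi. Exchanging the variables
    turns Y into the conjugate of X by the symmetry of U. The substitution eta -> xi - eta keeps the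
    product U eta * U (xi - eta) and turns X - Y into Y.\<close>
  define Y where "Y = (\<lambda>(\<xi>, \<eta>). of_real \<eta> * (cnj (U \<xi>) * (U \<eta> * U (\<xi> - \<eta>))))"
  have Yswap: "Y = (\<lambda>(\<xi>, \<eta>). cnj (X (\<eta>, \<xi>)))"
  proof (rule ext, clarify)
    fix \<xi> \<eta>
    have "U (\<xi> - \<eta>) = cnj (U (\<eta> - \<xi>))" using herm[of "\<eta> - \<xi>"] by simp
    then show "Y (\<xi>, \<eta>) = cnj (X (\<eta>, \<xi>))" by (simp add: Y_def X_def mult_ac)
  qed
  have sw: "integrable (lborel \<Otimes>\<^sub>M lborel) (\<lambda>(\<xi>, \<eta>). X (\<eta>, \<xi>))"
    by (rule lborel_pair.integrable_product_swap[OF X])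
  then have Y: "integrable (lborel \<Otimes>\<^sub>M lborel) Y"
    unfolding Yswap by (simp add: split_beta')
  have intY: "integral\<^sup>L (lborel \<Otimes>\<^sub>M lborel) Y = cnj (integral\<^sup>L (lborel \<Otimes>\<^sub>M lborel) X)"
  proof -
    have "integral\<^sup>L (lborel \<Otimes>\<^sub>M lborel) Y = cnj (integral\<^sup>L (lborel \<Otimes>\<^sub>M lborel) (\<lambda>(\<xi>, \<eta>). X (\<eta>, \<xi>)))"
      unfolding Yswap by (simp add: split_beta')
    also have "integral\<^sup>L (lborel \<Otimes>\<^sub>M lborel) (\<lambda>(\<xi>, \<eta>). X (\<eta>, \<xi>)) = integral\<^sup>L (lborel \<Otimes>\<^sub>M lborel) X"
      by (rule lborel_pair.integral_product_swap) (use X in \<open>auto dest: borel_measurable_integrable\<close>)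
    finally show ?thesis .
  qed
  have "integral\<^sup>L (lborel \<Otimes>\<^sub>M lborel) X - integral\<^sup>L (lborel \<Otimes>\<^sub>M lborel) Y
    = integral\<^sup>L (lborel \<Otimes>\<^sub>M lborel) (\<lambda>p. X p - Y p)"
    by (rule Bochner_Integration.integral_diff[OF X Y, symmetric])
  also have "\<dots> = (LINT \<xi>|lborel. LINT \<eta>|lborel. X (\<xi>, \<eta>) - Y (\<xi>, \<eta>))"
    by (rule lborel_pair.integral_fst'[symmetric]) (rule Bochner_Integration.integrable_diff[OF X Y])
  also have "\<dots> = (LINT \<xi>|lborel. LINT \<eta>|lborel. Y (\<xi>, \<eta>))"
  proof (rule Bochner_Integration.integral_cong[OF refl])
    fix \<xi>
    have "(LINT \<eta>|lborel. X (\<xi>, \<eta>) - Y (\<xi>, \<eta>)) = (LINT \<eta>|lborel. X (\<xi>, \<xi> - \<eta>) - Y (\<xi>, \<xi> - \<eta>))"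
      by (subst lborel_integral_real_affine[of "-1" _ \<xi>]) auto
    also have "\<dots> = (LINT \<eta>|lborel. Y (\<xi>, \<eta>))"
      by (rule Bochner_Integration.integral_cong[OF refl]) (simp add: X_def Y_def algebra_simps)
    finally show "(LINT \<eta>|lborel. X (\<xi>, \<eta>) - Y (\<xi>, \<eta>)) = (LINT \<eta>|lborel. Y (\<xi>, \<eta>))" .
  qed
  also have "\<dots> = integral\<^sup>L (lborel \<Otimes>\<^sub>M lborel) Y"
    by (rule lborel_pair.integral_fst'[OF Y])
  \<comment> \<open>The integral equals twice its own conjugate, so comparing moduli forces it to be
    0.\<close>
  finally have "integral\<^sup>L (lborel \<Otimes>\<^sub>M lborel) X = 2 * cnj (integral\<^sup>L (lborel \<Otimes>\<^sub>M lborel) X)"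
    unfolding intY by (simp add: algebra_simps)
  from arg_cong[OF this, of cmod] show ?thesis by (simp add: norm_mult)
qed

lemma cosh_quotient: "cosh (a + b) / (cosh a * cosh b) = 1 + tanh a * tanh (b :: real)"
  by (simp add: cosh_add tanh_def add_divide_distrib)

lemma integrable_pairI:
  fixes X :: "real \<times> real \<Rightarrow> complex"
  assumes [measurable]: "X \<in> borel_measurable (lborel \<Otimes>\<^sub>M lborel)"
    and le: "(\<integral>\<^sup>+ x. \<integral>\<^sup>+ y. ennreal (cmod (X (x, y))) \<partial>lborel \<partial>lborel) \<le> ennreal c"
  shows "integrable (lborel \<Otimes>\<^sub>M lborel) X" "0 \<le> c \<Longrightarrow> cmod (integral\<^sup>L (lborel \<Otimes>\<^sub>M lborel) X) \<le> c"
proof -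
  have eq: "(\<integral>\<^sup>+ p. ennreal (cmod (X p)) \<partial>(lborel \<Otimes>\<^sub>M lborel)) = (\<integral>\<^sup>+ x. \<integral>\<^sup>+ y. ennreal (cmod (X (x, y))) \<partial>lborel \<partial>lborel)"
    by (subst lborel.nn_integral_fst[symmetric]) auto
  show i: "integrable (lborel \<Otimes>\<^sub>M lborel) X"
    by (rule integrableI_bounded) (use le eq in \<open>auto intro: le_less_trans\<close>)
  assume "0 \<le> c"
  have "ennreal (cmod (integral\<^sup>L (lborel \<Otimes>\<^sub>M lborel) X)) \<le> ennreal c"
    using integral_norm_bound_ennreal[OF i] le eq by simp
  then show "cmod (integral\<^sup>L (lborel \<Otimes>\<^sub>M lborel) X) \<le> c" using \<open>0 \<le> c\<close> by simp
qed

text \<open>The symmetry \<open>herm V = V\<close>, that is, real-valued u, is what removes the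
  leading cubic term. At sigma = 0 the bound is 0 and expresses the conservation of the
  H^(\<alpha>/2) energy.\<close>

theorem bbm_energy:
  assumes \<alpha>: "1 < \<alpha>"
  obtains D where "D \<ge> 0" "\<And>\<sigma> V. 0 \<le> \<sigma> \<Longrightarrow> herm V = V \<Longrightarrow>
    inner V (bbm_field \<alpha> \<sigma> V) \<le> D * \<sigma> powr (1 / decay_exponent \<alpha>) * norm V ^ 3"
proof -
  \<comment> \<open>The number of powers taken from the Sobolev weight. Beyond 7/3 the scaling
    relation would demand theta > 1.\<close>
  define a where "a = min \<alpha> (7/3)"
  \<comment> \<open>The solution of p + 2q = -1/2 for the exponents defined next, which is the
    homogeneity needed for the trilinear bound.\<close>
  define \<theta> where "\<theta> = 3 * (a - 1) / 4"
  define p q where "p = 1 - a / 2" and "q = \<theta> - a / 2"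
  have a: "1 < a" "a \<le> \<alpha>" "a \<le> 7/3" using \<alpha> by (auto simp: a_def)
  have \<theta>: "0 < \<theta>" "\<theta> \<le> 1" using a by (auto simp: \<theta>_def)
  have kap: "1 / decay_exponent \<alpha> = \<theta> + \<theta>"
    using \<alpha> by (auto simp: decay_exponent_def \<theta>_def a_def min_def field_simps)
  have pq: "q \<le> 0" "2 * q > -1" "2 * p > -1" "2 * p + 4 * q = -1"
    using a by (auto simp: p_def q_def \<theta>_def field_simps)
  obtain C where C: "C \<ge> 0" "\<And>h. h \<in> L2 \<Longrightarrow>
    (\<integral>\<^sup>+ \<xi>. \<integral>\<^sup>+ \<eta>. ennreal (\<bar>\<xi>\<bar> powr p * (\<bar>\<eta>\<bar> powr q * \<bar>\<xi> - \<eta>\<bar> powr q) * (cmod (h \<xi>) * (cmod (h \<eta>) * cmod (h (\<xi> - \<eta>))))) \<partial>lborel \<partial>lborel)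
      \<le> ennreal (C * L2_norm h ^ 3)"
    using homogeneous_trilinear_bound[OF pq] by blast
  obtain B where B: "B \<ge> 0" "\<And>\<xi>. (\<integral>\<^sup>+ \<eta>. (ennreal (sob_kernel \<alpha> \<xi> \<eta>))\<^sup>2 \<partial>lborel) \<le> ennreal B"
    using sob_kernel_bound[OF \<alpha>] by metis
  have key: "\<bar>inner V (bil \<alpha> \<sigma> V V)\<bar> \<le> C * \<sigma> powr (1 / decay_exponent \<alpha>) * norm V ^ 3"
    if \<sigma>: "0 \<le> \<sigma>" and V: "herm V = V" for \<sigma> V
  proof -
    \<comment> \<open>A representative with the symmetry at every point: \<open>herm V = V\<close>
      provides it only almost everywhere, whereas \<open>cubic_cancellation\<close> asks for it
      pointwise.\<close>
    define h where "h \<xi> = (fn V \<xi> + cnj (fn V (- \<xi>))) / 2" for \<xi>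
    have [measurable]: "h \<in> borel_measurable borel" unfolding h_def by measurable
    have hV: "AE \<xi> in lborel. h \<xi> = fn V \<xi>"
      using fn_herm[of V] unfolding V by eventually_elim (simp add: h_def)
    have hL2: "h \<in> L2" and hN: "L2_norm h = norm V"
      using L2_cong_AE[OF fn_L2[of V] _ hV] by (simp_all add: norm_ltwo)
    have hh: "h (- \<xi>) = cnj (h \<xi>)" for \<xi> by (simp add: h_def)
    \<comment> \<open>The transform of u times cosh (sigma xi): the Sobolev factor is removed from V
      and the exponential one is kept.\<close>
    define U where "U \<xi> = h \<xi> / of_real (sqrt (sob \<alpha> \<xi>))" for \<xi>
    have [measurable]: "U \<in> borel_measurable borel" unfolding U_def by measurable
    have UU: "U (- \<xi>) = cnj (U \<xi>)" for \<xi> by (simp add: U_def hh)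
    define t where "t \<xi> = tanh (\<sigma> * \<xi>)" for \<xi>
    have [measurable]: "t \<in> borel_measurable borel"
      unfolding t_def by (intro borel_measurable_continuous_onI continuous_intros) auto
    define X where "X = (\<lambda>(\<xi>, \<eta>). complex_of_real \<xi> * (cnj (U \<xi>) * (U \<eta> * U (\<xi> - \<eta>))))"
    define Z where "Z = (\<lambda>(\<xi>, \<eta>). complex_of_real (t \<eta> * t (\<xi> - \<eta>)) * X (\<xi>, \<eta>))"
    have [measurable]: "X \<in> borel_measurable (lborel \<Otimes>\<^sub>M lborel)" unfolding X_def by measurable
    have Zm [measurable]: "Z \<in> borel_measurable (lborel \<Otimes>\<^sub>M lborel)" unfolding Z_def by measurable
    have cX: "cmod (X (\<xi>, \<eta>)) = sob_kernel \<alpha> \<xi> \<eta> * (cmod (h \<xi>) * (cmod (h \<eta>) * cmod (h (\<xi> - \<eta>))))" for \<xi> \<eta>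
      by (simp add: X_def U_def norm_mult norm_divide sob_kernel_def)
    \<comment> \<open>X and Z can be integrated separately only if both converge absolutely. For X
      this follows from the square integrability of \<open>sob_kernel\<close>.\<close>
    have Xint: "integrable (lborel \<Otimes>\<^sub>M lborel) X"
    proof (rule integrable_pairI(1))
      define N where "N = norm V"
      have a2: "(\<integral>\<^sup>+ x. (ennreal (cmod (h x)))\<^sup>2 \<partial>lborel) = ennreal (N\<^sup>2)"
        using nn_integral_L2_norm[OF hL2] by (simp add: N_def hN ennreal_power)
      have "(\<integral>\<^sup>+ \<xi>. \<integral>\<^sup>+ \<eta>. ennreal (cmod (X (\<xi>, \<eta>))) \<partial>lborel \<partial>lborel)
        = (\<integral>\<^sup>+ \<xi>. \<integral>\<^sup>+ \<eta>. ennreal (sob_kernel \<alpha> \<xi> \<eta>) * (ennreal (cmod (h \<xi>)) * (ennreal (cmod (h \<eta>)) * ennreal (cmod (h (\<xi> - \<eta>))))) \<partial>lborel \<partial>lborel)"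
        by (simp add: cX ennreal_mult)
      also have "\<dots> \<le> ennreal (sqrt B * N ^ 3)"
      proof (rule ennreal_le_of_power2_le)
        have "(\<integral>\<^sup>+ \<xi>. \<integral>\<^sup>+ \<eta>. ennreal (sob_kernel \<alpha> \<xi> \<eta>) * (ennreal (cmod (h \<xi>)) * (ennreal (cmod (h \<eta>)) * ennreal (cmod (h (\<xi> - \<eta>))))) \<partial>lborel \<partial>lborel)\<^sup>2
          \<le> ennreal B * ennreal (N\<^sup>2) * ennreal (N\<^sup>2) * ennreal (N\<^sup>2)"
          unfolding a2[symmetric] by (rule trilinear_bound) (measurable, rule B(2))
        also have "\<dots> = ennreal (B * N\<^sup>2 * N\<^sup>2 * N\<^sup>2)"
          using B(1) by (simp add: ennreal_mult)
        also have "B * N\<^sup>2 * N\<^sup>2 * N\<^sup>2 = (sqrt B * N ^ 3)\<^sup>2"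
          using B(1) by (simp add: power_mult_distrib power2_eq_square power3_eq_cube)
        finally show "(\<integral>\<^sup>+ \<xi>. \<integral>\<^sup>+ \<eta>. ennreal (sob_kernel \<alpha> \<xi> \<eta>) * (ennreal (cmod (h \<xi>)) * (ennreal (cmod (h \<eta>)) * ennreal (cmod (h (\<xi> - \<eta>))))) \<partial>lborel \<partial>lborel)\<^sup>2
          \<le> ennreal ((sqrt B * N ^ 3)\<^sup>2)" .
      qed (use B(1) in \<open>simp add: N_def\<close>)
      finally show "(\<integral>\<^sup>+ \<xi>. \<integral>\<^sup>+ \<eta>. ennreal (cmod (X (\<xi>, \<eta>))) \<partial>lborel \<partial>lborel) \<le> ennreal (sqrt B * N ^ 3)" .
    qed measurable
    have X0: "integral\<^sup>L (lborel \<Otimes>\<^sub>M lborel) X = 0"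
      using cubic_cancellation[of U, OF UU] Xint by (simp add: X_def)
    have Zle: "(\<integral>\<^sup>+ \<xi>. \<integral>\<^sup>+ \<eta>. ennreal (cmod (Z (\<xi>, \<eta>))) \<partial>lborel \<partial>lborel)
      \<le> ennreal (C * \<sigma> powr (1 / decay_exponent \<alpha>) * norm V ^ 3)"
    proof -
      have "(\<integral>\<^sup>+ \<xi>. \<integral>\<^sup>+ \<eta>. ennreal (cmod (Z (\<xi>, \<eta>))) \<partial>lborel \<partial>lborel)
        \<le> (\<integral>\<^sup>+ \<xi>. \<integral>\<^sup>+ \<eta>. ennreal (\<sigma> powr (\<theta> + \<theta>)) * ennreal (\<bar>\<xi>\<bar> powr p * (\<bar>\<eta>\<bar> powr q * \<bar>\<xi> - \<eta>\<bar> powr q)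
            * (cmod (h \<xi>) * (cmod (h \<eta>) * cmod (h (\<xi> - \<eta>))))) \<partial>lborel \<partial>lborel)"
      proof (intro nn_integral_mono)
        fix \<xi> \<eta>
        define m where "m = cmod (h \<xi>) * (cmod (h \<eta>) * cmod (h (\<xi> - \<eta>)))"
        have m: "0 \<le> m" by (simp add: m_def)
        have s: "\<bar>t x\<bar> / sqrt (sob \<alpha> x) \<le> \<sigma> powr \<theta> * \<bar>x\<bar> powr q" for x
        proof -
          have "\<bar>t x\<bar> / sqrt (sob \<alpha> x) \<le> \<sigma> powr \<theta> * \<bar>x\<bar> powr \<theta> / sqrt (sob \<alpha> x)"
            unfolding t_def by (intro divide_right_mono abs_tanh_le_powr \<theta> \<sigma>) simp
          also have "\<dots> \<le> \<sigma> powr \<theta> * \<bar>x\<bar> powr q"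
            using mult_left_mono[OF powr_div_sob_le[of a \<alpha> x \<theta>], of "\<sigma> powr \<theta>"] a by (simp add: q_def)
          finally show ?thesis .
        qed
        have "\<bar>\<xi>\<bar> / sqrt (sob \<alpha> \<xi>) \<le> \<bar>\<xi>\<bar> powr p"
          using powr_div_sob_le[of a \<alpha> \<xi> 1] a by (simp add: p_def)
        then have "(\<bar>\<xi>\<bar> / sqrt (sob \<alpha> \<xi>)) * ((\<bar>t \<eta>\<bar> / sqrt (sob \<alpha> \<eta>)) * (\<bar>t (\<xi> - \<eta>)\<bar> / sqrt (sob \<alpha> (\<xi> - \<eta>)))) * m
          \<le> (\<bar>\<xi>\<bar> powr p) * ((\<sigma> powr \<theta> * \<bar>\<eta>\<bar> powr q) * (\<sigma> powr \<theta> * \<bar>\<xi> - \<eta>\<bar> powr q)) * m"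
          by (intro mult_right_mono[OF _ m] mult_mono s) simp_all
        also have "\<dots> = \<sigma> powr (\<theta> + \<theta>) * (\<bar>\<xi>\<bar> powr p * (\<bar>\<eta>\<bar> powr q * \<bar>\<xi> - \<eta>\<bar> powr q) * m)"
          by (simp only: powr_add mult_ac)
        also have "(\<bar>\<xi>\<bar> / sqrt (sob \<alpha> \<xi>)) * ((\<bar>t \<eta>\<bar> / sqrt (sob \<alpha> \<eta>)) * (\<bar>t (\<xi> - \<eta>)\<bar> / sqrt (sob \<alpha> (\<xi> - \<eta>)))) * m = cmod (Z (\<xi>, \<eta>))"
          by (simp add: Z_def norm_mult abs_mult cX sob_kernel_def m_def mult_ac)
        finally show "ennreal (cmod (Z (\<xi>, \<eta>))) \<le> ennreal (\<sigma> powr (\<theta> + \<theta>)) * ennreal (\<bar>\<xi>\<bar> powr p * (\<bar>\<eta>\<bar> powr q * \<bar>\<xi> - \<eta>\<bar> powr q)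
            * (cmod (h \<xi>) * (cmod (h \<eta>) * cmod (h (\<xi> - \<eta>)))))"
          by (simp add: m_def ennreal_leI flip: ennreal_mult)
      qed
      also have "\<dots> = ennreal (\<sigma> powr (\<theta> + \<theta>)) * (\<integral>\<^sup>+ \<xi>. \<integral>\<^sup>+ \<eta>. ennreal (\<bar>\<xi>\<bar> powr p * (\<bar>\<eta>\<bar> powr q * \<bar>\<xi> - \<eta>\<bar> powr q)
            * (cmod (h \<xi>) * (cmod (h \<eta>) * cmod (h (\<xi> - \<eta>))))) \<partial>lborel \<partial>lborel)"
        by (simp add: nn_integral_cmult)
      also have "\<dots> \<le> ennreal (\<sigma> powr (\<theta> + \<theta>)) * ennreal (C * L2_norm h ^ 3)"
        by (intro mult_left_mono C hL2) simp
      also have "\<dots> = ennreal (C * \<sigma> powr (1 / decay_exponent \<alpha>) * norm V ^ 3)"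
        unfolding kap hN using C(1) by (simp add: mult_ac flip: ennreal_mult)
      finally show ?thesis .
    qed
    have Zint: "integrable (lborel \<Otimes>\<^sub>M lborel) Z"
      by (rule integrable_pairI(1)[OF Zm Zle])
    have Zn: "cmod (integral\<^sup>L (lborel \<Otimes>\<^sub>M lborel) Z) \<le> C * \<sigma> powr (1 / decay_exponent \<alpha>) * norm V ^ 3"
      by (rule integrable_pairI(2)[OF Zm Zle]) (use C(1) in simp)
    have conv: "convolution (unweight \<alpha> \<sigma> V) (unweight \<alpha> \<sigma> V)
        = convolution (\<lambda>\<eta>. h \<eta> / of_real (wt \<alpha> \<sigma> \<eta>)) (\<lambda>\<eta>. h \<eta> / of_real (wt \<alpha> \<sigma> \<eta>))"
    proof -
      have "AE \<eta> in lborel. unweight \<alpha> \<sigma> V \<eta> = h \<eta> / of_real (wt \<alpha> \<sigma> \<eta>)"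
        using hV by eventually_elim (simp add: unweight_def)
      from convolution_cong_AE[OF this this] show ?thesis by simp
    qed
    \<comment> \<open>The square root of \<open>sob\<close> in h and the one in the outer weight
      cancel the denominator of the symbol. What remains is xi, three values of U and the quotient
      of cosh, which is 1 plus the product of tanh in Z.\<close>
    have pt: "cnj (h \<xi>) * bil_fun \<alpha> \<sigma> V V \<xi> = \<i> * (LINT \<eta>|lborel. X (\<xi>, \<eta>) + Z (\<xi>, \<eta>))" for \<xi>
    proof -
      define S where "S x = complex_of_real (sqrt (sob \<alpha> x))" for x
      define c where "c x = complex_of_real (cosh (\<sigma> * x))" for x
      have S: "S x \<noteq> 0" "S x * S x = of_real (sob \<alpha> x)" for x
        by (simp_all add: S_def flip: of_real_mult)
      have c: "c x \<noteq> 0" for x by (simp add: c_def)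
      have w: "complex_of_real (wt \<alpha> \<sigma> x) = S x * c x" for x by (simp add: wt_def S_def c_def)
      have hS: "h x = S x * U x" for x using S by (simp add: U_def S_def)
      have m: "bbm_symbol \<alpha> \<xi> = \<i> * of_real \<xi> / (S \<xi> * S \<xi>)" by (simp add: bbm_symbol_eq S(2))
      have "cnj (h \<xi>) * bil_fun \<alpha> \<sigma> V V \<xi> = (\<i> * of_real \<xi> * cnj (U \<xi>) * c \<xi>) *
          convolution (\<lambda>\<eta>. h \<eta> / of_real (wt \<alpha> \<sigma> \<eta>)) (\<lambda>\<eta>. h \<eta> / of_real (wt \<alpha> \<sigma> \<eta>)) \<xi>"
        unfolding bil_fun_def conv w m using S(1)[of \<xi>] by (simp add: hS S_def)
      also have "\<dots> = (LINT \<eta>|lborel. (\<i> * of_real \<xi> * cnj (U \<xi>) * c \<xi>) * (h \<eta> / of_real (wt \<alpha> \<sigma> \<eta>) * (h (\<xi> - \<eta>) / of_real (wt \<alpha> \<sigma> (\<xi> - \<eta>)))))"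
        unfolding convolution_def by (rule integral_mult_right_zero[symmetric])
      also have "\<dots> = (LINT \<eta>|lborel. \<i> * (X (\<xi>, \<eta>) + Z (\<xi>, \<eta>)))"
      proof (rule Bochner_Integration.integral_cong[OF refl])
        fix \<eta>
        have "cosh (\<sigma> * \<xi>) / (cosh (\<sigma> * \<eta>) * cosh (\<sigma> * (\<xi> - \<eta>))) = 1 + t \<eta> * t (\<xi> - \<eta>)"
          using cosh_quotient[of "\<sigma> * \<eta>" "\<sigma> * (\<xi> - \<eta>)"] by (simp add: t_def algebra_simps)
        then have cc: "c \<xi> / (c \<eta> * c (\<xi> - \<eta>)) = 1 + of_real (t \<eta> * t (\<xi> - \<eta>))"
          unfolding c_def by (simp flip: of_real_mult of_real_divide)
        have "(\<i> * of_real \<xi> * cnj (U \<xi>) * c \<xi>) * (h \<eta> / of_real (wt \<alpha> \<sigma> \<eta>) * (h (\<xi> - \<eta>) / of_real (wt \<alpha> \<sigma> (\<xi> - \<eta>))))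
          = \<i> * ((c \<xi> / (c \<eta> * c (\<xi> - \<eta>))) * X (\<xi>, \<eta>))"
          unfolding w hS X_def using S(1) by simp
        then show "(\<i> * of_real \<xi> * cnj (U \<xi>) * c \<xi>) * (h \<eta> / of_real (wt \<alpha> \<sigma> \<eta>) * (h (\<xi> - \<eta>) / of_real (wt \<alpha> \<sigma> (\<xi> - \<eta>))))
          = \<i> * (X (\<xi>, \<eta>) + Z (\<xi>, \<eta>))"
          unfolding cc by (simp add: Z_def algebra_simps)
      qed
      also have "\<dots> = \<i> * (LINT \<eta>|lborel. X (\<xi>, \<eta>) + Z (\<xi>, \<eta>))" by (rule integral_mult_right_zero)
      finally show ?thesis .
    qed
    have "inner V (bil \<alpha> \<sigma> V V) = Re (LINT \<xi>|lborel. fn V \<xi> * cnj (fn (bil \<alpha> \<sigma> V V) \<xi>))"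
      by (simp add: inner_ltwo_def)
    also have "(LINT \<xi>|lborel. fn V \<xi> * cnj (fn (bil \<alpha> \<sigma> V V) \<xi>)) = (LINT \<xi>|lborel. cnj (cnj (h \<xi>) * bil_fun \<alpha> \<sigma> V V \<xi>))"
    proof (rule integral_cong_AE)
      show "AE \<xi> in lborel. fn V \<xi> * cnj (fn (bil \<alpha> \<sigma> V V) \<xi>) = cnj (cnj (h \<xi>) * bil_fun \<alpha> \<sigma> V V \<xi>)"
        using hV fn_bil[OF \<alpha>, of \<sigma> V V] by eventually_elim simp
    qed measurable
    also have "\<dots> = cnj (LINT \<xi>|lborel. cnj (h \<xi>) * bil_fun \<alpha> \<sigma> V V \<xi>)"
      by (simp del: complex_cnj_mult)
    also have "(LINT \<xi>|lborel. cnj (h \<xi>) * bil_fun \<alpha> \<sigma> V V \<xi>) = \<i> * (LINT \<xi>|lborel. LINT \<eta>|lborel. X (\<xi>, \<eta>) + Z (\<xi>, \<eta>))"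
      unfolding pt by (rule integral_mult_right_zero)
    also have "(LINT \<xi>|lborel. LINT \<eta>|lborel. X (\<xi>, \<eta>) + Z (\<xi>, \<eta>)) = integral\<^sup>L (lborel \<Otimes>\<^sub>M lborel) (\<lambda>p. X p + Z p)"
      by (rule lborel_pair.integral_fst') (rule Bochner_Integration.integrable_add[OF Xint Zint])
    also have "\<dots> = integral\<^sup>L (lborel \<Otimes>\<^sub>M lborel) Z"
      using Bochner_Integration.integral_add[OF Xint Zint] X0 by simp
    finally have "inner V (bil \<alpha> \<sigma> V V) = Re (cnj (\<i> * integral\<^sup>L (lborel \<Otimes>\<^sub>M lborel) Z))" .
    then have "\<bar>inner V (bil \<alpha> \<sigma> V V)\<bar> \<le> cmod (cnj (\<i> * integral\<^sup>L (lborel \<Otimes>\<^sub>M lborel) Z))"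
      by (simp only: abs_Re_le_cmod)
    also have "\<dots> = cmod (integral\<^sup>L (lborel \<Otimes>\<^sub>M lborel) Z)" by (simp add: norm_mult)
    finally show ?thesis using Zn by simp
  qed
  show thesis
  proof (rule that[of "C / (4 * pi)"])
    fix \<sigma> :: real and V assume \<sigma>: "0 \<le> \<sigma>" and V: "herm V = V"
    have "inner V (bbm_field \<alpha> \<sigma> V) = - (1 / (4 * pi)) * inner V (bil \<alpha> \<sigma> V V)"
      using \<alpha> by (simp add: bbm_field_def inner_diff_right inner_mult_op_bbm)
    also have "\<dots> \<le> (1 / (4 * pi)) * \<bar>inner V (bil \<alpha> \<sigma> V V)\<bar>"
    proof -
      have "(1 / (4 * pi)) * (- inner V (bil \<alpha> \<sigma> V V)) \<le> (1 / (4 * pi)) * \<bar>inner V (bil \<alpha> \<sigma> V V)\<bar>"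
        by (rule mult_left_mono) (simp_all add: abs_ge_minus_self)
      then show ?thesis by simp
    qed
    also have "\<dots> \<le> (1 / (4 * pi)) * (C * \<sigma> powr (1 / decay_exponent \<alpha>) * norm V ^ 3)"
      by (intro mult_left_mono key \<sigma> V) simp
    finally show "inner V (bbm_field \<alpha> \<sigma> V) \<le> C / (4 * pi) * \<sigma> powr (1 / decay_exponent \<alpha>) * norm V ^ 3"
      by simp
  qed (use C(1) in simp)
qed

subsection \<open>Solutions on the Fourier side\<close>

text \<open>D depends on \<alpha> only, and V is chosen before T. For sigma = 0 the condition on T
  reads 0 <= 1, because 0 \<open>powr\<close> any exponent is 0; that case yields one solution that
  is bounded for all times.\<close>

lemma bbm_ode_solution:
  assumes \<alpha>: "1 < \<alpha>"
  obtains D where "D \<ge> 0" "\<And>\<sigma> r V0. 0 \<le> \<sigma> \<Longrightarrow> 0 < r \<Longrightarrow> norm V0 \<le> r / 2 \<Longrightarrow> herm V0 = V0 \<Longrightarrow>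
    \<exists>V. continuous_on {0..} V \<and> (\<forall>T\<ge>0. 8 * T * (D * \<sigma> powr (1 / decay_exponent \<alpha>)) * r \<le> 1 \<longrightarrow>
      (\<forall>t\<in>{0..T}. norm (V t) \<le> r \<and> V t = V0 + integral {0..t} (\<lambda>s. bbm_field \<alpha> \<sigma> (V s))))"
proof -
  obtain D where D: "D \<ge> 0" "\<And>\<sigma> V. 0 \<le> \<sigma> \<Longrightarrow> herm V = V \<Longrightarrow>
    inner V (bbm_field \<alpha> \<sigma> V) \<le> D * \<sigma> powr (1 / decay_exponent \<alpha>) * norm V ^ 3"
    using bbm_energy[OF \<alpha>] by metis
  obtain B where B: "B \<ge> 0" "\<And>\<sigma> r (V :: ltwo) W. norm V \<le> r \<Longrightarrow> norm W \<le> r \<Longrightarrow>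
    norm (bbm_field \<alpha> \<sigma> V - bbm_field \<alpha> \<sigma> W) \<le> (1 + B * r) * norm (V - W)"
    using bbm_field_lipschitz[OF \<alpha>] by metis
  show thesis
  proof (rule that[OF D(1)])
    fix \<sigma> r :: real and V0 assume \<sigma>: "0 \<le> \<sigma>" and r: "0 < r" and V0: "norm V0 \<le> r / 2" "herm V0 = V0"
    have D0: "D * \<sigma> powr (1 / decay_exponent \<alpha>) \<ge> 0" using D(1) by simp
    have L: "0 < 1 + B * r" using B(1) r by (simp add: add_pos_nonneg)
    show "\<exists>V. continuous_on {0..} V \<and> (\<forall>T\<ge>0. 8 * T * (D * \<sigma> powr (1 / decay_exponent \<alpha>)) * r \<le> 1 \<longrightarrow>
      (\<forall>t\<in>{0..T}. norm (V t) \<le> r \<and> V t = V0 + integral {0..t} (\<lambda>s. bbm_field \<alpha> \<sigma> (V s))))"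
    proof (rule energy_ode_solution[OF L r D0 B(2) bounded_linear_herm norm_herm bbm_field_herm[OF \<alpha>] D(2)[OF \<sigma>] V0])
      fix V :: "real \<Rightarrow> ltwo"
      assume "continuous_on {0..} V"
        "\<And>T t. T \<ge> 0 \<Longrightarrow> 8 * T * (D * \<sigma> powr (1 / decay_exponent \<alpha>)) * r \<le> 1 \<Longrightarrow> t \<in> {0..T} \<Longrightarrow> norm (V t) \<le> r"
        "\<And>T t. T \<ge> 0 \<Longrightarrow> 8 * T * (D * \<sigma> powr (1 / decay_exponent \<alpha>)) * r \<le> 1 \<Longrightarrow> t \<in> {0..T} \<Longrightarrow>
          V t = V0 + integral {0..t} (\<lambda>s. bbm_field \<alpha> \<sigma> (V s))"
      then show ?thesis by (intro exI[of _ V] conjI allI impI ballI)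
    qed
  qed
qed

lemma continuous_on_bbm_field:
  assumes \<alpha>: "1 < \<alpha>" and V: "continuous_on S V" and r: "\<And>t. t \<in> S \<Longrightarrow> norm (V t) \<le> r"
  shows "continuous_on S (\<lambda>t. bbm_field \<alpha> \<sigma> (V t))"
proof -
  obtain B where B: "B \<ge> 0" "\<And>\<sigma> r (V :: ltwo) W. norm V \<le> r \<Longrightarrow> norm W \<le> r \<Longrightarrow>
    norm (bbm_field \<alpha> \<sigma> V - bbm_field \<alpha> \<sigma> W) \<le> (1 + B * r) * norm (V - W)"
    using bbm_field_lipschitz[OF \<alpha>] by metis
  show ?thesis
    unfolding continuous_on_def
  proof
    fix t assume t: "t \<in> S"
    have "((\<lambda>s. (1 + B * r) * norm (V s - V t)) \<longlongrightarrow> (1 + B * r) * norm (V t - V t)) (at t within S)"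
      using V t by (intro tendsto_intros) (auto simp: continuous_on_def)
    then have lim: "((\<lambda>s. (1 + B * r) * norm (V s - V t)) \<longlongrightarrow> 0) (at t within S)" by simp
    have "\<forall>\<^sub>F s in at t within S. norm (bbm_field \<alpha> \<sigma> (V s) - bbm_field \<alpha> \<sigma> (V t)) \<le> (1 + B * r) * norm (V s - V t)"
      unfolding eventually_at_filter using B(2) r t by (auto intro!: always_eventually)
    from Lim_null_comparison[OF this lim]
    show "((\<lambda>t. bbm_field \<alpha> \<sigma> (V t)) \<longlongrightarrow> bbm_field \<alpha> \<sigma> (V t)) (at t within S)"
      by (simp add: LIM_zero_iff)
  qed
qed

section \<open>Comparison of solutions for different weights\<close>

definition cosh_inv :: "real \<Rightarrow> real \<Rightarrow> complex" where
  "cosh_inv \<sigma> \<xi> = of_real (1 / cosh (\<sigma> * \<xi>))"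

lemma cosh_inv_measurable [measurable]: "cosh_inv \<sigma> \<in> borel_measurable borel"
  unfolding cosh_inv_def by measurable

lemma cmod_cosh_inv_le: "cmod (cosh_inv \<sigma> \<xi>) \<le> 1"
  using cosh_real_ge_1[of "\<sigma> * \<xi>"] by (simp add: cosh_inv_def norm_divide)

lemmas cosh_inv_bounds = cosh_inv_measurable cmod_cosh_inv_le

lemma unweight_cosh_inv: "AE \<xi> in lborel. unweight \<alpha> 0 (mult_op (cosh_inv \<sigma>) V) \<xi> = unweight \<alpha> \<sigma> V \<xi>"
  using fn_mult_op[OF cosh_inv_bounds, of \<sigma> V]
proof eventually_elim
  case (elim \<xi>)
  show ?case unfolding unweight_def elim by (simp add: cosh_inv_def wt_def)
qed

text \<open>Multiplication by 1 / cosh changes the weight from sigma to 0 and leaves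
  \<open>unweight\<close> unchanged almost everywhere. The convolution is therefore the same, and
  its outer weight changes by the same factor 1 / cosh.\<close>

lemma bbm_field_cosh_inv:
  assumes \<alpha>: "1 < \<alpha>"
  shows "mult_op (cosh_inv \<sigma>) (bbm_field \<alpha> \<sigma> V) = bbm_field \<alpha> 0 (mult_op (cosh_inv \<sigma>) V)"
proof -
  note b = bbm_symbol_measurable[of \<alpha>] cmod_bbm_symbol_le[OF less_imp_le[OF \<alpha>]]
  interpret Q: bounded_linear "mult_op (cosh_inv \<sigma>)" by (rule bounded_linear_mult_op[OF cosh_inv_bounds])
  have "mult_op (cosh_inv \<sigma>) (mult_op (bbm_symbol \<alpha>) V) = mult_op (bbm_symbol \<alpha>) (mult_op (cosh_inv \<sigma>) V)"
    by (simp add: mult_op_mult_op[OF cosh_inv_bounds b] mult_op_mult_op[OF b cosh_inv_bounds] mult.commute)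
  moreover have "mult_op (cosh_inv \<sigma>) (bil \<alpha> \<sigma> V V) = bil \<alpha> 0 (mult_op (cosh_inv \<sigma>) V) (mult_op (cosh_inv \<sigma>) V)"
  proof -
    have c: "convolution (unweight \<alpha> 0 (mult_op (cosh_inv \<sigma>) V)) (unweight \<alpha> 0 (mult_op (cosh_inv \<sigma>) V))
      = convolution (unweight \<alpha> \<sigma> V) (unweight \<alpha> \<sigma> V)"
      by (rule convolution_cong_AE[OF unweight_cosh_inv unweight_cosh_inv]) measurable
    have "bil_fun \<alpha> 0 (mult_op (cosh_inv \<sigma>) V) (mult_op (cosh_inv \<sigma>) V) = (\<lambda>\<xi>. cosh_inv \<sigma> \<xi> * bil_fun \<alpha> \<sigma> V V \<xi>)"
      by (simp add: fun_eq_iff bil_fun_def c cosh_inv_def wt_def)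
    then show ?thesis
      by (simp add: bil_def mult_op_lt[OF cosh_inv_bounds bil_fun_L2[OF \<alpha>]])
  qed
  ultimately show ?thesis
    by (simp add: bbm_field_def Q.diff Q.neg Q.scaleR)
qed

text \<open>After multiplication by 1 / cosh the solution W satisfies the equation of V with the
  same datum. This factor does not increase the norm, so both curves stay in the ball on which the
  field is Lipschitz, and uniqueness applies.\<close>

lemma bbm_solution_regularity:
  fixes V W :: "real \<Rightarrow> ltwo"
  assumes \<alpha>: "1 < \<alpha>" and T: "0 \<le> T" and r: "0 < r"
    and V: "continuous_on {0..T} V" "\<And>t. t \<in> {0..T} \<Longrightarrow> norm (V t) \<le> r"
      "\<And>t. t \<in> {0..T} \<Longrightarrow> V t = V0 + integral {0..t} (\<lambda>s. bbm_field \<alpha> 0 (V s))"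
    and W: "continuous_on {0..T} W" "\<And>t. t \<in> {0..T} \<Longrightarrow> norm (W t) \<le> r"
      "\<And>t. t \<in> {0..T} \<Longrightarrow> W t = W0 + integral {0..t} (\<lambda>s. bbm_field \<alpha> \<sigma> (W s))"
    and W0: "mult_op (cosh_inv \<sigma>) W0 = V0" and t: "t \<in> {0..T}"
  shows "mult_op (cosh_inv \<sigma>) (W t) = V t"
proof -
  obtain B where B: "B \<ge> 0" "\<And>\<sigma> r (V :: ltwo) W. norm V \<le> r \<Longrightarrow> norm W \<le> r \<Longrightarrow>
    norm (bbm_field \<alpha> \<sigma> V - bbm_field \<alpha> \<sigma> W) \<le> (1 + B * r) * norm (V - W)"
    using bbm_field_lipschitz[OF \<alpha>] by metis
  interpret Q: bounded_linear "mult_op (cosh_inv \<sigma>)" by (rule bounded_linear_mult_op[OF cosh_inv_bounds])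
  have QW: "norm (mult_op (cosh_inv \<sigma>) (W t)) \<le> r" if "t \<in> {0..T}" for t
    using norm_mult_op_le[OF cosh_inv_bounds, of \<sigma> "W t"] W(2)[OF that] by simp
  have cW: "continuous_on {0..T} (\<lambda>t. bbm_field \<alpha> \<sigma> (W t))"
    by (rule continuous_on_bbm_field[OF \<alpha> W(1,2)])
  have cQW: "continuous_on {0..T} (\<lambda>t. mult_op (cosh_inv \<sigma>) (W t))"
    by (rule Q.continuous_on[OF W(1)])
  show ?thesis
  proof (rule ode_unique[where L = "1 + B * r" and T = T
        and f = "\<lambda>t. bbm_field \<alpha> 0 (mult_op (cosh_inv \<sigma>) (W t))" and g = "\<lambda>t. bbm_field \<alpha> 0 (V t)"
        and x = "\<lambda>t::real. mult_op (cosh_inv \<sigma>) (W t)" and y = V])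
    show "0 < 1 + B * r" using B(1) r by (simp add: add_pos_nonneg)
    show "continuous_on {0..T} (\<lambda>t. bbm_field \<alpha> 0 (mult_op (cosh_inv \<sigma>) (W t)))"
      by (rule continuous_on_bbm_field[OF \<alpha> cQW QW])
    show "continuous_on {0..T} (\<lambda>t. bbm_field \<alpha> 0 (V t))"
      by (rule continuous_on_bbm_field[OF \<alpha> V(1,2)])
    show "norm (bbm_field \<alpha> 0 (mult_op (cosh_inv \<sigma>) (W s)) - bbm_field \<alpha> 0 (V s)) \<le> (1 + B * r) * norm (mult_op (cosh_inv \<sigma>) (W s) - V s)"
      if "s \<in> {0..T}" for s
      by (rule B(2)[OF QW[OF that] V(2)[OF that]])
    show "mult_op (cosh_inv \<sigma>) (W s) = V0 + integral {0..s} (\<lambda>t. bbm_field \<alpha> 0 (mult_op (cosh_inv \<sigma>) (W t)))"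
      if s: "s \<in> {0..T}" for s
    proof -
      have "(\<lambda>t. bbm_field \<alpha> \<sigma> (W t)) integrable_on {0..s}"
        using s by (intro integrable_continuous_interval continuous_on_subset[OF cW]) auto
      then have "integral {0..s} (mult_op (cosh_inv \<sigma>) \<circ> (\<lambda>t. bbm_field \<alpha> \<sigma> (W t)))
        = mult_op (cosh_inv \<sigma>) (integral {0..s} (\<lambda>t. bbm_field \<alpha> \<sigma> (W t)))"
        by (rule integral_linear) (rule Q.bounded_linear_axioms)
      then show ?thesis
        by (subst W(3)[OF s]) (simp add: Q.add W0 o_def bbm_field_cosh_inv[OF \<alpha>])
    qed
  qed (use T V t cQW in auto)
qed

subsection \<open>Duhamel's formula\<close>

definition prop_symbol :: "real \<Rightarrow> real \<Rightarrow> real \<Rightarrow> complex" where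
  "prop_symbol \<alpha> t \<xi> = exp (- of_real t * bbm_symbol \<alpha> \<xi>)"

lemma prop_symbol_measurable [measurable]: "prop_symbol \<alpha> t \<in> borel_measurable borel"
  unfolding prop_symbol_def by measurable

lemma cmod_prop_symbol: "cmod (prop_symbol \<alpha> t \<xi>) = 1"
  by (simp add: prop_symbol_def bbm_symbol_eq norm_exp_eq_Re)

lemma cmod_prop_symbol_le: "cmod (prop_symbol \<alpha> t \<xi>) \<le> 1"
  by (simp add: cmod_prop_symbol)

lemmas prop_bounds = prop_symbol_measurable cmod_prop_symbol_le

text \<open>The symbol is imaginary and at most 1 in modulus, so the second-order remainder of the
  exponential is bounded uniformly in xi. Uniformity is what makes the group differentiable in
  operator norm.\<close>

lemma prop_symbol_taylor:
  assumes "1 \<le> \<alpha>"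
  shows "cmod (prop_symbol \<alpha> y \<xi> - prop_symbol \<alpha> x \<xi> + of_real (y - x) * (bbm_symbol \<alpha> \<xi> * prop_symbol \<alpha> x \<xi>)) \<le> (y - x)\<^sup>2"
proof -
  define z where "z = - (y - x) * (\<xi> / sob \<alpha> \<xi>)"
  have b: "- of_real (y - x) * bbm_symbol \<alpha> \<xi> = \<i> * of_real z" by (simp add: bbm_symbol_eq z_def)
  have "prop_symbol \<alpha> y \<xi> = prop_symbol \<alpha> x \<xi> * exp (- of_real (y - x) * bbm_symbol \<alpha> \<xi>)"
    by (simp add: prop_symbol_def algebra_simps flip: exp_add)
  then have "prop_symbol \<alpha> y \<xi> - prop_symbol \<alpha> x \<xi> + of_real (y - x) * (bbm_symbol \<alpha> \<xi> * prop_symbol \<alpha> x \<xi>)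
    = prop_symbol \<alpha> x \<xi> * (exp (\<i> * of_real z) - 1 - \<i> * of_real z)"
    unfolding b[symmetric] by (simp add: algebra_simps)
  then have "cmod (prop_symbol \<alpha> y \<xi> - prop_symbol \<alpha> x \<xi> + of_real (y - x) * (bbm_symbol \<alpha> \<xi> * prop_symbol \<alpha> x \<xi>))
    = cmod (exp (\<i> * of_real z) - 1 - \<i> * of_real z)"
    by (simp only: norm_mult cmod_prop_symbol mult_1_left)
  also have "\<dots> = cmod (iexp z - (\<Sum>k\<le>1. (\<i> * z) ^ k / fact k))"
    by (simp add: algebra_simps)
  also have "\<dots> \<le> \<bar>z\<bar> ^ Suc 1 / fact (Suc 1)" by (rule iexp_approx1)
  also have "\<dots> \<le> z\<^sup>2" by (simp add: power2_eq_square)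
  also have "\<dots> \<le> (y - x)\<^sup>2 * 1"
    unfolding z_def power_mult_distrib
  proof (rule mult_mono)
    have "\<bar>\<xi> / sob \<alpha> \<xi>\<bar> \<le> 1" using cmod_bbm_symbol_le[OF assms, of \<xi>] by (simp add: cmod_bbm_symbol)
    then show "(\<xi> / sob \<alpha> \<xi>)\<^sup>2 \<le> 1" by (simp add: abs_square_le_1)
  qed (auto simp: power2_commute)
  finally show ?thesis by simp
qed

lemma mult_op_add_symbol:
  assumes "g \<in> borel_measurable borel" "\<And>x. cmod (g x) \<le> c" "h \<in> borel_measurable borel" "\<And>x. cmod (h x) \<le> d"
  shows "mult_op (\<lambda>x. g x + h x) V = mult_op g V + mult_op h V"
proof -
  note [measurable] = assms(1,3)
  have gh: "AE x in lborel. fn (mult_op (\<lambda>x. g x + h x) V) x = (g x + h x) * fn V x"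
    by (rule fn_mult_op[of _ "c + d"]) (measurable, rule norm_triangle_mono[OF assms(2,4)])
  show ?thesis
    by (rule ltwo_eqI) (use gh fn_mult_op[OF assms(1,2), of V] fn_mult_op[OF assms(3,4), of V] fn_add[of "mult_op g V" "mult_op h V"]
      in eventually_elim, simp add: algebra_simps)
qed

lemma mult_op_scaleR_symbol:
  assumes "g \<in> borel_measurable borel" "\<And>x. cmod (g x) \<le> c"
  shows "mult_op (\<lambda>x. of_real k * g x) V = k *\<^sub>R mult_op g V"
proof -
  note [measurable] = assms(1)
  have gh: "AE x in lborel. fn (mult_op (\<lambda>x. of_real k * g x) V) x = (of_real k * g x) * fn V x"
    by (rule fn_mult_op[of _ "\<bar>k\<bar> * c"]) (auto simp: norm_mult assms(2) intro!: mult_left_mono)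
  show ?thesis
    by (rule ltwo_eqI) (use gh fn_mult_op[OF assms, of V] fn_scaleR[of k "mult_op g V"]
      in eventually_elim, simp add: scaleR_conv_of_real)
qed

text \<open>Packaged as bounded operators, so that the product rule for operator application can be
  used in \<open>duhamel\<close>.\<close>

definition prop_op :: "real \<Rightarrow> real \<Rightarrow> ltwo \<Rightarrow>\<^sub>L ltwo" where
  "prop_op \<alpha> t = Blinfun (mult_op (prop_symbol \<alpha> t))"

lemma prop_op_apply: "blinfun_apply (prop_op \<alpha> t) = mult_op (prop_symbol \<alpha> t)"
  unfolding prop_op_def by (rule bounded_linear_Blinfun_apply) (rule bounded_linear_mult_op[OF prop_bounds])

lemma prop_op_derivative:
  assumes \<alpha>: "1 \<le> \<alpha>"
  shows "(prop_op \<alpha> has_vector_derivative - (prop_op \<alpha> x o\<^sub>L Blinfun (mult_op (bbm_symbol \<alpha>)))) (at x within S)"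
  unfolding has_vector_derivative_def
proof (rule has_derivativeI_sandwich[of 1])
  note b = bbm_symbol_measurable[of \<alpha>] cmod_bbm_symbol_le[OF \<alpha>]
  have bl: "blinfun_apply (Blinfun (mult_op (bbm_symbol \<alpha>))) = mult_op (bbm_symbol \<alpha>)"
    by (rule bounded_linear_Blinfun_apply) (rule bounded_linear_mult_op[OF b])
  show "bounded_linear (\<lambda>h. h *\<^sub>R - (prop_op \<alpha> x o\<^sub>L Blinfun (mult_op (bbm_symbol \<alpha>))))"
    by (rule bounded_linear_scaleR_left)
  fix y assume "y \<noteq> x"
  have "norm (prop_op \<alpha> y - prop_op \<alpha> x - (y - x) *\<^sub>R - (prop_op \<alpha> x o\<^sub>L Blinfun (mult_op (bbm_symbol \<alpha>)))) \<le> (y - x)\<^sup>2"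
  proof (rule norm_blinfun_bound)
    fix V
    have bp: "(\<lambda>\<xi>. bbm_symbol \<alpha> \<xi> * prop_symbol \<alpha> x \<xi>) \<in> borel_measurable borel" by measurable
    have bp1: "cmod (bbm_symbol \<alpha> \<xi> * prop_symbol \<alpha> x \<xi>) \<le> 1" for \<xi>
      using b(2) by (simp add: norm_mult cmod_prop_symbol)
    define g where "g \<xi> = prop_symbol \<alpha> y \<xi> + (of_real (-1) * prop_symbol \<alpha> x \<xi> + of_real (y - x) * (bbm_symbol \<alpha> \<xi> * prop_symbol \<alpha> x \<xi>))" for \<xi>
    have mp: "mult_op (prop_symbol \<alpha> x) (mult_op (bbm_symbol \<alpha>) V) = mult_op (\<lambda>\<xi>. bbm_symbol \<alpha> \<xi> * prop_symbol \<alpha> x \<xi>) V"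
      by (simp add: mult_op_mult_op[OF prop_bounds b] mult.commute)
    have "mult_op g V = mult_op (prop_symbol \<alpha> y) V + ((-1) *\<^sub>R mult_op (prop_symbol \<alpha> x) V
        + (y - x) *\<^sub>R mult_op (\<lambda>\<xi>. bbm_symbol \<alpha> \<xi> * prop_symbol \<alpha> x \<xi>) V)"
    proof -
      have 1: "cmod (of_real (-1) * prop_symbol \<alpha> x \<xi>) \<le> 1" for \<xi> by (simp add: cmod_prop_symbol)
      have 2: "cmod (of_real (y - x) * (bbm_symbol \<alpha> \<xi> * prop_symbol \<alpha> x \<xi>)) \<le> \<bar>y - x\<bar> * 1" for \<xi>
        unfolding norm_mult[of "of_real (y - x)"] norm_of_real by (rule mult_left_mono[OF bp1]) simp
      have 3: "cmod (of_real (-1) * prop_symbol \<alpha> x \<xi> + of_real (y - x) * (bbm_symbol \<alpha> \<xi> * prop_symbol \<alpha> x \<xi>)) \<le> 1 + \<bar>y - x\<bar> * 1" for \<xi>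
        by (rule norm_triangle_mono[OF 1 2])
      have m1: "(\<lambda>\<xi>. of_real (-1) * prop_symbol \<alpha> x \<xi>) \<in> borel_measurable borel" by measurable
      have m2: "(\<lambda>\<xi>. of_real (y - x) * (bbm_symbol \<alpha> \<xi> * prop_symbol \<alpha> x \<xi>)) \<in> borel_measurable borel" by measurable
      have m3: "(\<lambda>\<xi>. of_real (-1) * prop_symbol \<alpha> x \<xi> + of_real (y - x) * (bbm_symbol \<alpha> \<xi> * prop_symbol \<alpha> x \<xi>)) \<in> borel_measurable borel" by measurable
      show ?thesis
        unfolding g_def mult_op_add_symbol[OF prop_bounds m3 3] mult_op_add_symbol[OF m1 1 m2 2]
          mult_op_scaleR_symbol[OF prop_bounds] mult_op_scaleR_symbol[OF bp bp1] ..
    qed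
    then have "blinfun_apply (prop_op \<alpha> y - prop_op \<alpha> x - (y - x) *\<^sub>R - (prop_op \<alpha> x o\<^sub>L Blinfun (mult_op (bbm_symbol \<alpha>)))) V = mult_op g V"
      by (simp add: blinfun.diff_left blinfun.add_left blinfun.scaleR_left blinfun.minus_left prop_op_apply bl mp algebra_simps)
    also have "norm (mult_op g V) \<le> (y - x)\<^sup>2 * norm V"
    proof (rule norm_mult_op_le)
      show "g \<in> borel_measurable borel" unfolding g_def by measurable
      show "cmod (g \<xi>) \<le> (y - x)\<^sup>2" for \<xi>
        using prop_symbol_taylor[OF \<alpha>, of y \<xi> x] by (simp add: g_def algebra_simps)
    qed
    finally show "norm (blinfun_apply (prop_op \<alpha> y - prop_op \<alpha> x - (y - x) *\<^sub>R - (prop_op \<alpha> x o\<^sub>L Blinfun (mult_op (bbm_symbol \<alpha>)))) V) \<le> (y - x)\<^sup>2 * norm V" .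
  qed simp
  then have "norm (prop_op \<alpha> y - prop_op \<alpha> x - (y - x) *\<^sub>R - (prop_op \<alpha> x o\<^sub>L Blinfun (mult_op (bbm_symbol \<alpha>)))) / norm (y - x) \<le> (y - x)\<^sup>2 / norm (y - x)"
    by (rule divide_right_mono) simp
  also have "\<dots> = \<bar>y - x\<bar>"
  proof -
    have e: "(y - x)\<^sup>2 = \<bar>y - x\<bar> * \<bar>y - x\<bar>" by (simp add: power2_eq_square)
    show ?thesis
      unfolding e real_norm_def by (rule nonzero_mult_div_cancel_right) (use \<open>y \<noteq> x\<close> in simp)
  qed
  finally show "norm (prop_op \<alpha> y - prop_op \<alpha> x - (y - x) *\<^sub>R - (prop_op \<alpha> x o\<^sub>L Blinfun (mult_op (bbm_symbol \<alpha>)))) / norm (y - x) \<le> \<bar>y - x\<bar>" .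
next
  have "((\<lambda>y. \<bar>y - x\<bar>) \<longlongrightarrow> \<bar>x - x\<bar>) (at x within S)" by (intro tendsto_intros)
  then show "((\<lambda>y. \<bar>y - x\<bar>) \<longlongrightarrow> 0) (at x within S)" by simp
qed simp

text \<open>In the derivative of the propagator over t - \<tau> applied to V \<tau>, the linear part
  of the field cancels. Only the quadratic part is left for the fundamental theorem, and - 4 pi
  undoes its coefficient.\<close>

lemma duhamel:
  fixes V :: "real \<Rightarrow> ltwo"
  assumes \<alpha>: "1 < \<alpha>" and t: "0 \<le> t"
    and cF: "continuous_on {0..t} (\<lambda>s. bbm_field \<alpha> 0 (V s))"
    and V: "\<And>s. s \<in> {0..t} \<Longrightarrow> V s = V0 + integral {0..s} (\<lambda>s. bbm_field \<alpha> 0 (V s))"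
  shows "((\<lambda>\<tau>. mult_op (prop_symbol \<alpha> (t - \<tau>)) (bil \<alpha> 0 (V \<tau>) (V \<tau>))) has_integral
    (- (4 * pi)) *\<^sub>R (V t - mult_op (prop_symbol \<alpha> t) V0)) {0..t}"
proof -
  note b = bbm_symbol_measurable[of \<alpha>] cmod_bbm_symbol_le[OF less_imp_le[OF \<alpha>]]
  have bl: "blinfun_apply (Blinfun (mult_op (bbm_symbol \<alpha>))) = mult_op (bbm_symbol \<alpha>)"
    by (rule bounded_linear_Blinfun_apply) (rule bounded_linear_mult_op[OF b])
  define \<phi> where "\<phi> \<tau> = blinfun_apply (prop_op \<alpha> (t - \<tau>)) (V \<tau>)" for \<tau>
  have "(\<phi> has_vector_derivative (- (1 / (4 * pi))) *\<^sub>R mult_op (prop_symbol \<alpha> (t - \<tau>)) (bil \<alpha> 0 (V \<tau>) (V \<tau>))) (at \<tau> within {0..t})"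
    if \<tau>: "\<tau> \<in> {0..t}" for \<tau>
  proof -
    have "((\<lambda>s. V0 + integral {0..s} (\<lambda>s. bbm_field \<alpha> 0 (V s))) has_vector_derivative (0 + bbm_field \<alpha> 0 (V \<tau>))) (at \<tau> within {0..t})"
      by (intro has_vector_derivative_add has_vector_derivative_const integral_has_vector_derivative cF \<tau>)
    then have *: "((\<lambda>s. V0 + integral {0..s} (\<lambda>s. bbm_field \<alpha> 0 (V s))) has_vector_derivative bbm_field \<alpha> 0 (V \<tau>)) (at \<tau> within {0..t})"
      by simp
    have dV: "(V has_vector_derivative bbm_field \<alpha> 0 (V \<tau>)) (at \<tau> within {0..t})"
      by (rule has_vector_derivative_transform[OF \<tau> _ *]) (rule V)
    have "((\<lambda>\<tau>. t - \<tau>) has_vector_derivative (- 1)) (at \<tau> within {0..t})"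
      by (auto intro!: derivative_eq_intros simp flip: has_real_derivative_iff_has_vector_derivative)
    from vector_diff_chain_within[OF this prop_op_derivative[OF less_imp_le[OF \<alpha>]]]
    have dE: "((\<lambda>\<tau>. prop_op \<alpha> (t - \<tau>)) has_vector_derivative (prop_op \<alpha> (t - \<tau>) o\<^sub>L Blinfun (mult_op (bbm_symbol \<alpha>)))) (at \<tau> within {0..t})"
      by (simp add: o_def)
    have "(\<phi> has_vector_derivative (blinfun_apply (prop_op \<alpha> (t - \<tau>)) (bbm_field \<alpha> 0 (V \<tau>))
        + blinfun_apply (prop_op \<alpha> (t - \<tau>) o\<^sub>L Blinfun (mult_op (bbm_symbol \<alpha>))) (V \<tau>))) (at \<tau> within {0..t})"
      unfolding \<phi>_def by (rule bounded_bilinear.has_vector_derivative[OF bounded_bilinear_blinfun_apply dE dV])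
    also have "blinfun_apply (prop_op \<alpha> (t - \<tau>)) (bbm_field \<alpha> 0 (V \<tau>)) + blinfun_apply (prop_op \<alpha> (t - \<tau>) o\<^sub>L Blinfun (mult_op (bbm_symbol \<alpha>))) (V \<tau>)
      = blinfun_apply (prop_op \<alpha> (t - \<tau>)) (bbm_field \<alpha> 0 (V \<tau>) + mult_op (bbm_symbol \<alpha>) (V \<tau>))"
      by (simp add: bl blinfun.add_right)
    also have "\<dots> = (- (1 / (4 * pi))) *\<^sub>R blinfun_apply (prop_op \<alpha> (t - \<tau>)) (bil \<alpha> 0 (V \<tau>) (V \<tau>))"
      by (simp add: bbm_field_def blinfun.minus_right blinfun.scaleR_right)
    finally show ?thesis by (simp only: prop_op_apply)
  qed
  then have "((\<lambda>\<tau>. (- (1 / (4 * pi))) *\<^sub>R mult_op (prop_symbol \<alpha> (t - \<tau>)) (bil \<alpha> 0 (V \<tau>) (V \<tau>))) has_integral (\<phi> t - \<phi> 0)) {0..t}"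
    by (rule fundamental_theorem_of_calculus[OF t])
  then have "((\<lambda>\<tau>. (- (4 * pi)) *\<^sub>R (- (1 / (4 * pi))) *\<^sub>R mult_op (prop_symbol \<alpha> (t - \<tau>)) (bil \<alpha> 0 (V \<tau>) (V \<tau>))) has_integral
      (- (4 * pi)) *\<^sub>R (\<phi> t - \<phi> 0)) {0..t}"
    by (rule has_integral_cmul)
  moreover have "\<phi> 0 = mult_op (prop_symbol \<alpha> t) V0"
    using V[of 0] t by (simp add: \<phi>_def prop_op_apply)
  moreover have "\<phi> t = V t"
  proof -
    have "AE \<xi> in lborel. fn (mult_op (prop_symbol \<alpha> 0) (V t)) \<xi> = fn (V t) \<xi>"
      using fn_mult_op[OF prop_bounds, of \<alpha> 0 "V t"]
    proof eventually_elim
      case (elim \<xi>)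
      show ?case unfolding elim by (simp add: prop_symbol_def)
    qed
    then show ?thesis by (simp add: \<phi>_def prop_op_apply ltwo_eqI)
  qed
  ultimately show ?thesis by simp
qed

subsection \<open>Back to physical space\<close>

definition FTinv :: "ltwo \<Rightarrow> ltwo" where
  "FTinv V = (1 / (2 * pi)) *\<^sub>R cj (FT (cj V))"

lemma FT_FTinv [simp]: "FT (FTinv V) = V"
  unfolding FTinv_def by (rule FT_surj)

lemma FTinv_FT [simp]: "FTinv (FT V) = V"
  unfolding FTinv_def fourier_inversion by simp

lemma bounded_linear_FTinv: "bounded_linear FTinv"
  unfolding FTinv_def
  by (rule bounded_linear_compose[OF bounded_linear_scaleR_right
      bounded_linear_compose[OF bounded_linear_cj bounded_linear_compose[OF bounded_linear_FT bounded_linear_cj]]])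

text \<open>\<open>inv_fourier\<close> is a choice: surjectivity of \<open>FT\<close> guarantees
  that there is something to choose, and its injectivity determines the class of the result.\<close>

lemma lt_inv_fourier:
  assumes "g \<in> L2" shows "inv_fourier g \<in> L2" "lt (inv_fourier g) = FTinv (lt g)"
proof -
  have "is_fourier (fn (FTinv (lt g))) g" using assms by (simp add: is_fourier_iff)
  then have "is_fourier (inv_fourier g) g" unfolding inv_fourier_def by (rule someI[of "\<lambda>f. is_fourier f g"])
  then have *: "inv_fourier g \<in> L2" "FT (lt (inv_fourier g)) = lt g" by (auto simp: is_fourier_iff)
  show "inv_fourier g \<in> L2" by (rule *(1))
  show "lt (inv_fourier g) = FTinv (lt g)" unfolding *(2)[symmetric] by simp
qed

lemma lt_fourier:
  assumes "f \<in> L2" shows "fourier f \<in> L2" "lt (fourier f) = FT (lt f)"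
proof -
  have "is_fourier f (fn (FT (lt f)))" using assms by (simp add: is_fourier_iff)
  then have "is_fourier f (fourier f)" unfolding fourier_def by (rule someI[of "is_fourier f"])
  then show "fourier f \<in> L2" "lt (fourier f) = FT (lt f)" by (auto simp: is_fourier_iff)
qed

lemma lt_fourier_multiplier:
  assumes "m \<in> borel_measurable borel" "\<And>\<xi>. cmod (m \<xi>) \<le> c" "f \<in> L2"
  shows "fourier_multiplier m f \<in> L2" "lt (fourier_multiplier m f) = FTinv (mult_op m (FT (lt f)))"
proof -
  note F = lt_fourier[OF assms(3)]
  have g: "(\<lambda>\<xi>. m \<xi> * fourier f \<xi>) \<in> L2"
    by (rule mult_op_L2(1)[OF assms(1,2) F(1)])
  have m: "lt (\<lambda>\<xi>. m \<xi> * fourier f \<xi>) = mult_op m (FT (lt f))"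
    unfolding F(2)[symmetric] by (rule mult_op_lt[OF assms(1,2) F(1), symmetric])
  show "fourier_multiplier m f \<in> L2"
    unfolding fourier_multiplier_def by (rule lt_inv_fourier(1)[OF g])
  show "lt (fourier_multiplier m f) = FTinv (mult_op m (FT (lt f)))"
    unfolding fourier_multiplier_def lt_inv_fourier(2)[OF g] m ..
qed

text \<open>The \<open>ltwo\<close> norm of a Riemann sum of classes is the L^2 norm of the same sum
  of representatives, so the gauge of the integral in \<open>ltwo\<close> serves unchanged. Tags lie
  in their cells, hence in the interval where f is known to be in \<open>L2\<close>.\<close>

lemma has_L2_integralI:
  assumes f: "\<And>\<tau>. \<tau> \<in> {a..b} \<Longrightarrow> f \<tau> \<in> L2" and I: "((\<lambda>\<tau>. lt (f \<tau>)) has_integral I) {a..b}"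
  shows "has_L2_integral f (fn I) a b"
  unfolding has_L2_integral_def
proof (intro conjI ballI allI impI)
  fix e :: real assume "e > 0"
  have "\<exists>\<gamma>. gauge \<gamma> \<and> (\<forall>\<D>. \<D> tagged_division_of {a..b} \<and> \<gamma> fine \<D> \<longrightarrow>
      norm ((\<Sum>(\<tau>, k)\<in>\<D>. measure lborel k *\<^sub>R lt (f \<tau>)) - I) < e)"
    by (rule I[unfolded has_integral_real, rule_format, OF \<open>e > 0\<close>])
  then obtain \<gamma> where \<gamma>0: "gauge \<gamma> \<and> (\<forall>\<D>. \<D> tagged_division_of {a..b} \<and> \<gamma> fine \<D> \<longrightarrow>
      norm ((\<Sum>(\<tau>, k)\<in>\<D>. measure lborel k *\<^sub>R lt (f \<tau>)) - I) < e)" ..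
  note \<gamma> = conjunct1[OF \<gamma>0] conjunct2[OF \<gamma>0, rule_format, OF conjI]
  have "L2_norm (\<lambda>x. (\<Sum>(\<tau>, k)\<in>\<D>. measure lborel k *\<^sub>R f \<tau> x) - fn I x) < e"
    if D: "\<D> tagged_division_of {a..b}" "\<gamma> fine \<D>" for \<D>
  proof -
    have p: "(case p of (\<tau>, k) \<Rightarrow> f \<tau>) \<in> L2" if "p \<in> \<D>" for p
    proof -
      obtain \<tau> k where "p = (\<tau>, k)" by (cases p)
      then have "\<tau> \<in> {a..b}" using tagged_division_ofD(2,3)[OF D(1), of \<tau> k] that by auto
      then show ?thesis using f \<open>p = (\<tau>, k)\<close> by simp
    qed
    have q: "(\<lambda>x. case p of (\<tau>, k) \<Rightarrow> measure lborel k *\<^sub>R f \<tau> x) \<in> L2" if "p \<in> \<D>" for p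
      using L2_scaleR[OF p[OF that], of "case p of (\<tau>, k) \<Rightarrow> measure lborel k"] by (cases p) simp
    have "lt (\<lambda>x. (\<Sum>(\<tau>, k)\<in>\<D>. measure lborel k *\<^sub>R f \<tau> x) - fn I x)
      = (\<Sum>p\<in>\<D>. lt (\<lambda>x. case p of (\<tau>, k) \<Rightarrow> measure lborel k *\<^sub>R f \<tau> x)) - I"
      using lt_diff[OF L2_sum[OF q] fn_L2, of \<D> "\<lambda>p. p" I] lt_sum[OF q, of \<D> "\<lambda>p. p"] by simp
    also have "(\<Sum>p\<in>\<D>. lt (\<lambda>x. case p of (\<tau>, k) \<Rightarrow> measure lborel k *\<^sub>R f \<tau> x))
      = (\<Sum>(\<tau>, k)\<in>\<D>. measure lborel k *\<^sub>R lt (f \<tau>))"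
    proof (rule sum.cong[OF refl])
      fix p assume "p \<in> \<D>"
      from lt_scaleR[OF p[OF this], of "case p of (\<tau>, k) \<Rightarrow> measure lborel k"]
      show "lt (\<lambda>x. case p of (\<tau>, k) \<Rightarrow> measure lborel k *\<^sub>R f \<tau> x) = (case p of (\<tau>, k) \<Rightarrow> measure lborel k *\<^sub>R lt (f \<tau>))"
        by (cases p) simp
    qed
    finally show ?thesis
      using \<gamma>(2)[OF D] norm_lt[OF L2_diff[OF L2_sum[OF q] fn_L2], of \<D> "\<lambda>p. p" I] by simp
  qed
  then show "\<exists>\<gamma>. gauge \<gamma> \<and> (\<forall>\<D>. \<D> tagged_division_of {a..b} \<and> \<gamma> fine \<D> \<longrightarrow>
      L2_norm (\<lambda>x. (\<Sum>(\<tau>, k)\<in>\<D>. measure lborel k *\<^sub>R f \<tau> x) - fn I x) < e)"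
    by (intro exI[of _ \<gamma>] conjI \<gamma>(1) allI impI) (elim conjE)
qed (use f in auto)

text \<open>Translates real values of a function, \<open>cj V = V\<close>, into the symmetry
  \<open>herm\<close> of its transform. On truncations it is conjugation under the integral sign,
  and the limit preserves it.\<close>

lemma herm_FT: "herm (FT V) = FT (cj V)"
proof (rule tendsto_unique[OF _ bounded_linear.tendsto[OF bounded_linear_herm FT_tendsto]])
  have "fourier_integral (trunc R (fn (cj V))) = (\<lambda>\<xi>. cnj (fourier_integral (trunc R (fn V)) (- \<xi>)))" for R
  proof
    fix \<xi>
    have [measurable]: "trunc R (fn W) \<in> borel_measurable borel" for W
      using trunc_L2[OF fn_L2] by (rule L2_measurable)
    have "fourier_integral (trunc R (fn (cj V))) \<xi> = fourier_integral (\<lambda>x. cnj (trunc R (fn V) x)) \<xi>"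
      by (rule fun_cong[OF fourier_integral_cong_AE]) (use fn_cj[of V] in \<open>auto elim!: eventually_mono simp: trunc_def indicator_def\<close>)
    also have "\<dots> = (LINT x|lborel. cnj (exp (- \<i> * of_real (x * - \<xi>)) * trunc R (fn V) x))"
      unfolding fourier_integral_def by (simp add: exp_cnj)
    finally show "fourier_integral (trunc R (fn (cj V))) \<xi> = cnj (fourier_integral (trunc R (fn V)) (- \<xi>))"
      unfolding fourier_integral_def by (simp del: complex_cnj_mult)
  qed
  then have "herm (lt (fourier_integral (trunc R (fn V)))) = lt (fourier_integral (trunc R (fn (cj V))))" for R
    by (simp add: herm_lt[OF plancherel_compact_support(1)[OF trunc_L2[OF fn_L2] trunc_supp]])
  then show "((\<lambda>R. herm (lt (fourier_integral (trunc R (fn V))))) \<longlongrightarrow> FT (cj V)) at_top"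
    using FT_tendsto[of "cj V"] by simp
qed simp

section \<open>Comparison of the weight with the Gevrey norm, and the solution in physical
  space\<close>

definition wt_inv :: "real \<Rightarrow> real \<Rightarrow> real \<Rightarrow> complex" where
  "wt_inv \<alpha> \<sigma> \<xi> = of_real (1 / wt \<alpha> \<sigma> \<xi>)"

lemma wt_inv_measurable [measurable]: "wt_inv \<alpha> \<sigma> \<in> borel_measurable borel"
  unfolding wt_inv_def by measurable

lemma cmod_wt_inv_le: "cmod (wt_inv \<alpha> \<sigma> \<xi>) \<le> 1"
  using wt_ge_1[of \<alpha> \<sigma> \<xi>] by (simp add: wt_inv_def norm_divide)

lemmas wt_inv_bounds = wt_inv_measurable cmod_wt_inv_le

lemma mult_op_wt_inv: "mult_op (wt_inv \<alpha> \<sigma>) V = lt (unweight \<alpha> \<sigma> V)"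
  by (simp add: mult_op_def unweight_def[abs_def] wt_inv_def)

lemma mult_op_wt_inv_cosh_inv: "mult_op (wt_inv \<alpha> 0) (mult_op (cosh_inv \<sigma>) V) = mult_op (wt_inv \<alpha> \<sigma>) V"
  unfolding mult_op_mult_op[OF wt_inv_bounds cosh_inv_bounds]
  by (rule arg_cong[of _ _ "\<lambda>g. mult_op g V"]) (simp add: fun_eq_iff wt_inv_def cosh_inv_def wt_def)

text \<open>The factor 2^(\<alpha>/2) comes from (1 + |xi|)^\<alpha> <= 2^\<alpha> (1 +
  |xi|^\<alpha>), and the 2 from exp |x| <= 2 cosh x.\<close>

lemma gevrey_weight_le:
  assumes "0 \<le> \<alpha>" "0 \<le> \<sigma>"
  shows "(1 + \<bar>\<xi>\<bar>) powr (\<alpha> / 2) * exp (\<sigma> * \<bar>\<xi>\<bar>) \<le> (2 * 2 powr (\<alpha> / 2)) * wt \<alpha> \<sigma> \<xi>"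
proof -
  have "(1 + \<bar>\<xi>\<bar>) powr \<alpha> \<le> 2 powr \<alpha> * sob \<alpha> \<xi>"
  proof (cases "\<bar>\<xi>\<bar> \<le> 1")
    case True
    then have "(1 + \<bar>\<xi>\<bar>) powr \<alpha> \<le> 2 powr \<alpha>" using assms by (intro powr_mono2) auto
    also have "\<dots> * 1 \<le> 2 powr \<alpha> * sob \<alpha> \<xi>" by (intro mult_left_mono sob_ge_1) simp
    finally show ?thesis by simp
  next
    case False
    then have "(1 + \<bar>\<xi>\<bar>) powr \<alpha> \<le> (2 * \<bar>\<xi>\<bar>) powr \<alpha>" using assms by (intro powr_mono2) auto
    also have "\<dots> = 2 powr \<alpha> * \<bar>\<xi>\<bar> powr \<alpha>" by (simp add: powr_mult)
    also have "\<dots> \<le> 2 powr \<alpha> * sob \<alpha> \<xi>" by (intro mult_left_mono) (auto simp: sob_def)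
    finally show ?thesis .
  qed
  moreover have sq: "(x powr (\<alpha> / 2))\<^sup>2 = x powr \<alpha>" for x :: real
    by (simp add: power2_eq_square flip: powr_add)
  ultimately have "((1 + \<bar>\<xi>\<bar>) powr (\<alpha> / 2))\<^sup>2 \<le> (2 powr (\<alpha> / 2) * sqrt (sob \<alpha> \<xi>))\<^sup>2"
    by (simp add: power_mult_distrib)
  then have 1: "(1 + \<bar>\<xi>\<bar>) powr (\<alpha> / 2) \<le> 2 powr (\<alpha> / 2) * sqrt (sob \<alpha> \<xi>)"
    by (rule power2_le_imp_le) simp
  have 2: "exp (\<sigma> * \<bar>\<xi>\<bar>) \<le> 2 * cosh (\<sigma> * \<xi>)"
    using exp_ge_zero[of "\<sigma> * \<xi>"] exp_ge_zero[of "- (\<sigma> * \<xi>)"] by (cases "0 \<le> \<xi>") (auto simp: cosh_def abs_if)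
  have "(1 + \<bar>\<xi>\<bar>) powr (\<alpha> / 2) * exp (\<sigma> * \<bar>\<xi>\<bar>) \<le> (2 powr (\<alpha> / 2) * sqrt (sob \<alpha> \<xi>)) * (2 * cosh (\<sigma> * \<xi>))"
    by (intro mult_mono 1 2) auto
  then show ?thesis by (simp add: wt_def mult_ac)
qed

text \<open>The converse comparison, needed for the datum. The Sobolev part costs sqrt 2, rounded up
  to 2, and cosh costs nothing against the exponential.\<close>

lemma wt_le_gevrey_weight:
  assumes "0 \<le> \<alpha>" "0 \<le> \<sigma>" "\<sigma> \<le> \<sigma>0"
  shows "wt \<alpha> \<sigma> \<xi> \<le> 2 * ((1 + \<bar>\<xi>\<bar>) powr (\<alpha> / 2) * exp (\<sigma>0 * \<bar>\<xi>\<bar>))"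
proof -
  have sq: "((1 + \<bar>\<xi>\<bar>) powr (\<alpha> / 2))\<^sup>2 = (1 + \<bar>\<xi>\<bar>) powr \<alpha>"
    by (simp add: power2_eq_square flip: powr_add)
  have "1 \<le> (1 + \<bar>\<xi>\<bar>) powr \<alpha>" using assms by (intro ge_one_powr_ge_zero) auto
  moreover have "\<bar>\<xi>\<bar> powr \<alpha> \<le> (1 + \<bar>\<xi>\<bar>) powr \<alpha>" using assms by (intro powr_mono2) auto
  ultimately have "(sqrt (sob \<alpha> \<xi>))\<^sup>2 \<le> (2 * (1 + \<bar>\<xi>\<bar>) powr (\<alpha> / 2))\<^sup>2"
    by (simp add: power_mult_distrib sq sob_def add_nonneg_nonneg)
  then have 1: "sqrt (sob \<alpha> \<xi>) \<le> 2 * (1 + \<bar>\<xi>\<bar>) powr (\<alpha> / 2)" by (rule power2_le_imp_le) simp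
  have 2: "cosh (\<sigma> * \<xi>) \<le> exp (\<sigma>0 * \<bar>\<xi>\<bar>)"
  proof -
    have "\<bar>\<sigma> * \<xi>\<bar> \<le> \<sigma>0 * \<bar>\<xi>\<bar>" using assms by (simp add: abs_mult mult_right_mono)
    then have "exp (\<sigma> * \<xi>) \<le> exp (\<sigma>0 * \<bar>\<xi>\<bar>)" "exp (- (\<sigma> * \<xi>)) \<le> exp (\<sigma>0 * \<bar>\<xi>\<bar>)" by auto
    then show ?thesis by (simp add: cosh_def del: exp_le_cancel_iff)
  qed
  have "wt \<alpha> \<sigma> \<xi> \<le> (2 * (1 + \<bar>\<xi>\<bar>) powr (\<alpha> / 2)) * exp (\<sigma>0 * \<bar>\<xi>\<bar>)"
    unfolding wt_def by (intro mult_mono 1 2) auto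
  then show ?thesis by simp
qed

text \<open>Applied to u t it gives membership in the Gevrey space; applied to differences of values
  of u it turns continuity of the weighted transform in \<open>ltwo\<close> into continuity in the
  Gevrey norm.\<close>

lemma gevrey_of_ltwo:
  assumes "0 \<le> \<alpha>" "0 \<le> \<sigma>" and f: "f \<in> L2" and FTf: "FT (lt f) = mult_op (wt_inv \<alpha> \<sigma>) W"
  shows "f \<in> gevrey \<sigma> (\<alpha> / 2)" "gevrey_norm \<sigma> (\<alpha> / 2) f \<le> (2 * 2 powr (\<alpha> / 2)) * norm W"
proof -
  note [measurable] = L2_measurable[OF lt_fourier(1)[OF f]]
  have "lt (fourier f) = lt (unweight \<alpha> \<sigma> W)"
    using lt_fourier(2)[OF f] FTf by (simp add: mult_op_wt_inv)
  then have "AE \<xi> in lborel. fourier f \<xi> = unweight \<alpha> \<sigma> W \<xi>"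
    using fn_lt[OF lt_fourier(1)[OF f]] fn_lt[OF unweight_L2[of \<alpha> \<sigma> W]] by (auto elim: eventually_elim2)
  then have le: "AE \<xi> in lborel. cmod (gevrey_weighted \<sigma> (\<alpha> / 2) f \<xi>) \<le> (2 * 2 powr (\<alpha> / 2)) * cmod (fn W \<xi>)"
  proof eventually_elim
    case (elim \<xi>)
    have "cmod (gevrey_weighted \<sigma> (\<alpha> / 2) f \<xi>) = ((1 + \<bar>\<xi>\<bar>) powr (\<alpha> / 2) * exp (\<sigma> * \<bar>\<xi>\<bar>)) * (cmod (fn W \<xi>) / wt \<alpha> \<sigma> \<xi>)"
      by (simp add: gevrey_weighted_def elim unweight_def norm_mult norm_divide)
    also have "\<dots> \<le> ((2 * 2 powr (\<alpha> / 2)) * wt \<alpha> \<sigma> \<xi>) * (cmod (fn W \<xi>) / wt \<alpha> \<sigma> \<xi>)"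
      by (intro mult_right_mono gevrey_weight_le assms) (simp add: less_imp_le)
    also have "\<dots> = (2 * 2 powr (\<alpha> / 2)) * cmod (fn W \<xi>)" by simp
    finally show ?case .
  qed
  have m: "gevrey_weighted \<sigma> (\<alpha> / 2) f \<in> borel_measurable borel"
    unfolding gevrey_weighted_def by measurable
  show "f \<in> gevrey \<sigma> (\<alpha> / 2)" "gevrey_norm \<sigma> (\<alpha> / 2) f \<le> (2 * 2 powr (\<alpha> / 2)) * norm W"
    using L2_bound[OF m fn_L2 le] f by (auto simp: gevrey_def gevrey_norm_def norm_ltwo)
qed

text \<open>The bounded operator \<open>FTinv \<circ> mult_op (wt_inv \<alpha> 0)\<close> carries
  \<open>duhamel\<close> to physical space: \<open>wt_inv\<close> commutes with the propagator
  because both are multipliers, and \<open>is_fourier_square\<close> identifies the quadratic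
  term.\<close>

lemma bbm_solution_of_fourier_side:
  fixes V :: "real \<Rightarrow> ltwo"
  assumes \<alpha>: "1 < \<alpha>" and cV: "continuous_on {0..} V" and r: "\<And>t. 0 \<le> t \<Longrightarrow> norm (V t) \<le> r"
    and V: "\<And>t. 0 \<le> t \<Longrightarrow> V t = V0 + integral {0..t} (\<lambda>s. bbm_field \<alpha> 0 (V s))"
    and u0: "u0 \<in> L2" "FT (lt u0) = mult_op (wt_inv \<alpha> 0) V0"
  shows "fractional_bbm_solution \<alpha> u0 (\<lambda>t. fn (FTinv (mult_op (wt_inv \<alpha> 0) (V t))))"
proof -
  define u where "u t = fn (FTinv (mult_op (wt_inv \<alpha> 0) (V t)))" for t
  note b = bbm_symbol_measurable[of \<alpha>] cmod_bbm_symbol_le[OF less_imp_le[OF \<alpha>]]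
  interpret R: bounded_linear "mult_op (wt_inv \<alpha> 0)" by (rule bounded_linear_mult_op[OF wt_inv_bounds])
  interpret FTinv: bounded_linear FTinv by (rule bounded_linear_FTinv)
  have comm: "mult_op (wt_inv \<alpha> 0) (mult_op (prop_symbol \<alpha> s) X) = mult_op (prop_symbol \<alpha> s) (mult_op (wt_inv \<alpha> 0) X)" for s X
    by (simp add: mult_op_mult_op[OF wt_inv_bounds prop_bounds] mult_op_mult_op[OF prop_bounds wt_inv_bounds] mult.commute)
  have pm: "fourier_multiplier (\<lambda>\<xi>. exp (- of_real s * bbm_symbol \<alpha> \<xi>)) = fourier_multiplier (prop_symbol \<alpha> s)" for s
    by (simp add: prop_symbol_def[abs_def])
  define G where "G t \<tau> = mult_op (prop_symbol \<alpha> (t - \<tau>)) (bil \<alpha> 0 (V \<tau>) (V \<tau>))" for t \<tau>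
  define f where "f t \<tau> = bbm_propagator \<alpha> (t - \<tau>) (fourier_multiplier (bbm_symbol \<alpha>) (\<lambda>x. (u \<tau> x)\<^sup>2))" for t \<tau>
  have f: "f t \<tau> \<in> L2" "lt (f t \<tau>) = FTinv ((1 / (2 * pi)) *\<^sub>R mult_op (wt_inv \<alpha> 0) (G t \<tau>))" for t \<tau>
  proof -
    define v where "v = unweight \<alpha> 0 (V \<tau>)"
    have "is_fourier (u \<tau>) v"
      unfolding is_fourier_iff u_def v_def by (simp add: unweight_L2 mult_op_wt_inv)
    then have sq: "is_fourier (\<lambda>x. (u \<tau> x)\<^sup>2) (\<lambda>\<xi>. convolution v v \<xi> / (2 * pi))"
      by (rule is_fourier_square) (simp add: v_def unweight_integrable \<alpha>)
    then have u2: "(\<lambda>x. (u \<tau> x)\<^sup>2) \<in> L2" and c2: "(\<lambda>\<xi>. convolution v v \<xi> / (2 * pi)) \<in> L2"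
      and FTu2: "FT (lt (\<lambda>x. (u \<tau> x)\<^sup>2)) = lt (\<lambda>\<xi>. convolution v v \<xi> / (2 * pi))"
      by (auto simp: is_fourier_iff)
    have "mult_op (bbm_symbol \<alpha>) (lt (\<lambda>\<xi>. convolution v v \<xi> / (2 * pi)))
      = lt (\<lambda>\<xi>. (1 / (2 * pi)) *\<^sub>R (wt_inv \<alpha> 0 \<xi> * bil_fun \<alpha> 0 (V \<tau>) (V \<tau>) \<xi>))"
      unfolding mult_op_lt[OF b c2]
      by (rule arg_cong[of _ _ lt]) (simp add: fun_eq_iff wt_inv_def bil_fun_def v_def scaleR_conv_of_real)
    also have "\<dots> = (1 / (2 * pi)) *\<^sub>R mult_op (wt_inv \<alpha> 0) (bil \<alpha> 0 (V \<tau>) (V \<tau>))"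
      unfolding bil_def mult_op_lt[OF wt_inv_bounds bil_fun_L2[OF \<alpha>]]
      by (rule lt_scaleR) (rule mult_op_L2(1)[OF wt_inv_bounds bil_fun_L2[OF \<alpha>]])
    finally have m: "mult_op (bbm_symbol \<alpha>) (FT (lt (\<lambda>x. (u \<tau> x)\<^sup>2))) = (1 / (2 * pi)) *\<^sub>R mult_op (wt_inv \<alpha> 0) (bil \<alpha> 0 (V \<tau>) (V \<tau>))"
      unfolding FTu2 .
    note M = lt_fourier_multiplier[OF b u2]
    show "f t \<tau> \<in> L2"
      unfolding f_def bbm_propagator_def pm by (rule lt_fourier_multiplier(1)[OF prop_bounds M(1)])
    have "lt (f t \<tau>) = FTinv (mult_op (prop_symbol \<alpha> (t - \<tau>)) ((1 / (2 * pi)) *\<^sub>R mult_op (wt_inv \<alpha> 0) (bil \<alpha> 0 (V \<tau>) (V \<tau>))))"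
      unfolding f_def bbm_propagator_def pm lt_fourier_multiplier(2)[OF prop_bounds M(1)] M(2) FT_FTinv m ..
    also have "\<dots> = FTinv ((1 / (2 * pi)) *\<^sub>R mult_op (wt_inv \<alpha> 0) (G t \<tau>))"
      unfolding G_def comm linear_scale[OF bounded_linear.linear[OF bounded_linear_mult_op[OF prop_bounds]]] ..
    finally show "lt (f t \<tau>) = FTinv ((1 / (2 * pi)) *\<^sub>R mult_op (wt_inv \<alpha> 0) (G t \<tau>))" .
  qed
  show ?thesis
    unfolding fractional_bbm_solution_def u_def[symmetric]
  proof (intro allI impI)
    fix t :: real assume t: "0 \<le> t"
    define X where "X = (- (4 * pi)) *\<^sub>R (V t - mult_op (prop_symbol \<alpha> t) V0)"
    have "continuous_on {0..t} V" by (rule continuous_on_subset[OF cV]) auto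
    then have "continuous_on {0..t} (\<lambda>s. bbm_field \<alpha> 0 (V s))"
      by (rule continuous_on_bbm_field[OF \<alpha>]) (use r in auto)
    from duhamel[OF \<alpha> t this, of V0] V
    have "(G t has_integral X) {0..t}" unfolding G_def X_def by auto
    then have "((\<lambda>\<tau>. FTinv ((1 / (2 * pi)) *\<^sub>R mult_op (wt_inv \<alpha> 0) (G t \<tau>))) has_integral
        FTinv ((1 / (2 * pi)) *\<^sub>R mult_op (wt_inv \<alpha> 0) X)) {0..t}"
      using has_integral_linear[OF _ bounded_linear_compose[OF bounded_linear_FTinv
          bounded_linear_compose[OF bounded_linear_scaleR_right R.bounded_linear_axioms]], of "G t" X "{0..t}" "1 / (2 * pi)"]
      by (simp add: o_def)
    then have I: "has_L2_integral (f t) (fn (FTinv ((1 / (2 * pi)) *\<^sub>R mult_op (wt_inv \<alpha> 0) X))) 0 t"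
      by (intro has_L2_integralI f(1)) (simp add: f(2))
    define p where "p = bbm_propagator \<alpha> t u0"
    have p: "p \<in> L2" "lt p = FTinv (mult_op (prop_symbol \<alpha> t) (mult_op (wt_inv \<alpha> 0) V0))"
      unfolding p_def bbm_propagator_def pm using lt_fourier_multiplier[OF prop_bounds u0(1)] by (simp_all add: u0(2))
    \<comment> \<open>The constants balance: 1/2 from the equation and 1 / (2 pi) from the
      convolution theorem cancel the 4 pi in X.\<close>
    have "FTinv (mult_op (wt_inv \<alpha> 0) (V t))
        = lt p - (1 / 2) *\<^sub>R FTinv ((1 / (2 * pi)) *\<^sub>R mult_op (wt_inv \<alpha> 0) X)"
      by (simp add: p(2) X_def R.scaleR R.diff R.neg FTinv.scaleR FTinv.diff FTinv.neg comm)
    then have eq: "FTinv (mult_op (wt_inv \<alpha> 0) (V t)) - lt p + (1 / 2) *\<^sub>R FTinv ((1 / (2 * pi)) *\<^sub>R mult_op (wt_inv \<alpha> 0) X) = 0"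
      by simp
    have "AE x in lborel. u t x = p x - (1 / 2) * fn (FTinv ((1 / (2 * pi)) *\<^sub>R mult_op (wt_inv \<alpha> 0) X)) x"
    proof -
      define Y where "Y = FTinv ((1 / (2 * pi)) *\<^sub>R mult_op (wt_inv \<alpha> 0) X)"
      define Z where "Z = FTinv (mult_op (wt_inv \<alpha> 0) (V t))"
      have "Z = lt p - (1 / 2) *\<^sub>R Y" using eq by (simp add: Y_def Z_def algebra_simps)
      then have "AE x in lborel. fn Z x = fn (lt p - (1 / 2) *\<^sub>R Y) x" by simp
      then have "AE x in lborel. fn Z x = p x - (1 / 2) * fn Y x"
        using fn_diff[of "lt p" "(1 / 2) *\<^sub>R Y"] fn_scaleR[of "1 / 2" Y] fn_lt[OF p(1)]
        by eventually_elim (simp add: scaleR_conv_of_real)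
      then show ?thesis by (simp add: u_def Y_def Z_def)
    qed
    with I show "\<exists>I. has_L2_integral (\<lambda>\<tau>. bbm_propagator \<alpha> (t - \<tau>) (fourier_multiplier (bbm_symbol \<alpha>) (\<lambda>x. (u \<tau> x)\<^sup>2))) I 0 t \<and>
        (AE x in lborel. u t x = bbm_propagator \<alpha> t u0 x - 1 / 2 * I x)"
      unfolding f_def p_def by blast
  qed
qed

section \<open>Initial data, choice of constants and conclusion\<close>

lemma decay_exponent_pos: "1 < \<alpha> \<Longrightarrow> 0 < decay_exponent \<alpha>"
  by (simp add: decay_exponent_def)

text \<open>All sigma up to \<open>\<sigma>0\<close> share one bound in terms of the norm with
  \<open>\<sigma>0\<close>, so the radius of the ball can be chosen independently of T. Real values
  enter through \<open>cj (lt f) = lt f\<close>, which \<open>herm_FT\<close> turns into the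
  symmetry of W.\<close>

lemma gevrey_initial_data:
  fixes u0 :: "real \<Rightarrow> real"
  defines "f \<equiv> (\<lambda>x. complex_of_real (u0 x))"
  assumes \<alpha>: "0 \<le> \<alpha>" and f: "f \<in> gevrey \<sigma>0 (\<alpha> / 2)" and \<sigma>: "0 \<le> \<sigma>" "\<sigma> \<le> \<sigma>0"
  defines "W \<equiv> lt (\<lambda>\<xi>. of_real (wt \<alpha> \<sigma> \<xi>) * fourier f \<xi>)"
  shows "norm W \<le> 2 * gevrey_norm \<sigma>0 (\<alpha> / 2) f" "herm W = W" "FT (lt f) = mult_op (wt_inv \<alpha> \<sigma>) W"
    "mult_op (cosh_inv \<sigma>) W = lt (\<lambda>\<xi>. of_real (wt \<alpha> 0 \<xi>) * fourier f \<xi>)"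
proof -
  have fL2: "f \<in> L2" and gL2: "gevrey_weighted \<sigma>0 (\<alpha> / 2) f \<in> L2" using f by (auto simp: gevrey_def)
  note F = lt_fourier[OF fL2]
  note [measurable] = L2_measurable[OF F(1)]
  define w where "w \<xi> = of_real (wt \<alpha> \<sigma> \<xi>) * fourier f \<xi>" for \<xi>
  have m: "w \<in> borel_measurable borel" unfolding w_def by measurable
  have le: "AE \<xi> in lborel. cmod (w \<xi>) \<le> 2 * cmod (gevrey_weighted \<sigma>0 (\<alpha> / 2) f \<xi>)"
  proof (rule AE_I2)
    fix \<xi>
    have "cmod (w \<xi>) = wt \<alpha> \<sigma> \<xi> * cmod (fourier f \<xi>)" by (simp add: w_def norm_mult)
    also have "\<dots> \<le> 2 * ((1 + \<bar>\<xi>\<bar>) powr (\<alpha> / 2) * exp (\<sigma>0 * \<bar>\<xi>\<bar>)) * cmod (fourier f \<xi>)"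
      by (intro mult_right_mono wt_le_gevrey_weight \<alpha> \<sigma>) simp
    also have "\<dots> = 2 * cmod (gevrey_weighted \<sigma>0 (\<alpha> / 2) f \<xi>)"
      by (simp add: gevrey_weighted_def norm_mult)
    finally show "cmod (w \<xi>) \<le> 2 * cmod (gevrey_weighted \<sigma>0 (\<alpha> / 2) f \<xi>)" .
  qed
  have w: "w \<in> L2" "L2_norm w \<le> 2 * L2_norm (gevrey_weighted \<sigma>0 (\<alpha> / 2) f)"
    using L2_bound[OF m gL2 le] by auto
  have W: "W = lt w" by (simp add: W_def w_def[abs_def])
  show "norm W \<le> 2 * gevrey_norm \<sigma>0 (\<alpha> / 2) f"
    unfolding W norm_lt[OF w(1)] gevrey_norm_def by (rule w(2))
  have "cj (lt f) = lt f" unfolding cj_lt[OF fL2] by (simp add: f_def)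
  then have hF: "herm (lt (fourier f)) = lt (fourier f)" unfolding F(2) herm_FT by simp
  have "AE \<xi> in lborel. cnj (fourier f (- \<xi>)) = fourier f \<xi>"
    using hF unfolding herm_lt[OF F(1)]
    using fn_lt[OF F(1)] fn_lt[OF L2_cnj[OF L2_reflect0[OF F(1)]]] by (auto elim: eventually_elim2)
  then have "AE \<xi> in lborel. cnj (w (- \<xi>)) = w \<xi>"
    by eventually_elim (simp add: w_def)
  then show "herm W = W"
    unfolding W herm_lt[OF w(1)] by (intro lt_eqI L2_cnj L2_reflect0 w(1))
  show "FT (lt f) = mult_op (wt_inv \<alpha> \<sigma>) W"
    unfolding W mult_op_lt[OF wt_inv_bounds w(1)] F(2)[symmetric]
    by (rule arg_cong[of _ _ lt]) (simp add: fun_eq_iff w_def wt_inv_def)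
  show "mult_op (cosh_inv \<sigma>) W = lt (\<lambda>\<xi>. of_real (wt \<alpha> 0 \<xi>) * fourier f \<xi>)"
    unfolding W mult_op_lt[OF cosh_inv_bounds w(1)]
    by (rule arg_cong[of _ _ lt]) (simp add: fun_eq_iff w_def cosh_inv_def wt_def)
qed

theorem theorem4p1:
  fixes \<alpha> :: real
  assumes "\<alpha> > 1"
  shows "\<exists>c :: real \<Rightarrow> real \<Rightarrow> real.
    \<forall>(\<sigma>\<^sub>0 :: real) (u\<^sub>0 :: real \<Rightarrow> real).
      \<sigma>\<^sub>0 > 0 \<and> (\<lambda>x. complex_of_real (u\<^sub>0 x)) \<in> gevrey \<sigma>\<^sub>0 (\<alpha> / 2) \<longrightarrow>
      (let C = c \<sigma>\<^sub>0 (gevrey_norm \<sigma>\<^sub>0 (\<alpha> / 2) (\<lambda>x. complex_of_real (u\<^sub>0 x))) in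
        C > 0 \<and>
        (\<exists>(\<sigma> :: real \<Rightarrow> real) (u :: real \<Rightarrow> real \<Rightarrow> complex).
           (\<forall>t\<ge>0. \<sigma> t > 0) \<and> antimono_on {0..} \<sigma> \<and>
           continuous_gevrey \<sigma> (\<alpha> / 2) u \<and>
           fractional_bbm_solution \<alpha> (\<lambda>x. complex_of_real (u\<^sub>0 x)) u \<and>
           (\<forall>\<^sub>F t in at_top. \<sigma> t \<ge> C * t powr (- decay_exponent \<alpha>))))"
proof -
  obtain D where D: "D \<ge> 0" and sol: "\<And>\<sigma> r V0. 0 \<le> \<sigma> \<Longrightarrow> 0 < r \<Longrightarrow> norm V0 \<le> r / 2 \<Longrightarrow> herm V0 = V0 \<Longrightarrow>
    \<exists>V. continuous_on {0..} V \<and> (\<forall>T\<ge>0. 8 * T * (D * \<sigma> powr (1 / decay_exponent \<alpha>)) * r \<le> 1 \<longrightarrow>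
      (\<forall>t\<in>{0..T}. norm (V t) \<le> r \<and> V t = V0 + integral {0..t} (\<lambda>s. bbm_field \<alpha> \<sigma> (V s))))"
    by (rule bbm_ode_solution[OF assms]) blast
  define \<mu> where "\<mu> = decay_exponent \<alpha>"
  have \<mu>: "\<mu> > 0" unfolding \<mu>_def by (rule decay_exponent_pos[OF assms])
  \<comment> \<open>Half of this exceeds the bound 2 N of \<open>gevrey_initial_data\<close>; the
    summand 1 keeps the radius positive for zero data.\<close>
  define r where "r N = 4 * N + 1" for N :: real
  \<comment> \<open>The first argument of \<open>min\<close> keeps sigma below
    \<open>\<sigma>0\<close>. The second makes the condition on T hold at every T, given that
    sigma(T)^(1/mu) is c^(1/mu) / (1 + T). The 1 in D + 1 covers D = 0, where the power would be
    0.\<close>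
  define c where "c \<sigma>0 N = min \<sigma>0 ((8 * (D + 1) * r N) powr (- \<mu>))" for \<sigma>0 N
  show ?thesis
  \<comment> \<open>The factor 2^(-mu) pays for replacing (1 + t)^(-mu) by t^(-mu) once t >=
    1.\<close>
  proof (intro exI[of _ "\<lambda>\<sigma>0 N. c \<sigma>0 N * 2 powr (- \<mu>)"] allI impI, unfold Let_def, elim conjE, intro conjI)
    fix \<sigma>\<^sub>0 :: real and u\<^sub>0 :: "real \<Rightarrow> real"
    define f where "f = (\<lambda>x. complex_of_real (u\<^sub>0 x))"
    assume \<sigma>0: "\<sigma>\<^sub>0 > 0" and u0: "(\<lambda>x. complex_of_real (u\<^sub>0 x)) \<in> gevrey \<sigma>\<^sub>0 (\<alpha> / 2)"
    note f = u0[folded f_def]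
    define N where "N = gevrey_norm \<sigma>\<^sub>0 (\<alpha> / 2) f"
    have N: "N \<ge> 0" by (simp add: N_def gevrey_norm_def)
    define R where "R = r N"
    have R: "R > 0" using N by (simp add: R_def r_def)
    define c0 where "c0 = c \<sigma>\<^sub>0 N"
    have c0: "c0 > 0" "c0 \<le> \<sigma>\<^sub>0" "c0 \<le> (8 * (D + 1) * R) powr (- \<mu>)"
      using \<sigma>0 D R by (auto simp: c0_def c_def R_def)
    then show "c \<sigma>\<^sub>0 (gevrey_norm \<sigma>\<^sub>0 (\<alpha> / 2) (\<lambda>x. complex_of_real (u\<^sub>0 x))) * 2 powr (- \<mu>) > 0"
      by (simp add: c0_def N_def f_def)
    \<comment> \<open>Using 1 + t instead of t keeps sigma bounded by \<open>c0\<close> down to t =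
      0.\<close>
    define \<sigma> where "\<sigma> t = c0 * (1 + t) powr (- \<mu>)" for t
    have \<sigma>_pos: "\<sigma> t > 0" if "t \<ge> 0" for t using c0 that by (simp add: \<sigma>_def)
    have \<sigma>_le: "\<sigma> t \<le> \<sigma>\<^sub>0" if "t \<ge> 0" for t
    proof -
      have "(1 + t) powr (- \<mu>) \<le> 1 powr (- \<mu>)" using that \<mu> by (intro powr_mono2') auto
      then have "c0 * (1 + t) powr (- \<mu>) \<le> c0 * 1" using c0 by (intro mult_left_mono) auto
      also have "\<dots> \<le> \<sigma>\<^sub>0" using c0 by simp
      finally show ?thesis by (simp only: \<sigma>_def)
    qed
    have small: "8 * T * (D * \<sigma> T powr (1 / decay_exponent \<alpha>)) * R \<le> 1" if T: "T \<ge> 0" for T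
    proof -
      have "\<sigma> T powr (1 / \<mu>) = c0 powr (1 / \<mu>) * (1 + T) powr (- 1)"
        using c0 \<mu> by (simp add: \<sigma>_def powr_mult powr_powr)
      also have "\<dots> \<le> ((8 * (D + 1) * R) powr (- \<mu>)) powr (1 / \<mu>) * (1 + T) powr (- 1)"
        using c0 \<mu> by (intro mult_right_mono powr_mono2) auto
      also have "((8 * (D + 1) * R) powr (- \<mu>)) powr (1 / \<mu>) = (8 * (D + 1) * R) powr (- 1)"
        using \<mu> by (simp add: powr_powr)
      also have "(8 * (D + 1) * R) powr (- 1) * (1 + T) powr (- 1) = 1 / ((8 * (D + 1) * R) * (1 + T))"
        using D R T by (simp add: powr_minus_divide)
      finally have "8 * T * (D * \<sigma> T powr (1 / \<mu>)) * R \<le> 8 * T * (D * (1 / ((8 * (D + 1) * R) * (1 + T)))) * R"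
        using T D R by (intro mult_right_mono mult_left_mono) auto
      also have "\<dots> = ((8 * R) * (D * T)) / ((8 * R) * ((D + 1) * (1 + T)))"
        by (simp only: times_divide_eq_right times_divide_eq_left mult_1_right mult_ac)
      also have "\<dots> = (D * T) / ((D + 1) * (1 + T))"
        by (rule mult_divide_mult_cancel_left) (use R in simp)
      also have "\<dots> \<le> 1"
      proof -
        have "D * T \<le> (D + 1) * (1 + T)" using D T by (intro mult_mono) auto
        moreover have "0 < (D + 1) * (1 + T)" using D T by (intro mult_pos_pos) auto
        ultimately show ?thesis by simp
      qed
      finally show ?thesis unfolding \<mu>_def .
    qed
    define W0 where "W0 s = lt (\<lambda>\<xi>. of_real (wt \<alpha> s \<xi>) * fourier f \<xi>)" for s
    have \<alpha>0: "0 \<le> \<alpha>" using assms by simp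
    have W0: "norm (W0 s) \<le> R / 2" "herm (W0 s) = W0 s" "FT (lt f) = mult_op (wt_inv \<alpha> s) (W0 s)"
        "mult_op (cosh_inv s) (W0 s) = W0 0" if s: "0 \<le> s" "s \<le> \<sigma>\<^sub>0" for s
      using gevrey_initial_data[OF \<alpha>0 f[unfolded f_def] s] N
      unfolding W0_def N_def R_def r_def f_def by simp_all
    have W00: "norm (W0 0) \<le> R / 2" "herm (W0 0) = W0 0" "FT (lt f) = mult_op (wt_inv \<alpha> 0) (W0 0)"
      using W0[of 0] \<sigma>0 by auto
    \<comment> \<open>The solution for sigma = 0 is controlled at all times and alone defines
      u.\<close>
    obtain V where V: "continuous_on {0..} V" and V': "\<forall>T\<ge>0. 8 * T * (D * 0 powr (1 / decay_exponent \<alpha>)) * R \<le> 1 \<longrightarrow>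
      (\<forall>t\<in>{0..T}. norm (V t) \<le> R \<and> V t = W0 0 + integral {0..t} (\<lambda>s. bbm_field \<alpha> 0 (V s)))"
      using sol[OF order_refl R W00(1,2)] by blast
    have Vt: "norm (V t) \<le> R \<and> V t = W0 0 + integral {0..t} (\<lambda>s. bbm_field \<alpha> 0 (V s))" if "0 \<le> t" for t
      by (rule V'[rule_format, of t t]) (use that in auto)
    note Vr = conjunct1[OF Vt] and Veq = conjunct2[OF Vt]
    define u where "u t = fn (FTinv (mult_op (wt_inv \<alpha> 0) (V t)))" for t
    have uL2: "u t \<in> L2" and FTu: "FT (lt (u t)) = mult_op (wt_inv \<alpha> 0) (V t)" for t
      by (simp_all add: u_def)
    \<comment> \<open>For each T a separate solution with the fixed weight sigma(T) is compared with
      V on [0,T]. By \<open>small\<close> it obeys the equation up to T, and its continuity is the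
      continuity of u in the Gevrey space of exponent sigma(T).\<close>
    have reg: "\<exists>W. continuous_on {0..T} W \<and> (\<forall>t\<in>{0..T}. FT (lt (u t)) = mult_op (wt_inv \<alpha> (\<sigma> T)) (W t))"
      if T: "T \<ge> 0" for T
    proof -
      note s = less_imp_le[OF \<sigma>_pos[OF T]] \<sigma>_le[OF T]
      obtain W where W: "continuous_on {0..} W" and W': "\<forall>S\<ge>0. 8 * S * (D * \<sigma> T powr (1 / decay_exponent \<alpha>)) * R \<le> 1 \<longrightarrow>
        (\<forall>t\<in>{0..S}. norm (W t) \<le> R \<and> W t = W0 (\<sigma> T) + integral {0..t} (\<lambda>s. bbm_field \<alpha> (\<sigma> T) (W s)))"
        using sol[OF s(1) R W0(1,2)[OF s]] by blast
      note Wt = W'[rule_format, OF T small[OF T]]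
      note Wr = conjunct1[OF Wt] and Weq = conjunct2[OF Wt]
      have cW: "continuous_on {0..T} W" by (rule continuous_on_subset[OF W]) auto
      have cV: "continuous_on {0..T} V" by (rule continuous_on_subset[OF V]) auto
      have "mult_op (cosh_inv (\<sigma> T)) (W t) = V t" if "t \<in> {0..T}" for t
        by (rule bbm_solution_regularity[OF assms T R cV _ _ cW Wr Weq W0(4)[OF s] that]) (auto intro: Vr Veq)
      then have "FT (lt (u t)) = mult_op (wt_inv \<alpha> (\<sigma> T)) (W t)" if "t \<in> {0..T}" for t
        unfolding FTu mult_op_wt_inv_cosh_inv[of \<alpha> "\<sigma> T", symmetric] using that by simp
      with cW show ?thesis by blast
    qed
    show "\<exists>\<sigma> u. (\<forall>t\<ge>0. \<sigma> t > 0) \<and> antimono_on {0..} \<sigma> \<and>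
           continuous_gevrey \<sigma> (\<alpha> / 2) u \<and>
           fractional_bbm_solution \<alpha> (\<lambda>x. complex_of_real (u\<^sub>0 x)) u \<and>
           (\<forall>\<^sub>F t in at_top. \<sigma> t \<ge> c \<sigma>\<^sub>0 (gevrey_norm \<sigma>\<^sub>0 (\<alpha> / 2) (\<lambda>x. complex_of_real (u\<^sub>0 x))) * 2 powr (- \<mu>) * t powr (- decay_exponent \<alpha>))"
      unfolding f_def[symmetric] N_def[symmetric] c0_def[symmetric] \<mu>_def[symmetric]
    proof (intro exI[of _ \<sigma>] exI[of _ u] conjI)
      show "\<forall>t\<ge>0. \<sigma> t > 0" using \<sigma>_pos by blast
      show "antimono_on {0..} \<sigma>"
      proof (rule monotone_onI)
        fix s t :: real assume "s \<in> {0..}" "t \<in> {0..}" "s \<le> t"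
        then have "(1 + t) powr (- \<mu>) \<le> (1 + s) powr (- \<mu>)" using \<mu> by (intro powr_mono2') auto
        then show "\<sigma> t \<le> \<sigma> s" using c0 by (simp add: \<sigma>_def)
      qed
      show "continuous_gevrey \<sigma> (\<alpha> / 2) u"
        unfolding continuous_gevrey_def
      proof (intro conjI allI impI ballI)
        fix t :: real assume t: "t \<ge> 0"
        obtain W where "FT (lt (u t)) = mult_op (wt_inv \<alpha> (\<sigma> t)) (W t)" using reg[OF t] t by auto
        then show "u t \<in> gevrey (\<sigma> t) (\<alpha> / 2)"
          by (rule gevrey_of_ltwo(1)[OF \<alpha>0 less_imp_le[OF \<sigma>_pos[OF t]] uL2])
      next
        fix T t :: real assume T: "T > 0" and t: "t \<in> {0..T}"
        note T' = less_imp_le[OF T] and s = less_imp_le[OF \<sigma>_pos[OF less_imp_le[OF T]]]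
        obtain W where W: "continuous_on {0..T} W" "\<And>t. t \<in> {0..T} \<Longrightarrow> FT (lt (u t)) = mult_op (wt_inv \<alpha> (\<sigma> T)) (W t)"
          using reg[OF T'] by blast
        show "u t \<in> gevrey (\<sigma> T) (\<alpha> / 2)"
          by (rule gevrey_of_ltwo(1)[OF \<alpha>0 s uL2 W(2)[OF t]])
        interpret Q: bounded_linear "mult_op (wt_inv \<alpha> (\<sigma> T))" by (rule bounded_linear_mult_op[OF wt_inv_bounds])
        have "gevrey_norm (\<sigma> T) (\<alpha> / 2) (\<lambda>x. u q x - u t x) \<le> (2 * 2 powr (\<alpha> / 2)) * norm (W q - W t)" if q: "q \<in> {0..T}" for q
        proof (rule gevrey_of_ltwo(2)[OF \<alpha>0 s])
          show "(\<lambda>x. u q x - u t x) \<in> L2" by (rule L2_diff[OF uL2 uL2])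
          show "FT (lt (\<lambda>x. u q x - u t x)) = mult_op (wt_inv \<alpha> (\<sigma> T)) (W q - W t)"
            unfolding lt_diff[OF uL2 uL2] linear_diff[OF linear_FT] W(2)[OF q] W(2)[OF t] Q.diff ..
        qed
        then have "\<forall>\<^sub>F q in at t within {0..T}. norm (gevrey_norm (\<sigma> T) (\<alpha> / 2) (\<lambda>x. u q x - u t x)) \<le> (2 * 2 powr (\<alpha> / 2)) * norm (W q - W t)"
          unfolding eventually_at_filter by (auto intro!: always_eventually simp: gevrey_norm_def)
        moreover have "((\<lambda>q. (2 * 2 powr (\<alpha> / 2)) * norm (W q - W t)) \<longlongrightarrow> (2 * 2 powr (\<alpha> / 2)) * norm (W t - W t)) (at t within {0..T})"
          using W(1) t by (intro tendsto_intros) (auto simp: continuous_on_def)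
        then have "((\<lambda>q. (2 * 2 powr (\<alpha> / 2)) * norm (W q - W t)) \<longlongrightarrow> 0) (at t within {0..T})" by simp
        ultimately show "((\<lambda>q. gevrey_norm (\<sigma> T) (\<alpha> / 2) (\<lambda>x. u q x - u t x)) \<longlongrightarrow> 0) (at t within {0..T})"
          by (rule Lim_null_comparison)
      qed
      show "fractional_bbm_solution \<alpha> f u"
        unfolding u_def
      proof (rule bbm_solution_of_fourier_side[OF assms V _ _ _ W00(3)])
        show "f \<in> L2" using f by (simp add: gevrey_def)
      qed (use Vr Veq in auto)
      show "\<forall>\<^sub>F t in at_top. \<sigma> t \<ge> c0 * 2 powr (- \<mu>) * t powr (- \<mu>)"
      proof (rule eventually_at_top_linorderI[of 1])
        fix t :: real assume t: "1 \<le> t"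
        have "(2 * t) powr (- \<mu>) \<le> (1 + t) powr (- \<mu>)" using t \<mu> by (intro powr_mono2') auto
        then have "c0 * (2 powr (- \<mu>) * t powr (- \<mu>)) \<le> c0 * (1 + t) powr (- \<mu>)"
          using c0 t by (intro mult_left_mono) (auto simp: powr_mult)
        then show "\<sigma> t \<ge> c0 * 2 powr (- \<mu>) * t powr (- \<mu>)" by (simp add: \<sigma>_def mult_ac)
      qed
    qed
  qed
qed

end
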